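(* Let $d_1\ge1$, $d_2\ge2$, write $(x,y)=(x,y_1,y')\in\mathbb{R}^{d_1}\times\mathbb{R}\times\mathbb{R}^{d_2-1}$, let $0<\varepsilon\le1$ and define the ellipsoid $$Z_\varepsilon=\Bigl\{(x,y):\ y_1=0,\ |x|^2+\frac{|y'|^2}{\varepsilon^2}<1\Bigr\}$$ in the Cauchy hypersurface $\{y_1=0\}$. If $u$ is a $C^2$ solution of $\Delta_xu-\Delta_yu=\sum_{j=1}^{d_1}\partial_{x_j}^2u-\sum_{j=1}^{d_2}\partial_{y_j}^2u=0$ whose Cauchy data $u(x,0,y')$, $\partial_{y_1}u(x,0,y')$ vanish on $Z_\varepsilon$, then $u$ vanishes on $$D=\{(x,y)\in\mathbb{R}^{d_1+d_2}:\ |x|+|y|<1\},$$ and in particular its Cauchy data, along with all their derivatives, vanish on $\{(x,y')\ :\ y_1=0,\ |x|+|y'|<1\}$. *)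

theory Defs
  imports "HOL-Analysis.Analysis"
begin

text \<open>Points of R^{d1} x R^{d2} are written (x, (y1, y')) with
  x :: real^'n  (d1 = CARD('n) >= 1),  y1 :: real,  y' :: real^'m  (d2 = CARD('m) + 1 >= 2).\<close>

type_synonym ('n, 'm) pt = "(real^'n) \<times> (real \<times> (real^'m))"

definition dirderiv :: "('a::real_normed_vector \<Rightarrow> real) \<Rightarrow> 'a \<Rightarrow> 'a \<Rightarrow> real" where
  "dirderiv f v p = deriv (\<lambda>t. f (p + t *\<^sub>R v)) 0"

definition C2 :: "('a::euclidean_space \<Rightarrow> real) \<Rightarrow> bool" where
  "C2 f \<longleftrightarrow> continuous_on UNIV f \<and>
     (\<forall>v\<in>Basis. (\<forall>p. (\<lambda>t. f (p + t *\<^sub>R v)) differentiable (at 0)) \<and>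
                continuous_on UNIV (dirderiv f v) \<and>
       (\<forall>w\<in>Basis. (\<forall>p. (\<lambda>t. dirderiv f v (p + t *\<^sub>R w)) differentiable (at 0)) \<and>
                  continuous_on UNIV (dirderiv (dirderiv f v) w)))"

definition xdir :: "'n \<Rightarrow> ('n::finite, 'm::finite) pt" where
  "xdir i = (axis i 1, (0, 0))"

definition y1dir :: "('n::finite, 'm::finite) pt" where
  "y1dir = (0, (1, 0))"

definition ypdir :: "'m \<Rightarrow> ('n::finite, 'm::finite) pt" where
  "ypdir j = (0, (0, axis j 1))"

definition ultrahyp :: "(('n::finite, 'm::finite) pt \<Rightarrow> real) \<Rightarrow> ('n, 'm) pt \<Rightarrow> real" where
  "ultrahyp u p =
     (\<Sum>i\<in>UNIV. dirderiv (dirderiv u (xdir i)) (xdir i) p)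
     - dirderiv (dirderiv u y1dir) y1dir p
     - (\<Sum>j\<in>UNIV. dirderiv (dirderiv u (ypdir j)) (ypdir j) p)"

end

theory Submission
  imports Defs "HOL-Complex_Analysis.Cauchy_Integral_Formula"
begin

text \<open>
  The core is a sharp local uniqueness statement: if the Cauchy data of \<open>u\<close> vanish on the hyperplane
  through \<open>(x\<^sub>0, y\<^sub>0)\<close> with conormal \<open>e\<close> in the \<open>y\<close>-space, for \<open>|x - x\<^sub>0|\<^sup>2 + |y - y\<^sub>0|\<^sup>2 / 2 < r\<^sup>2\<close>,
  then \<open>u(x\<^sub>0, y\<^sub>0 + T e) = 0\<close> for \<open>0 < T < r\<close>. To see it, integrate a cut-off of \<open>u(t, \<cdot>)\<close> against the
  Gaussian \<open>h\<^sub>\<zeta> = (\<zeta> + 2\<delta>)\<^bsup>-d/2\<^esup> (1 - \<zeta>)\<^bsup>-m/2\<^esup> exp(- \<Lambda> (|x|\<^sup>2 / (\<zeta> + 2\<delta>) + |y|\<^sup>2 / (1 - \<zeta>)))\<close>, for which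
  \<open>(\<Delta>\<^sub>x - \<Delta>\<^sub>y) h\<^sub>\<zeta> = 4 \<Lambda> \<partial>\<^sub>\<zeta> h\<^sub>\<zeta>\<close>. The integral \<open>I(t, \<zeta>)\<close> is holomorphic in \<open>\<zeta>\<close> and solves
  \<open>\<partial>\<^sub>t\<^sup>2 I = 4 \<Lambda> \<partial>\<^sub>\<zeta> I\<close> up to a cut-off error; pairing it with an explicit kernel over a circle in the
  \<open>\<zeta>\<close>-plane bounds \<open>I(T, 0)\<close> by an exponentially small quantity as \<open>\<Lambda> \<rightarrow> \<infinity>\<close>, whereas \<open>I(T, 0)\<close> is only
  polynomially small if \<open>u(T, 0) \<noteq> 0\<close>.

  Applied to the ellipsoid this gives \<open>u = 0\<close> on the cone \<open>|y| < \<kappa> (1 - |x|)\<close> with \<open>\<kappa> = \<epsilon> / 6\<close>. If \<open>u\<close>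
  vanishes on such a cone with \<open>\<kappa> < 1\<close>, then local uniqueness starting from the chords orthogonal to
  \<open>y\<close> inside the cone enlarges \<open>\<kappa>\<close>: the height reached equals the radius used, to first order, and the
  boundary of the cone falls more slowly than that. Hence the supremum of all such \<open>\<kappa>\<close> is \<open>1\<close>.
\<close>

section \<open>A Cauchy problem holomorphic in one variable\<close>

text \<open>For z = s^2 this is exp(s^2) / s times the integral of exp(- p^2) over [0, s], a Dawson
  function divided by its argument. Rescaling the integral to [0, 1] makes it entire in z, with no
  square root of z to choose.\<close>

definition dawson :: "complex \<Rightarrow> complex" where
  "dawson z = integral {0..1} (\<lambda>q. exp (z * of_real (1 - q\<^sup>2)))"

lemma dawson_has_field_derivative:
  "(dawson has_field_derivative integral {0..1} (\<lambda>q. of_real (1 - q\<^sup>2) * exp (z * of_real (1 - q\<^sup>2)))) (at z)"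
proof -
  have "((\<lambda>z. integral (cbox 0 1) (\<lambda>q::real. exp (z * of_real (1 - q\<^sup>2)))) has_field_derivative
     integral (cbox 0 1) (\<lambda>q. of_real (1 - q\<^sup>2) * exp (z * of_real (1 - q\<^sup>2)))) (at z within UNIV)"
    by (rule leibniz_rule_field_derivative)
      (auto intro!: derivative_eq_intros integrable_continuous_real continuous_intros simp: split_beta simp del: of_real_diff of_real_power)
  then show ?thesis unfolding dawson_def[abs_def] by simp
qed

lemma dawson_holomorphic: "dawson holomorphic_on S"
  using dawson_has_field_derivative by (meson holomorphic_onI field_differentiable_def field_differentiable_at_within)

lemma dawson_deriv: "(dawson has_field_derivative deriv dawson z) (at z)"
  by (metis DERIV_imp_deriv dawson_has_field_derivative)

text \<open>Integrate the derivative of q exp(z (1 - q^2)) over [0, 1]: the boundary terms give 1,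
  and q^2 = 1 - (1 - q^2) turns the integrand into a combination of those of \<open>dawson\<close>
  and its derivative. The left side is the combination in which \<open>deriv dawson\<close> enters
  when \<open>time_kernel\<close> is differentiated, so that it can be eliminated there.\<close>

lemma dawson_ode: "2 * z * deriv dawson z + dawson z = 1 + 2 * z * dawson z"
proof -
  have d: "deriv dawson z = integral {0..1} (\<lambda>q. of_real (1 - q\<^sup>2) * exp (z * of_real (1 - q\<^sup>2)))"
    by (rule DERIV_imp_deriv) (rule dawson_has_field_derivative)
  have "((\<lambda>q::real. exp (z * of_real (1 - q\<^sup>2)) + of_real q * (exp (z * of_real (1 - q\<^sup>2)) * (- 2 * z * of_real q)))
     has_integral (of_real 1 * exp (z * of_real (1 - 1\<^sup>2)) - of_real 0 * exp (z * of_real (1 - 0\<^sup>2)))) {0..1}"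
  proof (rule fundamental_theorem_of_calculus)
    fix x :: real
    have "((\<lambda>w. w * exp (z * (1 - w\<^sup>2))) has_field_derivative
        exp (z * of_real (1 - x\<^sup>2)) + of_real x * (exp (z * of_real (1 - x\<^sup>2)) * (- 2 * z * of_real x))) (at (of_real x))"
      by (auto intro!: derivative_eq_intros simp: algebra_simps)
    from has_vector_derivative_real_field[OF this]
    show "((\<lambda>x::real. of_real x * exp (z * of_real (1 - x\<^sup>2))) has_vector_derivative
        exp (z * of_real (1 - x\<^sup>2)) + of_real x * (exp (z * of_real (1 - x\<^sup>2)) * (- 2 * z * of_real x))) (at x within {0..1})"
      by simp
  qed simp
  then have 1: "integral {0..1} (\<lambda>q::real. exp (z * of_real (1 - q\<^sup>2)) + of_real q * (exp (z * of_real (1 - q\<^sup>2)) * (- 2 * z * of_real q))) = 1"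
    by (simp add: integral_unique)
  have i1: "(\<lambda>q::real. exp (z * of_real (1 - q\<^sup>2))) integrable_on {0..1}"
    and i2: "(\<lambda>q::real. of_real (1 - q\<^sup>2) * exp (z * of_real (1 - q\<^sup>2))) integrable_on {0..1}"
    by (auto intro!: integrable_continuous_real continuous_intros)
  have "(\<lambda>q::real. exp (z * of_real (1 - q\<^sup>2)) + of_real q * (exp (z * of_real (1 - q\<^sup>2)) * (- 2 * z * of_real q)))
     = (\<lambda>q. (1 - 2 * z) * exp (z * of_real (1 - q\<^sup>2)) + (2 * z) * (of_real (1 - q\<^sup>2) * exp (z * of_real (1 - q\<^sup>2))))"
    by (auto simp: fun_eq_iff algebra_simps power2_eq_square)
  with 1 have "(1 - 2 * z) * dawson z + (2 * z) * deriv dawson z = 1"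
    unfolding d dawson_def using i1 i2
    by (simp add: integral_add integrable_on_mult_right integral_mult_right del: of_real_diff of_real_power)
  then show ?thesis by (simp add: algebra_simps)
qed

lemma norm_dawson_le:
  assumes "Re z \<le> B" "0 \<le> B"
  shows "norm (dawson z) \<le> exp B"
proof -
  have "norm (integral (cbox 0 1) (\<lambda>q::real. exp (z * of_real (1 - q\<^sup>2)))) \<le> exp B * measure lborel (cbox 0 (1::real))"
  proof (rule integrable_bound)
    show "(\<lambda>q::real. exp (z * of_real (1 - q\<^sup>2))) integrable_on cbox 0 1"
      by (auto intro!: integrable_continuous_real continuous_intros)
    fix q :: real assume "q \<in> cbox 0 1"
    then have q: "0 \<le> 1 - q\<^sup>2" "1 - q\<^sup>2 \<le> 1" by (auto simp: power_le_one)
    have "Re z * (1 - q\<^sup>2) \<le> B * (1 - q\<^sup>2)" using assms q by (intro mult_right_mono) auto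
    also have "\<dots> \<le> B * 1" using assms q by (intro mult_left_mono) auto
    finally show "norm (exp (z * of_real (1 - q\<^sup>2))) \<le> exp B"
      by (simp add: norm_exp_eq_Re del: of_real_diff of_real_power)
  qed simp
  then show ?thesis by (simp add: dawson_def)
qed

text \<open>\<open>time_kernel\<close> is the solution of the backward heat equation \<open>\<partial>\<^sub>\<tau>\<^sup>2 e = - 4 \<Lambda> \<partial>\<^sub>\<zeta> e\<close> with
  \<open>e(0,\<zeta>) = 0\<close> and \<open>\<partial>\<^sub>\<tau> e(0,\<zeta>) = 1 / \<zeta>\<close>; the pole is what Cauchy's formula picks up.\<close>

definition time_kernel :: "real \<Rightarrow> real \<Rightarrow> complex \<Rightarrow> complex" where
  "time_kernel \<Lambda> \<tau> \<zeta> = of_real \<tau> / \<zeta> * dawson (of_real (\<Lambda> * \<tau>\<^sup>2) / \<zeta>)"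

text \<open>By \<open>dawson_ode\<close> the kernel solves the first-order equation y' = 1 / \<zeta>
  + (2 \<Lambda> \<tau> / \<zeta>) y in \<tau>; this definition and the next express its
  \<tau>-derivatives through the kernel itself.\<close>

definition time_kernel_d1 :: "real \<Rightarrow> real \<Rightarrow> complex \<Rightarrow> complex" where
  "time_kernel_d1 \<Lambda> \<tau> \<zeta> = 1 / \<zeta> + of_real (2 * \<Lambda> * \<tau>) / \<zeta> * time_kernel \<Lambda> \<tau> \<zeta>"

definition time_kernel_d2 :: "real \<Rightarrow> real \<Rightarrow> complex \<Rightarrow> complex" where
  "time_kernel_d2 \<Lambda> \<tau> \<zeta> = of_real (2 * \<Lambda>) / \<zeta> * time_kernel \<Lambda> \<tau> \<zeta> + of_real (2 * \<Lambda> * \<tau>) / \<zeta> * time_kernel_d1 \<Lambda> \<tau> \<zeta>"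

lemma time_kernel_d1_deriv:
  assumes "\<zeta> \<noteq> 0"
  shows "((\<lambda>\<tau>. time_kernel \<Lambda> \<tau> \<zeta>) has_vector_derivative time_kernel_d1 \<Lambda> \<tau> \<zeta>) (at \<tau>)"
proof -
  define z where "z = complex_of_real (\<Lambda> * \<tau>\<^sup>2) / \<zeta>"
  have "((\<lambda>\<tau>. complex_of_real (\<Lambda> * \<tau>\<^sup>2) / \<zeta>) has_vector_derivative of_real (2 * \<Lambda> * \<tau>) / \<zeta>) (at \<tau>)"
    unfolding has_vector_derivative_def
    by (auto intro!: derivative_eq_intros simp: assms scaleR_conv_of_real)
  from field_vector_diff_chain_at[OF this, of dawson "deriv dawson z"]
  have 1: "((\<lambda>\<tau>. dawson (of_real (\<Lambda> * \<tau>\<^sup>2) / \<zeta>)) has_vector_derivative of_real (2 * \<Lambda> * \<tau>) / \<zeta> * deriv dawson z) (at \<tau>)"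
    using dawson_deriv by (simp add: z_def o_def)
  have "((\<lambda>\<tau>. time_kernel \<Lambda> \<tau> \<zeta>) has_vector_derivative (of_real \<tau> / \<zeta> * (of_real (2 * \<Lambda> * \<tau>) / \<zeta> * deriv dawson z) + 1 / \<zeta> * dawson z)) (at \<tau>)"
    unfolding time_kernel_def z_def
    by (rule has_vector_derivative_mult[OF _ 1[unfolded z_def]])
      (auto intro!: derivative_eq_intros simp: has_vector_derivative_def assms scaleR_conv_of_real)
  moreover have "of_real \<tau> / \<zeta> * (of_real (2 * \<Lambda> * \<tau>) / \<zeta> * deriv dawson z) + 1 / \<zeta> * dawson z = 1 / \<zeta> * (2 * z * deriv dawson z + dawson z)"
    by (simp add: z_def field_simps power2_eq_square assms)
  moreover have "\<dots> = time_kernel_d1 \<Lambda> \<tau> \<zeta>"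
    unfolding dawson_ode time_kernel_d1_def time_kernel_def by (simp add: z_def field_simps power2_eq_square assms)
  ultimately show ?thesis by simp
qed

lemma time_kernel_d2_deriv:
  assumes "\<zeta> \<noteq> 0"
  shows "((\<lambda>\<tau>. time_kernel_d1 \<Lambda> \<tau> \<zeta>) has_vector_derivative time_kernel_d2 \<Lambda> \<tau> \<zeta>) (at \<tau>)"
proof -
  have 1: "((\<lambda>\<tau>. complex_of_real (2 * \<Lambda> * \<tau>) / \<zeta>) has_vector_derivative of_real (2 * \<Lambda>) / \<zeta>) (at \<tau>)"
    unfolding has_vector_derivative_def
    by (auto intro!: derivative_eq_intros simp: assms scaleR_conv_of_real)
  show ?thesis
    unfolding time_kernel_d1_def
    by (rule has_vector_derivative_eq_rhs[OF has_vector_derivative_add[OF has_vector_derivative_const has_vector_derivative_mult[OF 1 time_kernel_d1_deriv[OF assms]]]])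
      (simp add: time_kernel_d2_def time_kernel_d1_def)
qed

text \<open>The kernel is \<tau> / \<zeta> times a function of z = \<Lambda> \<tau>^2 / \<zeta>, so
  the heat equation reduces to an ordinary one in z: both sides are multiples of
  \<open>dawson z + z * deriv dawson z\<close>, the second \<tau>-derivative by
  \<open>dawson_ode\<close>.\<close>

lemma time_kernel_heat:
  assumes "\<zeta> \<noteq> 0" "\<Lambda> \<noteq> 0"
  shows "(time_kernel \<Lambda> \<tau> has_field_derivative - time_kernel_d2 \<Lambda> \<tau> \<zeta> / of_real (4 * \<Lambda>)) (at \<zeta>)"
proof -
  define z where "z = complex_of_real (\<Lambda> * \<tau>\<^sup>2) / \<zeta>"
  have 1: "((\<lambda>\<zeta>. dawson (of_real (\<Lambda> * \<tau>\<^sup>2) / \<zeta>)) has_field_derivative deriv dawson z * (- of_real (\<Lambda> * \<tau>\<^sup>2) / \<zeta>\<^sup>2)) (at \<zeta>)"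
    unfolding z_def
    by (rule DERIV_chain2[OF dawson_deriv]) (auto intro!: derivative_eq_intros simp: assms power2_eq_square)
  have 2: "(time_kernel \<Lambda> \<tau> has_field_derivative (- of_real \<tau> / \<zeta>\<^sup>2 * dawson z + deriv dawson z * (- of_real (\<Lambda> * \<tau>\<^sup>2) / \<zeta>\<^sup>2) * (of_real \<tau> / \<zeta>))) (at \<zeta>)"
    unfolding time_kernel_def[abs_def]
    by (rule DERIV_mult[OF _ 1, folded z_def]) (auto intro!: derivative_eq_intros simp: assms power2_eq_square)
  have "time_kernel_d2 \<Lambda> \<tau> \<zeta> = of_real (2 * \<Lambda> * \<tau>) / \<zeta>\<^sup>2 * (dawson z + (1 + 2 * z * dawson z))"
    unfolding time_kernel_d2_def time_kernel_d1_def time_kernel_def by (simp add: z_def field_simps power2_eq_square assms)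
  also have "\<dots> = of_real (4 * \<Lambda> * \<tau>) / \<zeta>\<^sup>2 * (dawson z + z * deriv dawson z)"
    unfolding dawson_ode[symmetric] by (simp add: field_simps power2_eq_square assms)
  finally have "- time_kernel_d2 \<Lambda> \<tau> \<zeta> / of_real (4 * \<Lambda>) = - of_real \<tau> / \<zeta>\<^sup>2 * dawson z + deriv dawson z * (- of_real (\<Lambda> * \<tau>\<^sup>2) / \<zeta>\<^sup>2) * (of_real \<tau> / \<zeta>)"
    using assms by (simp add: z_def field_simps power2_eq_square)
  with 2 show ?thesis by simp
qed

lemma continuous_time_kernel:
  assumes "continuous_on S f" "continuous_on S g" "\<And>x. x \<in> S \<Longrightarrow> g x \<noteq> 0"
  shows "continuous_on S (\<lambda>x. time_kernel \<Lambda> (f x) (g x))"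
    and "continuous_on S (\<lambda>x. time_kernel_d1 \<Lambda> (f x) (g x))"
    and "continuous_on S (\<lambda>x. time_kernel_d2 \<Lambda> (f x) (g x))"
proof -
  have "continuous_on UNIV dawson" by (rule holomorphic_on_imp_continuous_on[OF dawson_holomorphic])
  moreover have "continuous_on S (\<lambda>x. of_real (\<Lambda> * (f x)\<^sup>2) / g x)"
    using assms by (auto intro!: continuous_intros)
  ultimately have d: "continuous_on S (\<lambda>x. dawson (of_real (\<Lambda> * (f x)\<^sup>2) / g x))"
    by (rule continuous_on_compose2) simp
  show 0: "continuous_on S (\<lambda>x. time_kernel \<Lambda> (f x) (g x))"
    unfolding time_kernel_def using d assms by (auto intro!: continuous_intros)
  show 1: "continuous_on S (\<lambda>x. time_kernel_d1 \<Lambda> (f x) (g x))"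
    unfolding time_kernel_d1_def using 0 assms by (auto intro!: continuous_intros)
  show "continuous_on S (\<lambda>x. time_kernel_d2 \<Lambda> (f x) (g x))"
    unfolding time_kernel_d2_def using 0 1 assms by (auto intro!: continuous_intros)
qed

text \<open>The circle with diameter \<open>[-\<delta>, \<rho>]\<close> is mapped by inversion to a circle on which \<open>Re \<le> 1 / \<rho>\<close>.\<close>

lemma circle_bounds:
  fixes \<delta> \<rho> :: real
  assumes "0 < \<delta>" "\<delta> \<le> \<rho>" and z: "cmod (z - of_real ((\<rho> - \<delta>) / 2)) = (\<rho> + \<delta>) / 2"
  shows "\<delta> \<le> cmod z" "Re (1 / z) \<le> 1 / \<rho>"
proof -
  have "cmod (z - of_real ((\<rho> - \<delta>) / 2)) \<le> cmod z + cmod (of_real ((\<rho> - \<delta>) / 2))" by (rule norm_triangle_ineq4)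
  also have "cmod (of_real ((\<rho> - \<delta>) / 2)) = (\<rho> - \<delta>) / 2" unfolding norm_of_real using assms by simp
  finally show 1: "\<delta> \<le> cmod z" using z by (simp add: field_simps)
  then have pos: "(Re z)\<^sup>2 + (Im z)\<^sup>2 > 0" using assms by (smt (verit) cmod_power2 zero_less_power)
  have "(Re z - (\<rho> - \<delta>) / 2)\<^sup>2 + (Im z)\<^sup>2 = ((\<rho> + \<delta>) / 2)\<^sup>2"
    using arg_cong[OF z, of "\<lambda>x. x\<^sup>2"] by (simp add: cmod_power2)
  then have e: "(Re z)\<^sup>2 + (Im z)\<^sup>2 = (\<rho> - \<delta>) * Re z + \<rho> * \<delta>"
    by (simp add: field_simps power2_eq_square)
  have "\<bar>Re (z - of_real ((\<rho> - \<delta>) / 2))\<bar> \<le> (\<rho> + \<delta>) / 2" using abs_Re_le_cmod z by metis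
  then have "Re z \<le> \<rho>" by (auto simp: field_simps)
  then have "\<delta> * Re z \<le> \<delta> * \<rho>" using assms by simp
  then have "\<rho> * Re z \<le> (Re z)\<^sup>2 + (Im z)\<^sup>2" unfolding e by (simp add: algebra_simps)
  then show "Re (1 / z) \<le> 1 / \<rho>" using pos assms
    by (simp add: Re_divide field_simps)
qed

text \<open>Inversion maps the disc with diameter [a, b] onto the disc with diameter [1 / b, 1 / a].
  In coordinates, membership means |w|^2 \<le> (a + b) Re w - a b, and Re w \<le> b reduces this to
  |w|^2 \<le> b Re w.\<close>

lemma Re_inverse_ge:
  fixes a b :: real
  assumes "0 < a" "a \<le> b" and w: "cmod (w - of_real ((a + b) / 2)) \<le> (b - a) / 2"
  shows "a \<le> Re w" "1 / b \<le> Re (1 / w)"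
proof -
  have r: "\<bar>Re (w - of_real ((a + b) / 2))\<bar> \<le> (b - a) / 2" using abs_Re_le_cmod w by (metis order_trans)
  then show 1: "a \<le> Re w" by (auto simp: field_simps abs_le_iff)
  have 2: "Re w \<le> b" using r by (auto simp: field_simps abs_le_iff)
  have "(cmod (w - of_real ((a + b) / 2)))\<^sup>2 \<le> ((b - a) / 2)\<^sup>2" using w by (intro power_mono) auto
  then have "(Re w - (a + b) / 2)\<^sup>2 + (Im w)\<^sup>2 \<le> ((b - a) / 2)\<^sup>2" by (simp add: cmod_power2)
  then have e: "(Re w)\<^sup>2 + (Im w)\<^sup>2 \<le> (a + b) * Re w - a * b"
    by (simp add: field_simps power2_eq_square)
  have "a * Re w \<le> a * b" using 2 assms by simp
  then have "(Re w)\<^sup>2 + (Im w)\<^sup>2 \<le> b * Re w" using e by (simp add: algebra_simps)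
  moreover have "(Re w)\<^sup>2 + (Im w)\<^sup>2 > 0" using 1 assms by (simp add: add_pos_nonneg)
  ultimately show "1 / b \<le> Re (1 / w)" using assms by (simp add: Re_divide field_simps)
qed

text \<open>The bound \<delta> \<le> |\<zeta>| alone would only give the rate T^2 / \<delta>. By
  \<open>circle_bounds\<close> the real part of 1 / \<zeta> is at most 1 / \<rho> on the circle, so
  \<delta> enters only the prefactor.\<close>

lemma norm_time_kernel_le:
  assumes "0 < \<delta>" "\<delta> \<le> \<rho>" "0 < \<Lambda>" "0 \<le> \<tau>" "\<tau> \<le> T"
    and z: "cmod (\<zeta> - of_real ((\<rho> - \<delta>) / 2)) = (\<rho> + \<delta>) / 2"
  shows "norm (time_kernel \<Lambda> \<tau> \<zeta>) \<le> T / \<delta> * exp (\<Lambda> * T\<^sup>2 / \<rho>)"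
proof -
  note b = circle_bounds[OF assms(1,2) z]
  have "Re (of_real (\<Lambda> * \<tau>\<^sup>2) / \<zeta>) = \<Lambda> * \<tau>\<^sup>2 * Re (1 / \<zeta>)"
    by (simp add: Re_divide)
  also have "\<dots> \<le> \<Lambda> * \<tau>\<^sup>2 * (1 / \<rho>)" using b assms by (intro mult_left_mono) auto
  also have "\<dots> \<le> \<Lambda> * T\<^sup>2 / \<rho>" using assms by (simp add: divide_right_mono mult_left_mono power_mono)
  finally have "norm (dawson (of_real (\<Lambda> * \<tau>\<^sup>2) / \<zeta>)) \<le> exp (\<Lambda> * T\<^sup>2 / \<rho>)"
    using assms by (intro norm_dawson_le) auto
  moreover have "norm (of_real \<tau> / \<zeta>) \<le> T / \<delta>"
    using b assms by (simp add: norm_divide frac_le)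
  ultimately show ?thesis unfolding time_kernel_def norm_mult using assms by (intro mult_mono) auto
qed

lemma circlepath_image_norm:
  "0 \<le> r \<Longrightarrow> cmod (circlepath c r x - c) = r"
  by (simp add: circlepath norm_mult)

text \<open>Pairing with \<open>time_kernel\<close> over the circle gives a quantity whose \<open>t\<close>-derivative only
  involves \<open>Er\<close>, because the terms with \<open>I\<close> combine to an exact \<open>\<zeta>\<close>-derivative.\<close>

lemma holomorphic_cauchy_bound:
  fixes I I1 I2 Iz Er :: "real \<Rightarrow> complex \<Rightarrow> complex"
  defines "c \<equiv> \<lambda>\<delta> \<rho>. complex_of_real ((\<rho> - \<delta>) / 2)"
  assumes par: "0 < \<delta>" "\<delta> \<le> \<rho>" "0 < \<Lambda>" "0 < T"
    and sub: "cball (c \<delta> \<rho>) ((\<rho> + \<delta>) / 2) \<subseteq> S"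
    and d1: "\<And>t \<zeta>. \<zeta> \<in> S \<Longrightarrow> ((\<lambda>t. I t \<zeta>) has_vector_derivative I1 t \<zeta>) (at t)"
    and d2: "\<And>t \<zeta>. \<zeta> \<in> S \<Longrightarrow> ((\<lambda>t. I1 t \<zeta>) has_vector_derivative I2 t \<zeta>) (at t)"
    and dz: "\<And>t \<zeta>. \<zeta> \<in> S \<Longrightarrow> (I t has_field_derivative Iz t \<zeta>) (at \<zeta>)"
    and pde: "\<And>t \<zeta>. \<zeta> \<in> S \<Longrightarrow> I2 t \<zeta> = of_real (4 * \<Lambda>) * Iz t \<zeta> + Er t \<zeta>"
    and cont: "continuous_on (UNIV \<times> S) (\<lambda>(t, \<zeta>). I t \<zeta>)" "continuous_on (UNIV \<times> S) (\<lambda>(t, \<zeta>). I1 t \<zeta>)"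
      "continuous_on (UNIV \<times> S) (\<lambda>(t, \<zeta>). I2 t \<zeta>)" "\<And>t. continuous_on S (Er t)"
    and init: "\<And>\<zeta>. \<zeta> \<in> S \<Longrightarrow> I 0 \<zeta> = 0" "\<And>\<zeta>. \<zeta> \<in> S \<Longrightarrow> I1 0 \<zeta> = 0"
    and Er: "\<And>t \<zeta>. 0 \<le> t \<Longrightarrow> t \<le> T \<Longrightarrow> \<zeta> \<in> cball (c \<delta> \<rho>) ((\<rho> + \<delta>) / 2) \<Longrightarrow> norm (Er t \<zeta>) \<le> M"
  shows "norm (I T 0) \<le> T * \<rho> * (T / \<delta> * exp (\<Lambda> * T\<^sup>2 / \<rho>) * M)"
proof -
  define r where "r = (\<rho> + \<delta>) / 2"
  define g where "g = circlepath (c \<delta> \<rho>) r"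
  have rpos: "0 < r" using par by (simp add: r_def)
  have gn: "cmod (g x - c \<delta> \<rho>) = r" for x unfolding g_def using rpos by (simp add: circlepath_image_norm)
  then have gB: "g x \<in> cball (c \<delta> \<rho>) ((\<rho> + \<delta>) / 2)" for x by (simp add: r_def dist_norm norm_minus_commute)
  then have gS: "g x \<in> S" for x using sub by blast
  have g0: "g x \<noteq> 0" for x
    using circle_bounds(1)[OF par(1,2), of "g x"] gn[of x] par by (auto simp: c_def r_def)
  have gc: "continuous_on A g" for A
    unfolding g_def circlepath by (auto intro!: continuous_intros)
  define g' where "g' x = vector_derivative g (at x)" for x
  have g': "g' x = 2 * of_real pi * \<i> * r * exp (2 * of_real pi * \<i> * x)" for x
    unfolding g'_def g_def by (simp add: vector_derivative_circlepath)
  have g'c: "continuous_on A g'" for A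
    unfolding g' [abs_def] by (auto intro!: continuous_intros)
  have ci: "contour_integral g f = integral {0..1} (\<lambda>x. f (g x) * g' x)" for f
    by (simp add: contour_integral_integral g'_def)
  have img: "path_image g \<subseteq> S" unfolding path_image_def using gS by auto
  \<comment> \<open>\<open>L\<close> is the Wronskian of I(t) and the kernel at the reversed time T
    - t. In its t-derivative \<open>L'\<close> the products of first derivatives cancel.\<close>
  define L where "L t \<zeta> = time_kernel \<Lambda> (T - t) \<zeta> * I1 t \<zeta> + time_kernel_d1 \<Lambda> (T - t) \<zeta> * I t \<zeta>" for t \<zeta>
  define L' where "L' t \<zeta> = time_kernel \<Lambda> (T - t) \<zeta> * I2 t \<zeta> - time_kernel_d2 \<Lambda> (T - t) \<zeta> * I t \<zeta>" for t \<zeta>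
  have Ld: "((\<lambda>t. L t \<zeta>) has_vector_derivative L' t \<zeta>) (at t)" if "\<zeta> \<in> S" "\<zeta> \<noteq> 0" for t \<zeta>
  proof -
    have s: "((\<lambda>t. T - t) has_vector_derivative -1) (at t)" by (auto intro!: derivative_eq_intros)
    have e1: "((\<lambda>t. time_kernel \<Lambda> (T - t) \<zeta>) has_vector_derivative - time_kernel_d1 \<Lambda> (T - t) \<zeta>) (at t)"
      using vector_diff_chain_at[OF s time_kernel_d1_deriv[OF that(2)]] by (simp add: o_def)
    have e2: "((\<lambda>t. time_kernel_d1 \<Lambda> (T - t) \<zeta>) has_vector_derivative - time_kernel_d2 \<Lambda> (T - t) \<zeta>) (at t)"
      using vector_diff_chain_at[OF s time_kernel_d2_deriv[OF that(2)]] by (simp add: o_def)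
    show ?thesis unfolding L_def L'_def
      by (rule has_vector_derivative_eq_rhs[OF has_vector_derivative_add[OF
            has_vector_derivative_mult[OF e1 d2[OF that(1)]] has_vector_derivative_mult[OF e2 d1[OF that(1)]]]]) simp
  qed
  have cI: "continuous_on (UNIV \<times> A) (\<lambda>(t, x). I t (g x))"
    "continuous_on (UNIV \<times> A) (\<lambda>(t, x). I1 t (g x))"
    "continuous_on (UNIV \<times> A) (\<lambda>(t, x). I2 t (g x))" for A
  proof -
    have gc2: "continuous_on (UNIV \<times> A) (\<lambda>p. g (snd p))"
      by (rule continuous_on_compose2[OF gc[of UNIV]]) (auto intro!: continuous_intros)
    have *: "continuous_on (UNIV \<times> A) (\<lambda>p. (fst p, g (snd p)))" by (intro continuous_intros gc2)
    have **: "(\<lambda>p. (fst p, g (snd p))) ` (UNIV \<times> A) \<subseteq> UNIV \<times> S" using gS by auto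
    show "continuous_on (UNIV \<times> A) (\<lambda>(t, x). I t (g x))"
      "continuous_on (UNIV \<times> A) (\<lambda>(t, x). I1 t (g x))"
      "continuous_on (UNIV \<times> A) (\<lambda>(t, x). I2 t (g x))"
      using continuous_on_compose2[OF cont(1) * **] continuous_on_compose2[OF cont(2) * **]
        continuous_on_compose2[OF cont(3) * **] by (auto simp: split_beta)
  qed
  have cek: "continuous_on (UNIV \<times> A) (\<lambda>(t, x). time_kernel \<Lambda> (T - t) (g x))"
    "continuous_on (UNIV \<times> A) (\<lambda>(t, x). time_kernel_d1 \<Lambda> (T - t) (g x))"
    "continuous_on (UNIV \<times> A) (\<lambda>(t, x). time_kernel_d2 \<Lambda> (T - t) (g x))" for A
  proof -
    have gc2: "continuous_on (UNIV \<times> A) (\<lambda>p. g (snd p))"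
      by (rule continuous_on_compose2[OF gc[of UNIV]]) (auto intro!: continuous_intros)
    have s: "continuous_on (UNIV \<times> A) (\<lambda>p. T - fst p)" by (intro continuous_intros)
    note k = continuous_time_kernel[OF s gc2 g0]
    show "continuous_on (UNIV \<times> A) (\<lambda>(t, x). time_kernel \<Lambda> (T - t) (g x))"
    "continuous_on (UNIV \<times> A) (\<lambda>(t, x). time_kernel_d1 \<Lambda> (T - t) (g x))"
    "continuous_on (UNIV \<times> A) (\<lambda>(t, x). time_kernel_d2 \<Lambda> (T - t) (g x))"
      using k by (auto simp: split_beta)
  qed
  have g'c2: "continuous_on (UNIV \<times> A) (\<lambda>p::real\<times>real. g' (snd p))" for A
    by (rule continuous_on_compose2[OF g'c[of UNIV]]) (auto intro!: continuous_intros)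
  have cL: "continuous_on (UNIV \<times> A) (\<lambda>(t, x). L t (g x) * g' x)" for A
    using cI[of A] cek[of A] g'c2[of A] unfolding L_def split_beta by (intro continuous_intros) auto
  have cL': "continuous_on (UNIV \<times> A) (\<lambda>(t, x). L' t (g x) * g' x)" for A
    using cI[of A] cek[of A] g'c2[of A] unfolding L'_def split_beta by (intro continuous_intros) auto
  define N where "N t = integral (cbox 0 1) (\<lambda>x. L t (g x) * g' x)" for t
  have Nd: "(N has_vector_derivative integral (cbox 0 1) (\<lambda>x. L' t (g x) * g' x)) (at t within UNIV)" for t
    unfolding N_def[abs_def]
  proof (rule leibniz_rule_vector_derivative)
    show "((\<lambda>t. L t (g x) * g' x) has_vector_derivative L' t (g x) * g' x) (at t within UNIV)" for t x
      using has_vector_derivative_mult_left[OF Ld[OF gS g0, of x t], of "g' x"] by simp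
    show "(\<lambda>x. L t (g x) * g' x) integrable_on cbox 0 1" for t
      by (rule integrable_continuous, rule continuous_on_compose2[OF cL[of UNIV], of _ "\<lambda>x. (t, x)", simplified])
        (auto intro!: continuous_intros)
    show "continuous_on (UNIV \<times> cbox 0 1) (\<lambda>(t, x). L' t (g x) * g' x)" by (rule cL')
  qed auto
  have cEr: "continuous_on A (\<lambda>x. Er t (g x))" for A t
    by (rule continuous_on_compose2[OF cont(4) gc]) (use gS in auto)
  have cek1: "continuous_on A (\<lambda>x. time_kernel \<Lambda> (T - t) (g x))" for A t
    by (rule continuous_time_kernel[OF continuous_on_const gc g0])
  have Neq: "integral (cbox 0 1) (\<lambda>x. L' t (g x) * g' x)
     = integral (cbox 0 1) (\<lambda>x. time_kernel \<Lambda> (T - t) (g x) * Er t (g x) * g' x)" for t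
  proof -
    \<comment> \<open>After insertion of \<open>pde\<close>, the part of \<open>L'\<close> without
      \<open>Er\<close> is the complex derivative of \<open>P\<close>, because the kernel solves the
      backward heat equation. \<open>P\<close> is single-valued off 0 and the circle is closed, so
      this part integrates to 0.\<close>
    define P where "P \<zeta> = of_real (4 * \<Lambda>) * (time_kernel \<Lambda> (T - t) \<zeta> * I t \<zeta>)" for \<zeta>
    define P' where "P' \<zeta> = of_real (4 * \<Lambda>) * time_kernel \<Lambda> (T - t) \<zeta> * Iz t \<zeta> - time_kernel_d2 \<Lambda> (T - t) \<zeta> * I t \<zeta>" for \<zeta>
    have Pd: "(P has_field_derivative P' \<zeta>) (at \<zeta> within S - {0})" if "\<zeta> \<in> S - {0}" for \<zeta>
    proof -
      have z: "\<zeta> \<noteq> 0" "\<zeta> \<in> S" using that by auto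
      show ?thesis unfolding P_def P'_def
        by (rule DERIV_subset[OF _ subset_UNIV], rule DERIV_cong[OF DERIV_cmult[OF
            DERIV_mult[OF time_kernel_heat[OF z(1)] dz[OF z(2)]]]]) (use par in \<open>auto simp: field_simps\<close>)
    qed
    have "(P' has_contour_integral (P (pathfinish g) - P (pathstart g))) g"
      by (rule contour_integral_primitive[where S = "S - {0}"])
        (use Pd img g0 in \<open>auto simp: g_def path_image_def\<close>)
    then have "contour_integral g P' = 0" by (simp add: contour_integral_unique g_def)
    then have 0: "integral {0..1} (\<lambda>x. P' (g x) * g' x) = 0" unfolding ci .
    have e: "L' t (g x) * g' x = P' (g x) * g' x + time_kernel \<Lambda> (T - t) (g x) * Er t (g x) * g' x" for x
      unfolding L'_def P'_def pde[OF gS] by (simp add: algebra_simps)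
    then have e': "(\<lambda>x. P' (g x) * g' x) = (\<lambda>x. L' t (g x) * g' x - time_kernel \<Lambda> (T - t) (g x) * Er t (g x) * g' x)"
      by (auto simp: fun_eq_iff)
    have i1: "(\<lambda>x. time_kernel \<Lambda> (T - t) (g x) * Er t (g x) * g' x) integrable_on {0..1}"
      by (intro integrable_continuous_real continuous_intros cEr cek1 g'c)
    have i2: "(\<lambda>x. P' (g x) * g' x) integrable_on {0..1}"
      unfolding e' by (rule integrable_diff[OF integrable_continuous_real i1],
          rule continuous_on_compose2[OF cL'[of UNIV], of _ "\<lambda>x. (t, x)", simplified])
        (auto intro!: continuous_intros)
    show ?thesis unfolding e using integral_add[OF i2 i1] 0 by simp
  qed
  define B where "B = T / \<delta> * exp (\<Lambda> * T\<^sup>2 / \<rho>) * M"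
  have M0: "0 \<le> M" using order_trans[OF norm_ge_zero Er[OF order_refl less_imp_le[OF par(4)] gB]] .
  have ng': "norm (g' x) = 2 * pi * r" for x unfolding g' using rpos by (simp add: norm_mult)
  have Nb: "norm (integral (cbox 0 1) (\<lambda>x. L' t (g x) * g' x)) \<le> 2 * pi * r * B" if "0 \<le> t" "t \<le> T" for t
  proof -
    have "norm (integral (cbox 0 1) (\<lambda>x. time_kernel \<Lambda> (T - t) (g x) * Er t (g x) * g' x)) \<le> (2 * pi * r * B) * measure lborel (cbox 0 (1::real))"
    proof (rule integrable_bound)
      show "(\<lambda>x. time_kernel \<Lambda> (T - t) (g x) * Er t (g x) * g' x) integrable_on cbox 0 1"
        by (intro integrable_continuous continuous_intros cEr cek1 g'c)
      show "0 \<le> 2 * pi * r * B" using rpos M0 par by (simp add: B_def)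
      fix x :: real
      have "norm (time_kernel \<Lambda> (T - t) (g x)) \<le> T / \<delta> * exp (\<Lambda> * T\<^sup>2 / \<rho>)"
        by (rule norm_time_kernel_le) (use par that gn[of x] in \<open>auto simp: c_def r_def\<close>)
      then have "norm (time_kernel \<Lambda> (T - t) (g x)) * norm (Er t (g x)) \<le> B"
        unfolding B_def using Er[OF that gB] M0 par by (intro mult_mono) auto
      then have "norm (time_kernel \<Lambda> (T - t) (g x)) * norm (Er t (g x)) * norm (g' x) \<le> B * (2 * pi * r)"
        unfolding ng' using rpos by (intro mult_right_mono) auto
      then show "norm (time_kernel \<Lambda> (T - t) (g x) * Er t (g x) * g' x) \<le> 2 * pi * r * B"
        by (simp add: norm_mult mult_ac)
    qed
    then show ?thesis unfolding Neq by simp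
  qed
  have "norm (N T - N 0) \<le> (2 * pi * r * B) * norm (T - 0)"
  proof (rule differentiable_bound[where S = "{0..T}" and f' = "\<lambda>t h. h *\<^sub>R integral (cbox 0 1) (\<lambda>x. L' t (g x) * g' x)"])
    show "(N has_derivative (\<lambda>h. h *\<^sub>R integral (cbox 0 1) (\<lambda>x. L' t (g x) * g' x))) (at t within {0..T})" for t
      using Nd[of t] by (auto simp: has_vector_derivative_def intro: has_derivative_at_withinI)
    show "onorm (\<lambda>h. h *\<^sub>R integral (cbox 0 1) (\<lambda>x. L' t (g x) * g' x)) \<le> 2 * pi * r * B" if "t \<in> {0..T}" for t
    proof (rule onorm_bound)
      show "0 \<le> 2 * pi * r * B" using rpos M0 par by (simp add: B_def)
      show "norm (x *\<^sub>R integral (cbox 0 1) (\<lambda>x. L' t (g x) * g' x)) \<le> 2 * pi * r * B * norm x" for x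
        unfolding norm_scaleR using mult_right_mono[OF Nb[of t], of "norm x"] that by (simp add: mult.commute)
    qed
  qed (use par in auto)
  moreover have "N 0 = 0" by (simp add: N_def L_def init gS)
  \<comment> \<open>At t = T the kernel vanishes and its first derivative is 1 / \<zeta>, so the
    pairing becomes Cauchy's formula for I(T) at 0.\<close>
  moreover have "N T = 2 * of_real pi * \<i> * I T 0"
  proof -
    have "((\<lambda>u. I T u / (u - 0)) has_contour_integral (2 * of_real pi * \<i> * I T 0)) g"
      unfolding g_def
    proof (rule Cauchy_integral_circlepath_simple)
      show "I T holomorphic_on cball (c \<delta> \<rho>) r"
      proof (rule holomorphic_onI)
        fix x assume "x \<in> cball (c \<delta> \<rho>) r"
        then have "x \<in> S" using sub by (auto simp: r_def)
        then have "I T field_differentiable at x" unfolding field_differentiable_def using dz by metis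
        then show "I T field_differentiable at x within cball (c \<delta> \<rho>) r" by (rule field_differentiable_at_within)
      qed
      have "cmod (c \<delta> \<rho>) = (\<rho> - \<delta>) / 2" unfolding c_def norm_of_real using par by simp
      then show "cmod (0 - c \<delta> \<rho>) < r" using par by (simp add: r_def)
    qed
    from contour_integral_unique[OF this]
    have 1: "integral {0..1} (\<lambda>x. I T (g x) / (g x - 0) * g' x) = 2 * of_real pi * \<i> * I T 0"
      unfolding ci .
    have 2: "L T \<zeta> = I T \<zeta> / (\<zeta> - 0)" for \<zeta> by (simp add: L_def time_kernel_def time_kernel_d1_def)
    show ?thesis unfolding N_def 2 using 1 by simp
  qed
  ultimately have "2 * pi * norm (I T 0) \<le> 2 * pi * r * B * T"
    using par by (simp add: norm_mult)
  then have "norm (I T 0) \<le> r * B * T" by (simp add: mult.assoc)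
  also have "\<dots> \<le> \<rho> * B * T" using par M0 by (intro mult_right_mono) (auto simp: r_def B_def)
  finally show ?thesis by (simp add: B_def mult_ac)
qed

section \<open>Integration by parts and cut-off functions\<close>

text \<open>This is translation invariance: the integral of F(z + h b) over the box does not depend
  on h for |h| \<le> 1, and differentiation under the integral at h = 0 gives the integral of F'.
  The margin 1 in \<open>box\<close> keeps every translated support inside.\<close>

lemma integral_directional_derivative_eq_0:
  fixes F F' :: "'z::euclidean_space \<Rightarrow> complex"
  assumes d: "\<And>z. ((\<lambda>s. F (z + s *\<^sub>R b)) has_vector_derivative F' z) (at 0)"
    and c: "continuous_on UNIV F" "continuous_on UNIV F'"
    and supp: "\<And>z. K \<le> norm z \<Longrightarrow> F z = 0"
    and b: "norm b \<le> 1" and box: "cball 0 (K + 1) \<subseteq> cbox p q"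
  shows "integral (cbox p q) F' = 0"
proof -
  define G where "G h = integral (cbox p q) (\<lambda>z. F (z + h *\<^sub>R b))" for h :: real
  have cs: "continuous_on S (\<lambda>z. F (z + h *\<^sub>R b))" for h S
    by (rule continuous_on_compose2[OF c(1)]) (auto intro!: continuous_intros)
  have G: "G h = integral UNIV F" if "h \<in> {-1..1}" for h
  proof -
    have z: "F (z + h *\<^sub>R b) = 0" if "z \<notin> cbox p q" for z
    proof (rule supp)
      have "z \<notin> cball 0 (K + 1)" using that box by blast
      then have "norm z > K + 1" by simp
      moreover have "norm (h *\<^sub>R b) \<le> 1" using b \<open>h \<in> {-1..1}\<close> mult_le_one[of "\<bar>h\<bar>" "norm b"] by auto
      moreover have "norm z \<le> norm (z + h *\<^sub>R b) + norm (h *\<^sub>R b)" by (metis add_diff_cancel norm_triangle_ineq4)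
      ultimately show "K \<le> norm (z + h *\<^sub>R b)" by linarith
    qed
    have "((\<lambda>z. F (z + h *\<^sub>R b)) has_integral G h) (cbox p q)"
      unfolding G_def by (intro integrable_integral integrable_continuous cs)
    then have 1: "((\<lambda>z. F (z + h *\<^sub>R b)) has_integral G h) UNIV"
      by (rule has_integral_on_superset) (use z in auto)
    have z0: "F z = 0" if "z \<notin> cbox p q" for z
    proof (rule supp, rule ccontr)
      assume "\<not> K \<le> norm z"
      then have "z \<in> cball 0 (K + 1)" by simp
      with box that show False by blast
    qed
    have 0: "(F has_integral integral (cbox p q) F) (cbox p q)"
      by (intro integrable_integral integrable_continuous continuous_on_subset[OF c(1)]) auto
    then have 2: "(F has_integral integral (cbox p q) F) UNIV"
      by (rule has_integral_on_superset) (use z0 in auto)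
    from has_integral_affinity[OF 0, of 1 "h *\<^sub>R b"]
    have "((\<lambda>x. F (x + h *\<^sub>R b)) has_integral integral (cbox p q) F) ((\<lambda>x. x - h *\<^sub>R b) ` cbox p q)" by simp
    then have "((\<lambda>x. F (x + h *\<^sub>R b)) has_integral integral (cbox p q) F) UNIV"
    proof (rule has_integral_on_superset)
      fix x assume "x \<notin> (\<lambda>x. x - h *\<^sub>R b) ` cbox p q"
      then have "x + h *\<^sub>R b \<notin> cbox p q" by (metis add_diff_cancel image_eqI)
      then show "F (x + h *\<^sub>R b) = 0" by (rule z0)
    qed auto
    with 1 have "G h = integral (cbox p q) F" by (rule has_integral_unique)
    then show ?thesis using 2 by (simp add: integral_unique)
  qed
  have "(G has_vector_derivative integral (cbox p q) (\<lambda>z. F' (z + 0 *\<^sub>R b))) (at 0 within {-1..1})"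
    unfolding G_def[abs_def]
  proof (rule leibniz_rule_vector_derivative)
    fix h z
    have "((\<lambda>s. F ((z + h *\<^sub>R b) + s *\<^sub>R b)) has_vector_derivative F' (z + h *\<^sub>R b)) (at (h - h))"
      using d by simp
    moreover have "((\<lambda>s. s - h) has_vector_derivative 1) (at h)" by (auto intro!: derivative_eq_intros)
    ultimately have "(((\<lambda>s. F ((z + h *\<^sub>R b) + s *\<^sub>R b)) \<circ> (\<lambda>s. s - h)) has_vector_derivative 1 *\<^sub>R F' (z + h *\<^sub>R b)) (at h)"
      by (intro vector_diff_chain_at)
    moreover have "((\<lambda>s. F ((z + h *\<^sub>R b) + s *\<^sub>R b)) \<circ> (\<lambda>s. s - h)) = (\<lambda>s. F (z + s *\<^sub>R b))"
      by (simp add: fun_eq_iff scaleR_diff_left)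
    ultimately show "((\<lambda>s. F (z + s *\<^sub>R b)) has_vector_derivative F' (z + h *\<^sub>R b)) (at h within {-1..1})"
      by (simp add: has_vector_derivative_at_within)
  next
    show "(\<lambda>z. F (z + h *\<^sub>R b)) integrable_on cbox p q" for h by (intro integrable_continuous cs)
    show "continuous_on ({-1..1} \<times> cbox p q) (\<lambda>(x, z). F' (z + x *\<^sub>R b))"
      unfolding split_beta by (rule continuous_on_compose2[OF c(2)]) (auto intro!: continuous_intros)
  qed auto
  then have "(G has_vector_derivative integral (cbox p q) F') (at 0)"
    using at_within_interior[of "0::real" "{-1..1}"] by simp
  moreover have "(G has_vector_derivative 0) (at 0)"
    by (rule has_vector_derivative_transform_within_open[of "\<lambda>_. integral UNIV F" _ _ "{-1<..<1}"]) (use G in auto)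
  ultimately show ?thesis by (rule vector_derivative_unique_at)
qed

text \<open>The cube of the positive part is twice continuously differentiable, which its square is
  not. With l affine, l(q0) = 0 and l(q1) = 1, the positive part of 1 - max(0, l)^3, cubed, is such
  a cut-off.\<close>

lemma C2_cutoff:
  fixes q0 q1 :: real
  assumes "q0 < q1"
  obtains \<Psi> \<Psi>1 \<Psi>2 :: "real \<Rightarrow> real" where
    "\<And>s. (\<Psi> has_real_derivative \<Psi>1 s) (at s)" "\<And>s. (\<Psi>1 has_real_derivative \<Psi>2 s) (at s)"
    "continuous_on UNIV \<Psi>2"
    "\<And>s. s \<le> q0 \<Longrightarrow> \<Psi> s = 1" "\<And>s. s < q0 \<Longrightarrow> \<Psi>1 s = 0" "\<And>s. s < q0 \<Longrightarrow> \<Psi>2 s = 0"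
    "\<And>s. q1 \<le> s \<Longrightarrow> \<Psi> s = 0" "\<And>s. q1 \<le> s \<Longrightarrow> \<Psi>1 s = 0"
proof -
  define m :: "real \<Rightarrow> real" where "m s = max 0 s" for s
  have pw: "((\<lambda>s. m s ^ Suc (Suc k)) has_real_derivative real (Suc (Suc k)) * m s ^ Suc k) (at s)" for k s
  proof (cases s "0::real" rule: linorder_cases)
    case less
    have "((\<lambda>_. 0) has_real_derivative real (Suc (Suc k)) * m s ^ Suc k) (at s)" using less by (simp add: m_def)
    then show ?thesis
      by (rule has_field_derivative_transform_within_open[of _ _ _ "{..<0}"]) (use less in \<open>auto simp: m_def\<close>)
  next
    case greater
    have "((\<lambda>s. s ^ Suc (Suc k)) has_real_derivative real (Suc (Suc k)) * m s ^ Suc k) (at s)" using greater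
      DERIV_pow[of "Suc (Suc k)" s] by (simp add: m_def max_def)
    then show ?thesis
      by (rule has_field_derivative_transform_within_open[of _ _ _ "{0<..}"]) (use greater in \<open>auto simp: m_def max_def\<close>)
  next
    case equal
    have "((\<lambda>h. m h ^ Suc (Suc k) / h) \<longlongrightarrow> 0) (at 0)"
    proof (rule Lim_null_comparison[where g = "\<lambda>h::real. \<bar>h\<bar> ^ Suc k"])
      show "\<forall>\<^sub>F h in at 0. norm (m h ^ Suc (Suc k) / h) \<le> \<bar>h\<bar> ^ Suc k"
      proof (rule eventuallyI)
        show "norm (m h ^ Suc (Suc k) / h) \<le> \<bar>h\<bar> ^ Suc k" for h
        proof (cases "0 \<le> h")
          case False
          then have "norm (m h ^ Suc (Suc k) / h) = 0" by (simp add: m_def)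
          then show ?thesis using zero_le_power[of "\<bar>h\<bar>" "Suc k"] by linarith
        qed (simp add: m_def abs_mult power_abs)
      qed
      show "((\<lambda>h::real. \<bar>h\<bar> ^ Suc k) \<longlongrightarrow> 0) (at 0)" by (auto intro!: tendsto_eq_intros)
    qed
    then show ?thesis using equal by (simp add: has_field_derivative_iff m_def)
  qed
  have p1: "((\<lambda>s. m s ^ 3) has_real_derivative 3 * m s ^ 2) (at s)" for s
    using pw[of 1 s] by (simp add: numeral_eq_Suc)
  have p2: "((\<lambda>s. m s ^ 2) has_real_derivative 2 * m s) (at s)" for s
    using pw[of 0 s] by (simp add: numeral_eq_Suc)
  define a where "a = 1 / (q1 - q0)"
  have a: "a > 0" using assms by (simp add: a_def)
  define l where "l s = a * (s - q0)" for s
  define \<Psi> where "\<Psi> s = m (1 - m (l s) ^ 3) ^ 3" for s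
  define \<Psi>1 where "\<Psi>1 s = - (3 * m (1 - m (l s) ^ 3) ^ 2 * (3 * m (l s) ^ 2 * a))" for s
  define \<Psi>2 where "\<Psi>2 s = (2 * m (1 - m (l s) ^ 3) * (3 * m (l s) ^ 2 * a)) * (3 * (3 * m (l s) ^ 2 * a))
      - 3 * m (1 - m (l s) ^ 3) ^ 2 * (3 * (2 * m (l s) * a) * a)" for s
  have l: "(l has_real_derivative a) (at s)" for s
    unfolding l_def[abs_def] by (auto intro!: derivative_eq_intros)
  have l3: "((\<lambda>s. 1 - m (l s) ^ 3) has_real_derivative - (3 * m (l s) ^ 2 * a)) (at s)" for s
    using DERIV_diff[OF DERIV_const DERIV_chain2[OF p1 l]] by simp
  have l2: "((\<lambda>s. 3 * m (l s) ^ 2 * a) has_real_derivative 3 * (2 * m (l s) * a) * a) (at s)" for s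
    by (rule DERIV_cmult_right[OF DERIV_cmult[OF DERIV_chain2[OF p2 l]]])
  have 1: "(\<Psi> has_real_derivative \<Psi>1 s) (at s)" for s
    unfolding \<Psi>_def[abs_def] \<Psi>1_def using DERIV_chain2[OF p1 l3] by simp
  have 2: "(\<Psi>1 has_real_derivative \<Psi>2 s) (at s)" for s
  proof -
    have "((\<lambda>s. 3 * m (1 - m (l s) ^ 3) ^ 2) has_real_derivative 3 * (2 * m (1 - m (l s) ^ 3) * - (3 * m (l s) ^ 2 * a))) (at s)"
      by (rule DERIV_cmult[OF DERIV_chain2[OF p2 l3]])
    from DERIV_minus[OF DERIV_mult[OF this l2]] show ?thesis
      unfolding \<Psi>1_def[abs_def] \<Psi>2_def by (rule DERIV_cong) (simp add: algebra_simps)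
  qed
  have lneg: "m (l s) = 0" if "s \<le> q0" for s
  proof -
    have "l s \<le> 0" unfolding l_def using that a by (simp add: mult_nonneg_nonpos)
    then show ?thesis by (simp add: m_def)
  qed
  show thesis
  proof (rule that[OF 1 2])
    show "continuous_on UNIV \<Psi>2"
      unfolding \<Psi>2_def[abs_def] m_def l_def by (intro continuous_intros)
    show "\<Psi> s = 1" if "s \<le> q0" for s using lneg[OF that] by (simp add: \<Psi>_def) (simp add: m_def)
    show "\<Psi>1 s = 0" if "s < q0" for s using lneg that by (simp add: \<Psi>1_def)
    show "\<Psi>2 s = 0" if "s < q0" for s using lneg that by (simp add: \<Psi>2_def)
    have *: "m (1 - m (l s) ^ 3) = 0" if "q1 \<le> s" for s
    proof -
      have "l s \<ge> 1" using that assms by (simp add: l_def a_def field_simps)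
      then have "m (l s) ^ 3 \<ge> 1" by (simp add: m_def one_le_power)
      then show ?thesis by (simp add: m_def)
    qed
    show "\<Psi> s = 0" if "q1 \<le> s" for s using *[OF that] by (simp add: \<Psi>_def)
    show "\<Psi>1 s = 0" if "q1 \<le> s" for s using *[OF that] by (simp add: \<Psi>1_def)
  qed
qed

section \<open>Mixed Gaussian kernels\<close>

text \<open>The variables x and y' are merged into one Euclidean space; \<open>X\<close> collects
  the basis vectors of the x-directions, and the remaining ones belong to y'. A single sum over
  \<open>Basis\<close> then treats both groups.\<close>

definition dir_sign :: "'z set \<Rightarrow> 'z \<Rightarrow> real" where
  "dir_sign X b = (if b \<in> X then 1 else - 1)"

text \<open>These are the reciprocals of the two heat times. The contour encircles \<zeta> = 0 and
  reaches down to - \<delta>; the shift by 2 \<delta> keeps the forward time in the right half-plane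
  there.\<close>

definition heat_rate :: "'z set \<Rightarrow> real \<Rightarrow> complex \<Rightarrow> 'z \<Rightarrow> complex" where
  "heat_rate X \<delta> \<zeta> b = (if b \<in> X then 1 / (\<zeta> + of_real (2 * \<delta>)) else 1 / (1 - \<zeta>))"

text \<open>Half the sum of these logarithms gives the powers -d/2 and -m/2 of the prefactor as a
  holomorphic branch, also when they are half-integral.\<close>

definition heat_log :: "'z set \<Rightarrow> real \<Rightarrow> complex \<Rightarrow> 'z \<Rightarrow> complex" where
  "heat_log X \<delta> \<zeta> b = (if b \<in> X then Ln (\<zeta> + of_real (2 * \<delta>)) else Ln (1 - \<zeta>))"

text \<open>With \<open>A = (\<Sum>b\<in>Basis. dir_sign X b * \<partial>\<^sub>b\<^sup>2)\<close>, the Gaussian \<open>mixed_gaussian\<close> solves \<open>A mixed_gaussian = 4 \<Lambda> \<partial>\<^sub>\<zeta> mixed_gaussian\<close>.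
  It is the product of a forward heat kernel at time \<open>\<zeta> + 2 \<delta>\<close> in the directions in \<open>X\<close> and a
  backward heat kernel at time \<open>1 - \<zeta>\<close> in the others.\<close>

definition mixed_gaussian :: "'z::euclidean_space set \<Rightarrow> real \<Rightarrow> real \<Rightarrow> complex \<Rightarrow> 'z \<Rightarrow> complex" where
  "mixed_gaussian X \<delta> \<Lambda> \<zeta> z = exp (- (\<Sum>b\<in>Basis. heat_log X \<delta> \<zeta> b) / 2
     - of_real \<Lambda> * (\<Sum>b\<in>Basis. heat_rate X \<delta> \<zeta> b * of_real ((z \<bullet> b)\<^sup>2)))"

definition mixed_gaussian_d1 :: "'z::euclidean_space set \<Rightarrow> real \<Rightarrow> real \<Rightarrow> complex \<Rightarrow> 'z \<Rightarrow> 'z \<Rightarrow> complex" where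
  "mixed_gaussian_d1 X \<delta> \<Lambda> \<zeta> b z = of_real (- 2 * \<Lambda> * (z \<bullet> b)) * heat_rate X \<delta> \<zeta> b * mixed_gaussian X \<delta> \<Lambda> \<zeta> z"

definition mixed_gaussian_d2 :: "'z::euclidean_space set \<Rightarrow> real \<Rightarrow> real \<Rightarrow> complex \<Rightarrow> 'z \<Rightarrow> 'z \<Rightarrow> complex" where
  "mixed_gaussian_d2 X \<delta> \<Lambda> \<zeta> b z = (of_real (4 * \<Lambda>\<^sup>2 * (z \<bullet> b)\<^sup>2) * (heat_rate X \<delta> \<zeta> b)\<^sup>2 - of_real (2 * \<Lambda>) * heat_rate X \<delta> \<zeta> b) * mixed_gaussian X \<delta> \<Lambda> \<zeta> z"

definition mixed_gaussian_dz :: "'z::euclidean_space set \<Rightarrow> real \<Rightarrow> real \<Rightarrow> complex \<Rightarrow> 'z \<Rightarrow> complex" where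
  "mixed_gaussian_dz X \<delta> \<Lambda> \<zeta> z = mixed_gaussian X \<delta> \<Lambda> \<zeta> z * (- (\<Sum>b\<in>Basis. of_real (dir_sign X b) * heat_rate X \<delta> \<zeta> b) / 2
     + of_real \<Lambda> * (\<Sum>b\<in>Basis. of_real (dir_sign X b) * (heat_rate X \<delta> \<zeta> b)\<^sup>2 * of_real ((z \<bullet> b)\<^sup>2)))"

text \<open>Both heat times have positive real part here, so the principal logarithms are
  holomorphic. Openness and convexity serve the differentiation under the integral with respect to
  \<zeta>.\<close>

definition strip :: "real \<Rightarrow> complex set" where
  "strip \<delta> = {\<zeta>. - 2 * \<delta> < Re \<zeta>} \<inter> {\<zeta>. Re \<zeta> < 1}"

lemma open_strip: "open (strip \<delta>)" and convex_strip: "convex (strip \<delta>)"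
  unfolding strip_def
  by (auto intro!: open_Int open_halfspace_Re_gt open_halfspace_Re_lt convex_Int convex_halfspace_Re_gt convex_halfspace_Re_lt)

lemma strip_nz:
  assumes "\<zeta> \<in> strip \<delta>"
  shows "\<zeta> + of_real (2 * \<delta>) \<notin> \<real>\<^sub>\<le>\<^sub>0" "1 - \<zeta> \<notin> \<real>\<^sub>\<le>\<^sub>0" "\<zeta> + of_real (2 * \<delta>) \<noteq> 0" "1 - \<zeta> \<noteq> 0"
  using assms by (auto simp: strip_def complex_nonpos_Reals_iff complex_eq_iff)

lemma heat_rate_deriv:
  assumes "\<zeta> \<in> strip \<delta>"
  shows "((\<lambda>\<zeta>. heat_rate X \<delta> \<zeta> b) has_field_derivative - of_real (dir_sign X b) * (heat_rate X \<delta> \<zeta> b)\<^sup>2) (at \<zeta>)"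
proof (cases "b \<in> X")
  case True
  then show ?thesis using strip_nz(3)[OF assms] unfolding heat_rate_def dir_sign_def
    by (auto intro!: derivative_eq_intros simp: divide_simps power2_eq_square)
next
  case False
  then show ?thesis using strip_nz(4)[OF assms] unfolding heat_rate_def dir_sign_def
    by (auto intro!: derivative_eq_intros simp: divide_simps power2_eq_square)
qed

lemma heat_log_deriv:
  assumes "\<zeta> \<in> strip \<delta>"
  shows "((\<lambda>\<zeta>. heat_log X \<delta> \<zeta> b) has_field_derivative of_real (dir_sign X b) * heat_rate X \<delta> \<zeta> b) (at \<zeta>)"
proof (cases "b \<in> X")
  case True
  have "((\<lambda>\<zeta>. Ln (\<zeta> + of_real (2 * \<delta>))) has_field_derivative inverse (\<zeta> + of_real (2 * \<delta>)) * 1) (at \<zeta>)"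
    by (rule DERIV_chain2[where f = Ln and g = "\<lambda>\<zeta>. \<zeta> + of_real (2 * \<delta>)", OF has_field_derivative_Ln[OF strip_nz(1)[OF assms]]]) (auto intro!: derivative_eq_intros)
  with True show ?thesis unfolding heat_log_def heat_rate_def dir_sign_def by (simp add: field_simps)
next
  case False
  have "((\<lambda>\<zeta>. Ln (1 - \<zeta>)) has_field_derivative inverse (1 - \<zeta>) * (- 1)) (at \<zeta>)"
    by (rule DERIV_chain2[where f = Ln and g = "\<lambda>\<zeta>. 1 - \<zeta>", OF has_field_derivative_Ln[OF strip_nz(2)[OF assms]]]) (auto intro!: derivative_eq_intros)
  with False show ?thesis unfolding heat_log_def heat_rate_def dir_sign_def by (simp add: field_simps)
qed

lemma mixed_gaussian_dz_deriv:
  assumes "\<zeta> \<in> strip \<delta>"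
  shows "((\<lambda>\<zeta>. mixed_gaussian X \<delta> \<Lambda> \<zeta> z) has_field_derivative mixed_gaussian_dz X \<delta> \<Lambda> \<zeta> z) (at \<zeta>)"
proof -
  have 1: "((\<lambda>\<zeta>. - (\<Sum>b\<in>Basis. heat_log X \<delta> \<zeta> b) / 2) has_field_derivative - (\<Sum>b\<in>Basis. of_real (dir_sign X b) * heat_rate X \<delta> \<zeta> b) / 2) (at \<zeta>)"
    by (rule DERIV_cdivide[OF DERIV_minus[OF DERIV_sum]]) (rule heat_log_deriv[OF assms])
  have 2: "((\<lambda>\<zeta>. of_real \<Lambda> * (\<Sum>b\<in>Basis. heat_rate X \<delta> \<zeta> b * of_real ((z \<bullet> b)\<^sup>2))) has_field_derivative
     of_real \<Lambda> * (\<Sum>b\<in>Basis. - of_real (dir_sign X b) * (heat_rate X \<delta> \<zeta> b)\<^sup>2 * of_real ((z \<bullet> b)\<^sup>2))) (at \<zeta>)"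
    by (rule DERIV_cmult[OF DERIV_sum]) (rule DERIV_cmult_right[OF heat_rate_deriv[OF assms]])
  show ?thesis
    unfolding mixed_gaussian_def mixed_gaussian_dz_def
    by (rule DERIV_cong[OF DERIV_chain2[OF DERIV_exp DERIV_diff[OF 1 2]]]) (simp add: sum_negf)
qed

lemma quad_dir_deriv:
  fixes a :: "'z::euclidean_space \<Rightarrow> 'a::real_normed_field"
  assumes "b \<in> Basis"
  shows "((\<lambda>s. \<Sum>c\<in>Basis. a c * of_real (((z + s *\<^sub>R b) \<bullet> c)\<^sup>2)) has_vector_derivative a b * of_real (2 * (z \<bullet> b))) (at 0)"
proof -
  have "((\<lambda>s. ((z + s *\<^sub>R b) \<bullet> c)\<^sup>2) has_real_derivative 2 * (z \<bullet> c) * (b \<bullet> c)) (at 0)" for c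
    by (auto intro!: derivative_eq_intros simp: inner_add_left)
  then have "((\<lambda>s. (of_real (((z + s *\<^sub>R b) \<bullet> c)\<^sup>2) :: 'a)) has_vector_derivative of_real (2 * (z \<bullet> c) * (b \<bullet> c))) (at 0)" for c
    by (intro has_vector_derivative_of_real)
  then have "((\<lambda>s. \<Sum>c\<in>Basis. a c * of_real (((z + s *\<^sub>R b) \<bullet> c)\<^sup>2)) has_vector_derivative
      (\<Sum>c\<in>Basis. a c * of_real (2 * (z \<bullet> c) * (b \<bullet> c)))) (at 0)"
    by (intro has_vector_derivative_sum has_vector_derivative_mult_right)
  moreover have "(\<Sum>c\<in>Basis. a c * of_real (2 * (z \<bullet> c) * (b \<bullet> c))) = (\<Sum>c\<in>Basis. if c = b then a b * of_real (2 * (z \<bullet> b)) else 0)"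
    using assms by (intro sum.cong) (auto simp: inner_Basis)
  moreover have "\<dots> = a b * of_real (2 * (z \<bullet> b))" using assms by simp
  ultimately show ?thesis by simp
qed

lemma mixed_gaussian_d1_deriv:
  assumes "b \<in> Basis"
  shows "((\<lambda>s. mixed_gaussian X \<delta> \<Lambda> \<zeta> (z + s *\<^sub>R b)) has_vector_derivative mixed_gaussian_d1 X \<delta> \<Lambda> \<zeta> b z) (at 0)"
proof -
  have "((\<lambda>s. - (\<Sum>b\<in>Basis. heat_log X \<delta> \<zeta> b) / 2
     - of_real \<Lambda> * (\<Sum>c\<in>Basis. heat_rate X \<delta> \<zeta> c * of_real (((z + s *\<^sub>R b) \<bullet> c)\<^sup>2))) has_vector_derivative
     (0 - of_real \<Lambda> * (heat_rate X \<delta> \<zeta> b * of_real (2 * (z \<bullet> b))))) (at 0)"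
    by (intro has_vector_derivative_diff has_vector_derivative_const has_vector_derivative_mult_right quad_dir_deriv assms)
  from field_vector_diff_chain_at[OF this DERIV_exp]
  show ?thesis unfolding mixed_gaussian_def mixed_gaussian_d1_def by (simp add: o_def mult_ac)
qed

lemma mixed_gaussian_d2_deriv:
  assumes "b \<in> Basis"
  shows "((\<lambda>s. mixed_gaussian_d1 X \<delta> \<Lambda> \<zeta> b (z + s *\<^sub>R b)) has_vector_derivative mixed_gaussian_d2 X \<delta> \<Lambda> \<zeta> b z) (at 0)"
proof -
  have "((\<lambda>s. - 2 * \<Lambda> * ((z + s *\<^sub>R b) \<bullet> b)) has_real_derivative - 2 * \<Lambda>) (at 0)"
    using assms by (auto intro!: derivative_eq_intros simp: inner_add_left)
  then have 1: "((\<lambda>s. of_real (- 2 * \<Lambda> * ((z + s *\<^sub>R b) \<bullet> b)) * heat_rate X \<delta> \<zeta> b) has_vector_derivative of_real (- 2 * \<Lambda>) * heat_rate X \<delta> \<zeta> b) (at 0)"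
    by (intro has_vector_derivative_mult_left has_vector_derivative_of_real)
  show ?thesis
    unfolding mixed_gaussian_d1_def
    by (rule has_vector_derivative_eq_rhs[OF has_vector_derivative_mult[OF 1 mixed_gaussian_d1_deriv[OF assms]]])
      (simp add: mixed_gaussian_d1_def mixed_gaussian_d2_def algebra_simps power2_eq_square)
qed

text \<open>The directions separate. For rate \<kappa> the second derivative contributes the factor
  4 \<Lambda>^2 z^2 \<kappa>^2 - 2 \<Lambda> \<kappa>; the \<zeta>-derivatives of exponent and
  prefactor (\<open>heat_rate_deriv\<close>, \<open>heat_log_deriv\<close>) supply the same two
  terms divided by 4 \<Lambda>, with the sign of the direction.\<close>

lemma mixed_gaussian_heat:
  "(\<Sum>b\<in>Basis. of_real (dir_sign X b) * mixed_gaussian_d2 X \<delta> \<Lambda> \<zeta> b z) = of_real (4 * \<Lambda>) * mixed_gaussian_dz X \<delta> \<Lambda> \<zeta> z"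
  unfolding mixed_gaussian_d2_def mixed_gaussian_dz_def
  by (simp add: sum_distrib_left sum_distrib_right sum_subtractf[symmetric] sum.distrib[symmetric] sum_negf[symmetric] sum_divide_distrib algebra_simps power2_eq_square)


lemma continuous_mixed_gaussian:
  assumes f: "continuous_on A f" and g: "continuous_on A g" and s: "\<And>x. x \<in> A \<Longrightarrow> f x \<in> strip \<delta>"
  shows "continuous_on A (\<lambda>x. mixed_gaussian X \<delta> \<Lambda> (f x) (g x))"
    and "continuous_on A (\<lambda>x. mixed_gaussian_d1 X \<delta> \<Lambda> (f x) b (g x))"
    and "continuous_on A (\<lambda>x. mixed_gaussian_d2 X \<delta> \<Lambda> (f x) b (g x))"
    and "continuous_on A (\<lambda>x. mixed_gaussian_dz X \<delta> \<Lambda> (f x) (g x))"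
    and "continuous_on A (\<lambda>x. \<Sum>b\<in>Basis. heat_log X \<delta> (f x) (b::'z::euclidean_space))"
proof -
  have k: "continuous_on A (\<lambda>x. heat_rate X \<delta> (f x) b)" for b
    unfolding heat_rate_def using strip_nz[OF s] f by (cases "b \<in> X") (auto intro!: continuous_intros)
  have l: "continuous_on A (\<lambda>x. heat_log X \<delta> (f x) b)" for b
    unfolding heat_log_def using strip_nz[OF s] f by (cases "b \<in> X") (auto intro!: continuous_intros)
  show 0: "continuous_on A (\<lambda>x. mixed_gaussian X \<delta> \<Lambda> (f x) (g x))"
    unfolding mixed_gaussian_def by (intro continuous_intros k l g) simp
  show "continuous_on A (\<lambda>x. mixed_gaussian_d1 X \<delta> \<Lambda> (f x) b (g x))"
    unfolding mixed_gaussian_d1_def by (intro continuous_intros k 0 g)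
  show "continuous_on A (\<lambda>x. mixed_gaussian_d2 X \<delta> \<Lambda> (f x) b (g x))"
    unfolding mixed_gaussian_d2_def by (intro continuous_intros k 0 g)
  show "continuous_on A (\<lambda>x. mixed_gaussian_dz X \<delta> \<Lambda> (f x) (g x))"
    unfolding mixed_gaussian_dz_def by (intro continuous_intros k 0 g) simp
  show "continuous_on A (\<lambda>x. \<Sum>b\<in>Basis. heat_log X \<delta> (f x) (b::'z))"
    by (intro continuous_intros l)
qed

section \<open>Uniform Gaussian bounds on the disc with diameter [- \<delta>, \<rho>]\<close>

definition disc :: "real \<Rightarrow> real \<Rightarrow> complex set" where
  "disc \<delta> \<rho> = cball (of_real ((\<rho> - \<delta>) / 2)) ((\<rho> + \<delta>) / 2)"

text \<open>As \<zeta> runs over the disc, the two heat times run over the discs with diameters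
  [\<delta>, \<rho> + 2 \<delta>] and [1 - \<rho>, 1 + \<delta>], to which
  \<open>Re_inverse_ge\<close> applies.\<close>

lemma disc_bounds:
  assumes "0 < \<delta>" "\<delta> \<le> \<rho>" "\<rho> < 1" "\<zeta> \<in> disc \<delta> \<rho>"
  shows "\<delta> \<le> Re (\<zeta> + of_real (2 * \<delta>))" "1 / (\<rho> + 2 * \<delta>) \<le> Re (1 / (\<zeta> + of_real (2 * \<delta>)))"
    "1 - \<rho> \<le> Re (1 - \<zeta>)" "1 / (1 + \<delta>) \<le> Re (1 / (1 - \<zeta>))"
proof -
  have n: "cmod (\<zeta> - of_real ((\<rho> - \<delta>) / 2)) \<le> (\<rho> + \<delta>) / 2"
    using assms(4) by (simp add: disc_def dist_norm norm_minus_commute)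
  have e: "\<zeta> + of_real (2 * \<delta>) - of_real ((\<delta> + (\<rho> + 2 * \<delta>)) / 2) = \<zeta> - of_real ((\<rho> - \<delta>) / 2)"
    "1 - \<zeta> - of_real (((1 - \<rho>) + (1 + \<delta>)) / 2) = - (\<zeta> - of_real ((\<rho> - \<delta>) / 2))"
    by (auto simp: field_simps)
  have "cmod (\<zeta> + of_real (2 * \<delta>) - of_real ((\<delta> + (\<rho> + 2 * \<delta>)) / 2)) \<le> ((\<rho> + 2 * \<delta>) - \<delta>) / 2"
    unfolding e using n by simp
  from Re_inverse_ge[OF _ _ this] assms
  show "\<delta> \<le> Re (\<zeta> + of_real (2 * \<delta>))" "1 / (\<rho> + 2 * \<delta>) \<le> Re (1 / (\<zeta> + of_real (2 * \<delta>)))" by auto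
  have "cmod (1 - \<zeta> - of_real (((1 - \<rho>) + (1 + \<delta>)) / 2)) \<le> ((1 + \<delta>) - (1 - \<rho>)) / 2"
    unfolding e norm_minus_cancel using n by simp
  from Re_inverse_ge[OF _ _ this] assms
  show "1 - \<rho> \<le> Re (1 - \<zeta>)" "1 / (1 + \<delta>) \<le> Re (1 / (1 - \<zeta>))" by auto
qed

lemma disc_strip:
  assumes "0 < \<delta>" "\<delta> \<le> \<rho>" "\<rho> < 1"
  shows "disc \<delta> \<rho> \<subseteq> strip \<delta>"
  using disc_bounds[OF assms] assms by (fastforce simp: strip_def)

text \<open>These are the lower bounds for the real part of \<open>heat_rate\<close> from
  \<open>disc_bounds\<close>. The quadratic form \<open>weight_form\<close> built from them measures
  the decay of the Gaussian uniformly on the disc; it tends to |x|^2 / \<rho> + |y|^2 as \<delta>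
  tends to 0.\<close>

definition rate_bound :: "'z set \<Rightarrow> real \<Rightarrow> real \<Rightarrow> 'z \<Rightarrow> real" where
  "rate_bound X \<delta> \<rho> b = (if b \<in> X then 1 / (\<rho> + 2 * \<delta>) else 1 / (1 + \<delta>))"

definition weight_form :: "'z::euclidean_space set \<Rightarrow> real \<Rightarrow> real \<Rightarrow> 'z \<Rightarrow> real" where
  "weight_form X \<delta> \<rho> z = (\<Sum>b\<in>Basis. rate_bound X \<delta> \<rho> b * (z \<bullet> b)\<^sup>2)"

lemma norm_heat_rate_le:
  assumes "0 < \<delta>" "\<delta> \<le> \<rho>" "\<rho> < 1" "\<zeta> \<in> disc \<delta> \<rho>"
  shows "cmod (heat_rate X \<delta> \<zeta> b) \<le> 1 / \<delta> + 1 / (1 - \<rho>)"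
proof -
  note d = disc_bounds[OF assms]
  have "\<delta> \<le> cmod (\<zeta> + of_real (2 * \<delta>))" "1 - \<rho> \<le> cmod (1 - \<zeta>)"
    using d(1,3) complex_Re_le_cmod order_trans by blast+
  then have "cmod (1 / (\<zeta> + of_real (2 * \<delta>))) \<le> 1 / \<delta>" "cmod (1 / (1 - \<zeta>)) \<le> 1 / (1 - \<rho>)"
    unfolding norm_divide norm_one using assms by (auto intro!: divide_left_mono mult_pos_pos)
  moreover have "0 \<le> 1 / \<delta>" "0 \<le> 1 / (1 - \<rho>)" using assms by auto
  ultimately show ?thesis unfolding heat_rate_def by (smt (verit, best))
qed

text \<open>The prefactor depends neither on \<Lambda> nor on z and is continuous on the compact
  disc, so a bound for it serves as C. The exponential is controlled direction by direction through
  \<open>rate_bound\<close>.\<close>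

lemma norm_mixed_gaussian_le:
  fixes X :: "'z::euclidean_space set"
  assumes "0 < \<delta>" "\<delta> \<le> \<rho>" "\<rho> < 1"
  obtains C where "0 < C" "\<And>\<Lambda> \<zeta> z. 0 \<le> \<Lambda> \<Longrightarrow> \<zeta> \<in> disc \<delta> \<rho> \<Longrightarrow> cmod (mixed_gaussian X \<delta> \<Lambda> \<zeta> z) \<le> C * exp (- \<Lambda> * weight_form X \<delta> \<rho> z)"
proof -
  define P where "P \<zeta> = exp (- (\<Sum>b\<in>Basis. heat_log X \<delta> \<zeta> (b::'z)) / 2)" for \<zeta>
  have "continuous_on (disc \<delta> \<rho>) P"
    unfolding P_def
    by (intro continuous_intros continuous_mixed_gaussian(5)[of _ _ "\<lambda>_. 0::'z"]) (use disc_strip[OF assms] in auto)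
  moreover have "compact (disc \<delta> \<rho>)" by (simp add: disc_def)
  ultimately have "bounded (P ` disc \<delta> \<rho>)" using compact_continuous_image compact_imp_bounded by blast
  then obtain C where C: "0 < C" "\<And>\<zeta>. \<zeta> \<in> disc \<delta> \<rho> \<Longrightarrow> cmod (P \<zeta>) \<le> C"
    by (auto simp: bounded_pos)
  show thesis
  proof (rule that[OF C(1)])
    fix \<Lambda> :: real and \<zeta> and z :: 'z assume L: "0 \<le> \<Lambda>" and z: "\<zeta> \<in> disc \<delta> \<rho>"
    define s where "s = (\<Sum>b\<in>Basis. heat_rate X \<delta> \<zeta> b * of_real ((z \<bullet> b)\<^sup>2))"
    have "weight_form X \<delta> \<rho> z \<le> Re s"
      unfolding weight_form_def s_def Re_sum
    proof (rule sum_mono)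
      fix b :: 'z
      have "rate_bound X \<delta> \<rho> b \<le> Re (heat_rate X \<delta> \<zeta> b)"
        using disc_bounds(2,4)[OF assms z] by (auto simp: rate_bound_def heat_rate_def)
      then have "rate_bound X \<delta> \<rho> b * (z \<bullet> b)\<^sup>2 \<le> Re (heat_rate X \<delta> \<zeta> b) * (z \<bullet> b)\<^sup>2" by (rule mult_right_mono) simp
      then show "rate_bound X \<delta> \<rho> b * (z \<bullet> b)\<^sup>2 \<le> Re (heat_rate X \<delta> \<zeta> b * of_real ((z \<bullet> b)\<^sup>2))"
        by (simp del: of_real_power)
    qed
    then have "exp (- (\<Lambda> * Re s)) \<le> exp (- \<Lambda> * weight_form X \<delta> \<rho> z)" using L by (simp add: mult_left_mono)
    moreover have "mixed_gaussian X \<delta> \<Lambda> \<zeta> z = P \<zeta> * exp (- (of_real \<Lambda> * s))"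
      by (simp add: mixed_gaussian_def P_def s_def exp_add[symmetric])
    moreover have "cmod (exp (- (of_real \<Lambda> * s))) = exp (- (\<Lambda> * Re s))" by (simp add: norm_exp_eq_Re)
    ultimately show "cmod (mixed_gaussian X \<delta> \<Lambda> \<zeta> z) \<le> C * exp (- \<Lambda> * weight_form X \<delta> \<rho> z)"
      using C z by (auto simp: norm_mult intro!: mult_mono)
  qed
qed

text \<open>Both rates are at least 1 / (1 + 2 \<delta>). This coercivity makes a cut-off in terms
  of \<open>weight_form\<close> compactly supported.\<close>

lemma weight_form_ge:
  assumes "0 < \<delta>" "0 < \<rho>" "\<rho> < 1"
  shows "(norm z)\<^sup>2 / (1 + 2 * \<delta>) \<le> weight_form X \<delta> \<rho> z"
proof -
  have "(norm z)\<^sup>2 = (\<Sum>b\<in>Basis. (z \<bullet> b)\<^sup>2)"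
    unfolding power2_norm_eq_inner by (subst euclidean_inner) (simp add: power2_eq_square)
  then have "(norm z)\<^sup>2 / (1 + 2 * \<delta>) = (\<Sum>b\<in>Basis. 1 / (1 + 2 * \<delta>) * (z \<bullet> b)\<^sup>2)" by (simp add: sum_divide_distrib)
  also have "\<dots> \<le> weight_form X \<delta> \<rho> z"
    unfolding weight_form_def using assms by (intro sum_mono mult_right_mono) (auto simp: rate_bound_def frac_le)
  finally show ?thesis .
qed

section \<open>The flat Cauchy problem\<close>

lemma continuous_on_slice:
  assumes "continuous_on UNIV (\<lambda>(t, z). f t z)"
  shows "continuous_on A (f t)"
  using continuous_on_compose2[OF assms continuous_on_Pair[OF continuous_on_const[of A t] continuous_on_id]] by simp

text \<open>The variable t runs along the conormal and z = (x, y') over the initial hyperplane. The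
  weight \<rho> in \<open>init\<close> is also the right end of the contour: in the limit \<delta> =
  0 the quadratic form there is \<rho> times \<open>weight_form\<close>, so the data vanish for
  \<open>weight_form\<close> below r^2 / \<rho>, while the kernel grows at the rate T^2 / \<rho>.
  Comparing the two leads to T < r.\<close>

locale cauchy_problem =
  fixes X :: "'z::euclidean_space set" and w w1 w2 :: "real \<Rightarrow> 'z \<Rightarrow> real" and wd wdd :: "'z \<Rightarrow> real \<Rightarrow> 'z \<Rightarrow> real"
    and \<rho> r T :: real
  assumes d1: "\<And>t z. ((\<lambda>t. w t z) has_real_derivative w1 t z) (at t)"
    and d2: "\<And>t z. ((\<lambda>t. w1 t z) has_real_derivative w2 t z) (at t)"
    and db1: "\<And>b t z. b \<in> Basis \<Longrightarrow> ((\<lambda>s. w t (z + s *\<^sub>R b)) has_real_derivative wd b t z) (at 0)"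
    and db2: "\<And>b t z. b \<in> Basis \<Longrightarrow> ((\<lambda>s. wd b t (z + s *\<^sub>R b)) has_real_derivative wdd b t z) (at 0)"
    and cw: "continuous_on UNIV (\<lambda>(t, z). w t z)" and cw1: "continuous_on UNIV (\<lambda>(t, z). w1 t z)"
    and cw2: "continuous_on UNIV (\<lambda>(t, z). w2 t z)"
    and cwd: "\<And>b t. b \<in> Basis \<Longrightarrow> continuous_on UNIV (wd b t)"
    and cwdd: "\<And>b t. b \<in> Basis \<Longrightarrow> continuous_on UNIV (wdd b t)"
    and pde: "\<And>t z. w2 t z = (\<Sum>b\<in>Basis. dir_sign X b * wdd b t z)"
    and par: "0 < \<rho>" "\<rho> < 1" "0 < T" "T < r"
    and init: "\<And>z. (\<Sum>b\<in>Basis. (if b \<in> X then 1 else \<rho>) * (z \<bullet> b)\<^sup>2) < r\<^sup>2 \<Longrightarrow> w 0 z = 0"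
    and init1: "\<And>z. (\<Sum>b\<in>Basis. (if b \<in> X then 1 else \<rho>) * (z \<bullet> b)\<^sup>2) < r\<^sup>2 \<Longrightarrow> w1 0 z = 0"
begin

text \<open>The quadratic form in \<open>init\<close> is at most (\<rho> + 2 \<delta>) times
  \<open>weight_form\<close>: with equality in the directions of \<open>X\<close>, and by \<rho> (1
  + \<delta>) \<le> \<rho> + 2 \<delta> in the others. Thus the Cauchy data vanish wherever a
  cut-off at level q1 can be nonzero.\<close>

lemma init_weight_form:
  assumes "0 < \<delta>" and q: "(\<rho> + 2 * \<delta>) * q1 \<le> r\<^sup>2" "weight_form X \<delta> \<rho> z < q1"
  shows "w 0 z = 0" "w1 0 z = 0"
proof -
  have "(\<Sum>b\<in>Basis. (if b \<in> X then 1 else \<rho>) * (z \<bullet> b)\<^sup>2) \<le> (\<Sum>b\<in>Basis. (\<rho> + 2 * \<delta>) * (rate_bound X \<delta> \<rho> b * (z \<bullet> b)\<^sup>2))"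
  proof (rule sum_mono)
    fix b :: 'z
    have "(if b \<in> X then 1 else \<rho>) \<le> (\<rho> + 2 * \<delta>) * rate_bound X \<delta> \<rho> b"
    proof (cases "b \<in> X")
      case False
      have "\<rho> * (1 + \<delta>) \<le> \<rho> + 2 * \<delta>" using par assms(1) by (simp add: algebra_simps)
      then show ?thesis using False assms(1) par by (simp add: rate_bound_def field_simps)
    qed (use par assms(1) in \<open>simp add: rate_bound_def\<close>)
    then show "(if b \<in> X then 1 else \<rho>) * (z \<bullet> b)\<^sup>2 \<le> (\<rho> + 2 * \<delta>) * (rate_bound X \<delta> \<rho> b * (z \<bullet> b)\<^sup>2)"
      unfolding mult.assoc[symmetric] by (rule mult_right_mono) simp
  qed
  also have "\<dots> = (\<rho> + 2 * \<delta>) * weight_form X \<delta> \<rho> z" by (simp add: weight_form_def sum_distrib_left)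
  also have "\<dots> < (\<rho> + 2 * \<delta>) * q1" using q par assms(1) by (intro mult_strict_left_mono) auto
  finally have "(\<Sum>b\<in>Basis. (if b \<in> X then 1 else \<rho>) * (z \<bullet> b)\<^sup>2) < r\<^sup>2" using q by simp
  then show "w 0 z = 0" "w1 0 z = 0" by (rule init, rule init1)
qed

text \<open>The cut-off is a function of \<open>weight_form\<close>, so its derivatives live in the
  shell between the levels q0 and q1, where the Gaussian is at most a constant times exp(- \<Lambda>
  q0). The kernel costs exp(\<Lambda> T^2 / \<rho>); the product is the stated rate. The factor
  \<Lambda> comes from a derivative falling on the Gaussian.\<close>

lemma gaussian_pairing_bound:
  assumes \<delta>: "0 < \<delta>" "\<delta> \<le> \<rho>" and q: "0 < q0" "q0 < q1" "(\<rho> + 2 * \<delta>) * q1 \<le> r\<^sup>2"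
  obtains \<phi> :: "'z \<Rightarrow> real" and k C where "continuous_on UNIV \<phi>" "\<phi> 0 = 1" "cball 0 1 \<subseteq> cbox (- k) k" "0 \<le> C"
    "\<And>\<Lambda>. 1 \<le> \<Lambda> \<Longrightarrow> cmod (integral (cbox (- k) k) (\<lambda>z. of_real (w T z * \<phi> z) * mixed_gaussian X \<delta> \<Lambda> 0 z))
        \<le> C * \<Lambda> * exp (- \<Lambda> * (q0 - T\<^sup>2 / \<rho>))"
proof -
  obtain \<Psi> \<Psi>1 \<Psi>2 :: "real \<Rightarrow> real" where \<Psi>:
    "\<And>s. (\<Psi> has_real_derivative \<Psi>1 s) (at s)" "\<And>s. (\<Psi>1 has_real_derivative \<Psi>2 s) (at s)"
    "continuous_on UNIV \<Psi>2"
    "\<And>s. s \<le> q0 \<Longrightarrow> \<Psi> s = 1" "\<And>s. s < q0 \<Longrightarrow> \<Psi>1 s = 0" "\<And>s. s < q0 \<Longrightarrow> \<Psi>2 s = 0"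
    "\<And>s. q1 \<le> s \<Longrightarrow> \<Psi> s = 0" "\<And>s. q1 \<le> s \<Longrightarrow> \<Psi>1 s = 0"
    using C2_cutoff[OF q(2)] by blast
  define Q where "Q = weight_form X \<delta> \<rho>"
  define \<kappa> where "\<kappa> = rate_bound X \<delta> \<rho>"
  define \<phi> where "\<phi> z = \<Psi> (Q z)" for z
  define \<phi>1 where "\<phi>1 b z = \<Psi>1 (Q z) * (2 * \<kappa> b * (z \<bullet> b))" for b z
  define \<phi>2 where "\<phi>2 b z = \<Psi>2 (Q z) * (2 * \<kappa> b * (z \<bullet> b))\<^sup>2 + \<Psi>1 (Q z) * (2 * \<kappa> b)" for b z
  have Qc: "continuous_on A Q" for A unfolding Q_def weight_form_def by (intro continuous_intros)
  have c\<Psi>: "continuous_on UNIV \<Psi>" "continuous_on UNIV \<Psi>1"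
    using \<Psi>(1,2) by (auto intro!: DERIV_continuous_on)
  have \<phi>c: "continuous_on A \<phi>" for A
    unfolding \<phi>_def by (rule continuous_on_compose2[OF c\<Psi>(1) Qc]) simp
  have \<phi>1c: "continuous_on A (\<phi>1 b)" for A b
    unfolding \<phi>1_def by (intro continuous_intros continuous_on_compose2[OF c\<Psi>(2) Qc]) simp
  have \<phi>2c: "continuous_on A (\<phi>2 b)" for A b
    unfolding \<phi>2_def by (intro continuous_intros continuous_on_compose2[OF c\<Psi>(2) Qc] continuous_on_compose2[OF \<Psi>(3) Qc]) simp_all
  have Qd: "((\<lambda>s. Q (z + s *\<^sub>R b)) has_real_derivative 2 * \<kappa> b * (z \<bullet> b)) (at 0)" if "b \<in> Basis" for b z
    using quad_dir_deriv[OF that, of \<kappa> z]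
    by (simp add: Q_def weight_form_def \<kappa>_def has_real_derivative_iff_has_vector_derivative mult_ac)
  have \<phi>d1: "((\<lambda>s. \<phi> (z + s *\<^sub>R b)) has_real_derivative \<phi>1 b z) (at 0)" if "b \<in> Basis" for b z
    unfolding \<phi>_def \<phi>1_def using DERIV_chain2[OF \<Psi>(1) Qd[OF that]] by simp
  have \<phi>d2: "((\<lambda>s. \<phi>1 b (z + s *\<^sub>R b)) has_real_derivative \<phi>2 b z) (at 0)" if "b \<in> Basis" for b z
  proof -
    have a: "((\<lambda>s. \<Psi>1 (Q (z + s *\<^sub>R b))) has_real_derivative \<Psi>2 (Q z) * (2 * \<kappa> b * (z \<bullet> b))) (at 0)"
      using DERIV_chain2[OF \<Psi>(2) Qd[OF that]] by simp
    have c: "((\<lambda>s. 2 * \<kappa> b * ((z + s *\<^sub>R b) \<bullet> b)) has_real_derivative 2 * \<kappa> b) (at 0)"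
      using that by (auto intro!: derivative_eq_intros simp: inner_add_left)
    show ?thesis unfolding \<phi>1_def \<phi>2_def
      by (rule DERIV_cong[OF DERIV_mult[OF a c]]) (simp add: algebra_simps power2_eq_square)
  qed
  \<comment> \<open>Since K \<ge> 1, a norm of at least K is bounded by its square. Hence |z| \<ge>
    K forces |z|^2 \<ge> (1 + 2 \<delta>) q1 and, by \<open>weight_form_ge\<close>, the vanishing of
    the cut-off, with no square root in K.\<close>
  define K where "K = 1 + (1 + 2 * \<delta>) * q1"
  have K1: "1 \<le> K" using \<delta> q by (simp add: K_def)
  have QK: "q1 \<le> Q z" if "K \<le> norm z" for z
  proof -
    have "(1 + 2 * \<delta>) * q1 \<le> norm z" using that by (simp add: K_def)
    also have "\<dots> \<le> (norm z)\<^sup>2" using that K1 by (intro self_le_power) auto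
    finally have "q1 \<le> (norm z)\<^sup>2 / (1 + 2 * \<delta>)" using \<delta> by (simp add: field_simps)
    also have "\<dots> \<le> Q z" unfolding Q_def by (rule weight_form_ge[OF \<delta>(1) par(1,2)])
    finally show ?thesis .
  qed
  define k :: 'z where "k = (K + 1) *\<^sub>R One"
  have box: "cball 0 (K + 1) \<subseteq> cbox (- k) k"
  proof
    fix z :: 'z assume z: "z \<in> cball 0 (K + 1)"
    have "- (K + 1) \<le> z \<bullet> b \<and> z \<bullet> b \<le> K + 1" if "b \<in> Basis" for b
      using Basis_le_norm[OF that, of z] z by (simp add: abs_le_iff)
    then show "z \<in> cbox (- k) k" by (simp add: mem_box k_def)
  qed
  define B where "B = cbox (- k) k"
  have Bc: "compact B" unfolding B_def by simp
  obtain Cg where Cg: "0 < Cg" "\<And>\<Lambda> \<zeta> z. 0 \<le> \<Lambda> \<Longrightarrow> \<zeta> \<in> disc \<delta> \<rho> \<Longrightarrow> cmod (mixed_gaussian X \<delta> \<Lambda> \<zeta> z) \<le> Cg * exp (- \<Lambda> * Q z)"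
    using norm_mixed_gaussian_le[OF \<delta> par(2), of X] unfolding Q_def by metis
  have bnd: "\<exists>M. 0 \<le> M \<and> (\<forall>z\<in>B. \<forall>b\<in>Basis. \<bar>f b z\<bar> \<le> M)" if "\<And>b. continuous_on B (f b)" for f :: "'z \<Rightarrow> 'z \<Rightarrow> real"
  proof -
    have "continuous_on B (\<lambda>z. \<Sum>b\<in>Basis. \<bar>f b z\<bar>)" by (intro continuous_intros that)
    then have "bounded ((\<lambda>z. \<Sum>b\<in>Basis. \<bar>f b z\<bar>) ` B)" using Bc compact_continuous_image compact_imp_bounded by blast
    then obtain M where M: "0 < M" "\<forall>z\<in>B. \<bar>\<Sum>b\<in>Basis. \<bar>f b z\<bar>\<bar> \<le> M" by (auto simp: bounded_pos)
    have "\<bar>f b z\<bar> \<le> M" if "z \<in> B" "b \<in> Basis" for b z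
    proof -
      have "\<bar>f b z\<bar> \<le> (\<Sum>b\<in>Basis. \<bar>f b z\<bar>)" by (rule member_le_sum) (use that in auto)
      also have "\<dots> \<le> M" using M(2) that(1) by force
      finally show ?thesis .
    qed
    then show ?thesis using M(1) by (intro exI[of _ M]) auto
  qed
  obtain M1 where M1: "0 \<le> M1" "\<forall>z\<in>B. \<forall>b\<in>Basis. \<bar>\<phi>1 b z\<bar> \<le> M1" using bnd[of \<phi>1] \<phi>1c by blast
  obtain M2 where M2: "0 \<le> M2" "\<forall>z\<in>B. \<forall>b\<in>Basis. \<bar>\<phi>2 b z\<bar> \<le> M2" using bnd[of \<phi>2] \<phi>2c by blast
  obtain Mz where Mz: "0 \<le> Mz" "\<forall>z\<in>B. \<forall>b\<in>Basis. \<bar>z \<bullet> b\<bar> \<le> Mz"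
    using bnd[of "\<lambda>b z. z \<bullet> b", OF continuous_on_inner[OF continuous_on_id continuous_on_const]] by blast
  obtain Mw where Mw: "0 < Mw" "\<And>t z. 0 \<le> t \<Longrightarrow> t \<le> T \<Longrightarrow> z \<in> B \<Longrightarrow> \<bar>w t z\<bar> \<le> Mw"
  proof -
    have "compact ({0..T} \<times> B)" by (intro compact_Times Bc) simp
    then have "bounded ((\<lambda>(t, z). w t z) ` ({0..T} \<times> B))"
      by (intro compact_imp_bounded compact_continuous_image continuous_on_subset[OF cw]) auto
    then show thesis using that by (auto simp: bounded_pos)
  qed
  define \<kappa>m where "\<kappa>m = 1 / \<delta> + 1 / (1 - \<rho>)"
  have \<kappa>m: "0 \<le> \<kappa>m" using \<delta> par by (simp add: \<kappa>m_def)
  define C0 where "C0 = Mw * (DIM('z) * ((M2 + 4 * M1 * Mz * \<kappa>m) * Cg)) * measure lborel B"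
  have C0: "0 \<le> C0" unfolding C0_def using Mw M1 M2 Mz \<kappa>m Cg by (intro mult_nonneg_nonneg add_nonneg_nonneg) auto
  define C where "C = T * \<rho> * (T / \<delta> * C0)"
  have goal: "cmod (integral B (\<lambda>z. of_real (w T z * \<phi> z) * mixed_gaussian X \<delta> \<Lambda> 0 z)) \<le> C * \<Lambda> * exp (- \<Lambda> * (q0 - T\<^sup>2 / \<rho>))"
    if L: "1 \<le> \<Lambda>" for \<Lambda>
  proof -
    define g where "g = mixed_gaussian X \<delta> \<Lambda>"
    define g1 where "g1 = mixed_gaussian_d1 X \<delta> \<Lambda>"
    define g2 where "g2 = mixed_gaussian_d2 X \<delta> \<Lambda>"
    define gz where "gz = mixed_gaussian_dz X \<delta> \<Lambda>"
    define S where "S = strip \<delta>"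
    \<comment> \<open>With A the signed sum of second derivatives, \<open>kk\<close> is the
      commutator of A with the cut-off, applied to the Gaussian: A(\<phi> g) - \<phi> A g.\<close>
    define kk where "kk \<zeta> z = (\<Sum>b\<in>Basis. of_real (dir_sign X b) * (of_real (\<phi>2 b z) * g \<zeta> z + of_real (2 * \<phi>1 b z) * g1 \<zeta> b z))" for \<zeta> z
    define I where "I t \<zeta> = integral B (\<lambda>z. of_real (w t z * \<phi> z) * g \<zeta> z)" for t \<zeta>
    define I1 where "I1 t \<zeta> = integral B (\<lambda>z. of_real (w1 t z * \<phi> z) * g \<zeta> z)" for t \<zeta>
    define I2 where "I2 t \<zeta> = integral B (\<lambda>z. of_real (w2 t z * \<phi> z) * g \<zeta> z)" for t \<zeta>
    define Iz where "Iz t \<zeta> = integral B (\<lambda>z. of_real (w t z * \<phi> z) * gz \<zeta> z)" for t \<zeta>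
    define Er where "Er t \<zeta> = integral B (\<lambda>z. of_real (w t z) * kk \<zeta> z)" for t \<zeta>
    have gc: "continuous_on A (g \<zeta>)" "continuous_on A (g1 \<zeta> b)" "continuous_on A (g2 \<zeta> b)" "continuous_on A (gz \<zeta>)"
      if "\<zeta> \<in> S" for \<zeta> b A
      unfolding g_def g1_def g2_def gz_def using that S_def
      by (auto intro!: continuous_mixed_gaussian(1-4)[of A "\<lambda>_. \<zeta>" "\<lambda>z. z"] continuous_intros)
    have gcp: "continuous_on ((UNIV \<times> S) \<times> B) (\<lambda>p. g (snd (fst p)) (snd p))"
      "continuous_on (S \<times> B) (\<lambda>p. gz (fst p) (snd p))"
      "continuous_on (S \<times> B) (\<lambda>p. g (fst p) (snd p))" "\<And>b. continuous_on (S \<times> B) (\<lambda>p. g1 (fst p) b (snd p))"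
      unfolding g_def gz_def g1_def S_def
      by (rule continuous_mixed_gaussian; auto intro!: continuous_intros)+
    have wc: "continuous_on A (\<lambda>p. w (f p) (h p))" "continuous_on A (\<lambda>p. w1 (f p) (h p))" "continuous_on A (\<lambda>p. w2 (f p) (h p))"
      if "continuous_on A f" "continuous_on A h" for A :: "'q::topological_space set" and f h
      using continuous_on_compose2[OF cw continuous_on_Pair[OF that]]
        continuous_on_compose2[OF cw1 continuous_on_Pair[OF that]]
        continuous_on_compose2[OF cw2 continuous_on_Pair[OF that]] by auto
    have \<phi>s: "continuous_on A (\<lambda>p. \<phi> (f p))" if "continuous_on A f" for A :: "'q::topological_space set" and f
      by (rule continuous_on_compose2[OF \<phi>c[of UNIV] that]) simp
    have \<phi>1s: "continuous_on A (\<lambda>p. \<phi>1 b (f p))" if "continuous_on A f" for A :: "'q::topological_space set" and f b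
      by (rule continuous_on_compose2[OF \<phi>1c[of UNIV] that]) simp
    have \<phi>2s: "continuous_on A (\<lambda>p. \<phi>2 b (f p))" if "continuous_on A f" for A :: "'q::topological_space set" and f b
      by (rule continuous_on_compose2[OF \<phi>2c[of UNIV] that]) simp
    have par1: "continuous_on (UNIV \<times> S) (\<lambda>x. integral B (\<lambda>z. of_real (f (fst x) z * \<phi> z) * g (snd x) z))"
      if f: "continuous_on UNIV (\<lambda>(t, z). f t z)" for f :: "real \<Rightarrow> 'z \<Rightarrow> real"
    proof -
      have "continuous_on ((UNIV \<times> S) \<times> B) (\<lambda>p. f (fst (fst p)) (snd p))"
        using continuous_on_compose2[OF f continuous_on_Pair[OF continuous_on_fst[OF continuous_on_fst[OF continuous_on_id]] continuous_on_snd[OF continuous_on_id]]] by simp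
      then show ?thesis
        unfolding B_def
        by (intro integral_continuous_on_param, unfold split_beta B_def[symmetric])
          (intro continuous_intros \<phi>s gcp(1))
    qed
    have tder: "((\<lambda>t. integral B (\<lambda>z. of_real (f t z * \<phi> z) * g \<zeta> z)) has_vector_derivative
        integral B (\<lambda>z. of_real (f' t z * \<phi> z) * g \<zeta> z)) (at t)"
      if f: "\<And>t z. ((\<lambda>t. f t z) has_real_derivative f' t z) (at t)" "continuous_on UNIV (\<lambda>(t, z). f t z)"
        "continuous_on UNIV (\<lambda>(t, z). f' t z)" and "\<zeta> \<in> S" for f f' :: "real \<Rightarrow> 'z \<Rightarrow> real" and t \<zeta>
    proof -
      have "((\<lambda>t. integral (cbox (- k) k) (\<lambda>z. of_real (f t z * \<phi> z) * g \<zeta> z)) has_vector_derivative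
        integral (cbox (- k) k) (\<lambda>z. of_real (f' t z * \<phi> z) * g \<zeta> z)) (at t within UNIV)"
      proof (rule leibniz_rule_vector_derivative)
        show "((\<lambda>t. of_real (f t z * \<phi> z) * g \<zeta> z) has_vector_derivative of_real (f' t z * \<phi> z) * g \<zeta> z) (at t within UNIV)" for t z
          by (intro has_vector_derivative_mult_left has_vector_derivative_of_real DERIV_cmult_right f(1))
        show "(\<lambda>z. of_real (f t z * \<phi> z) * g \<zeta> z) integrable_on cbox (- k) k" for t
          by (intro integrable_continuous continuous_intros \<phi>c gc(1) continuous_on_slice[OF f(2)] \<open>\<zeta> \<in> S\<close>)
        have "continuous_on (UNIV \<times> cbox (- k) k) (\<lambda>p. f' (fst p) (snd p))"
          using continuous_on_subset[OF f(3)] by (simp add: split_beta)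
        then show "continuous_on (UNIV \<times> cbox (- k) k) (\<lambda>(t, z). of_real (f' t z * \<phi> z) * g \<zeta> z)"
          unfolding split_beta by (intro continuous_intros \<phi>s continuous_on_compose2[OF gc(1)[OF \<open>\<zeta> \<in> S\<close>]]) auto
      qed auto
      then show ?thesis by (simp add: B_def)
    qed
    \<comment> \<open>Green's formula in one direction: the integrand is the b-derivative of the
      flux w_b \<phi> g - w (\<phi> g)_b, in which the cross terms w_b (\<phi> g)_b cancel.\<close>
    have by_parts: "integral B (\<lambda>z. of_real (wdd b t z * \<phi> z) * g \<zeta> z
        - of_real (w t z) * (of_real (\<phi>2 b z) * g \<zeta> z + of_real (2 * \<phi>1 b z) * g1 \<zeta> b z + of_real (\<phi> z) * g2 \<zeta> b z)) = 0"
      if b: "b \<in> Basis" and z: "\<zeta> \<in> S" for b t \<zeta>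
      unfolding B_def
    proof (rule integral_directional_derivative_eq_0[where b = b and K = K and
          F = "\<lambda>z. of_real (wd b t z * \<phi> z) * g \<zeta> z - of_real (w t z) * (of_real (\<phi>1 b z) * g \<zeta> z + of_real (\<phi> z) * g1 \<zeta> b z)"])
      fix x
      have G1: "((\<lambda>s. g \<zeta> (x + s *\<^sub>R b)) has_vector_derivative g1 \<zeta> b x) (at 0)"
        unfolding g_def g1_def by (rule mixed_gaussian_d1_deriv[OF b])
      have G2: "((\<lambda>s. g1 \<zeta> b (x + s *\<^sub>R b)) has_vector_derivative g2 \<zeta> b x) (at 0)"
        unfolding g2_def g1_def by (rule mixed_gaussian_d2_deriv[OF b])
      have R: "((\<lambda>s. complex_of_real (w t (x + s *\<^sub>R b))) has_vector_derivative of_real (wd b t x)) (at 0)"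
        "((\<lambda>s. complex_of_real (\<phi> (x + s *\<^sub>R b))) has_vector_derivative of_real (\<phi>1 b x)) (at 0)"
        "((\<lambda>s. complex_of_real (\<phi>1 b (x + s *\<^sub>R b))) has_vector_derivative of_real (\<phi>2 b x)) (at 0)"
        "((\<lambda>s. complex_of_real (wd b t (x + s *\<^sub>R b))) has_vector_derivative of_real (wdd b t x)) (at 0)"
        by (intro has_vector_derivative_of_real db1 db2 \<phi>d1 \<phi>d2 b)+
      show "((\<lambda>s. of_real (wd b t (x + s *\<^sub>R b) * \<phi> (x + s *\<^sub>R b)) * g \<zeta> (x + s *\<^sub>R b)
          - of_real (w t (x + s *\<^sub>R b)) * (of_real (\<phi>1 b (x + s *\<^sub>R b)) * g \<zeta> (x + s *\<^sub>R b) + of_real (\<phi> (x + s *\<^sub>R b)) * g1 \<zeta> b (x + s *\<^sub>R b)))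
          has_vector_derivative of_real (wdd b t x * \<phi> x) * g \<zeta> x
        - of_real (w t x) * (of_real (\<phi>2 b x) * g \<zeta> x + of_real (2 * \<phi>1 b x) * g1 \<zeta> b x + of_real (\<phi> x) * g2 \<zeta> b x)) (at 0)"
        unfolding of_real_mult
        by (rule has_vector_derivative_eq_rhs[OF has_vector_derivative_diff[OF
              has_vector_derivative_mult[OF has_vector_derivative_mult[OF R(4) R(2)] G1]
              has_vector_derivative_mult[OF R(1) has_vector_derivative_add[OF
                has_vector_derivative_mult[OF R(3) G1] has_vector_derivative_mult[OF R(2) G2]]]]])
          (simp add: algebra_simps)
    next
      fix x :: 'z assume "K \<le> norm x"
      then have "\<phi> x = 0" "\<phi>1 b x = 0" using \<Psi>(7,8)[OF QK] by (auto simp: \<phi>_def \<phi>1_def)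
      then show "of_real (wd b t x * \<phi> x) * g \<zeta> x - of_real (w t x) * (of_real (\<phi>1 b x) * g \<zeta> x + of_real (\<phi> x) * g1 \<zeta> b x) = 0"
        by simp
    qed (use box b in \<open>auto intro!: continuous_intros \<phi>c \<phi>1c \<phi>2c gc z cwd cwdd continuous_on_slice[OF cw]\<close>)
    \<comment> \<open>Summing \<open>by_parts\<close> with the signs of the operator moves it from w
      to \<phi> g; \<open>mixed_gaussian_heat\<close> turns the part \<phi> A g into the
      \<zeta>-derivative, and \<open>kk\<close> remains as the error.\<close>
    have pde2: "I2 t \<zeta> = of_real (4 * \<Lambda>) * Iz t \<zeta> + Er t \<zeta>" if z: "\<zeta> \<in> S" for t \<zeta>
    proof -
      define D where "D b x = of_real (wdd b t x * \<phi> x) * g \<zeta> x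
        - of_real (w t x) * (of_real (\<phi>2 b x) * g \<zeta> x + of_real (2 * \<phi>1 b x) * g1 \<zeta> b x + of_real (\<phi> x) * g2 \<zeta> b x)" for b x
      have Di: "D b integrable_on B" if "b \<in> Basis" for b
        unfolding D_def B_def
        by (intro integrable_continuous continuous_intros \<phi>c \<phi>1c \<phi>2c gc z continuous_on_slice[OF cw] continuous_on_subset[OF cwdd[OF that] subset_UNIV])
      have D0: "integral B (D b) = 0" if "b \<in> Basis" for b
        unfolding D_def[abs_def] by (rule by_parts[OF that z])
      have "0 = (\<Sum>b\<in>Basis. of_real (dir_sign X b) * integral B (D b))"
        using D0 by simp
      also have "\<dots> = integral B (\<lambda>x. \<Sum>b\<in>Basis. of_real (dir_sign X b) * D b x)"
        by (subst integral_sum) (auto intro!: integrable_on_mult_right Di)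
      also have "(\<lambda>x. \<Sum>b\<in>Basis. of_real (dir_sign X b) * D b x) = (\<lambda>x. of_real (w2 t x * \<phi> x) * g \<zeta> x
          - (of_real (4 * \<Lambda>) * (of_real (w t x * \<phi> x) * gz \<zeta> x) + of_real (w t x) * kk \<zeta> x))"
      proof
        fix x
        have 1: "(\<Sum>b\<in>Basis. of_real (dir_sign X b) * g2 \<zeta> b x) = of_real (4 * \<Lambda>) * gz \<zeta> x"
          unfolding g2_def gz_def by (rule mixed_gaussian_heat)
        have "(\<Sum>b\<in>Basis. of_real (dir_sign X b) * D b x)
          = (\<Sum>b\<in>Basis. of_real (dir_sign X b * wdd b t x) * (of_real (\<phi> x) * g \<zeta> x)
             - (of_real (w t x * \<phi> x) * (of_real (dir_sign X b) * g2 \<zeta> b x)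
             + of_real (w t x) * (of_real (dir_sign X b) * (of_real (\<phi>2 b x) * g \<zeta> x + of_real (2 * \<phi>1 b x) * g1 \<zeta> b x))))"
          by (intro sum.cong refl) (simp add: D_def algebra_simps)
        also have "\<dots> = of_real (w2 t x) * (of_real (\<phi> x) * g \<zeta> x)
           - (of_real (w t x * \<phi> x) * (of_real (4 * \<Lambda>) * gz \<zeta> x) + of_real (w t x) * kk \<zeta> x)"
          unfolding sum_subtractf sum.distrib kk_def 1[symmetric] pde sum_distrib_left sum_distrib_right of_real_sum by simp
        finally show "(\<Sum>b\<in>Basis. of_real (dir_sign X b) * D b x) = of_real (w2 t x * \<phi> x) * g \<zeta> x
          - (of_real (4 * \<Lambda>) * (of_real (w t x * \<phi> x) * gz \<zeta> x) + of_real (w t x) * kk \<zeta> x)" by (simp add: mult_ac)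
      qed
      also have "integral B \<dots> = I2 t \<zeta> - (of_real (4 * \<Lambda>) * Iz t \<zeta> + Er t \<zeta>)"
      proof -
        have i: "(\<lambda>x. of_real (w2 t x * \<phi> x) * g \<zeta> x) integrable_on B" "(\<lambda>x. of_real (w t x * \<phi> x) * gz \<zeta> x) integrable_on B"
          "(\<lambda>x. of_real (w t x) * kk \<zeta> x) integrable_on B"
          unfolding B_def kk_def
          by (intro integrable_continuous continuous_intros \<phi>c \<phi>1c \<phi>2c gc z continuous_on_slice[OF cw] continuous_on_slice[OF cw2])+
        show ?thesis
          unfolding I2_def Iz_def Er_def
          using i by (simp add: integral_diff integral_add integrable_add integrable_on_mult_right del: of_real_mult)
      qed
      finally show ?thesis by simp
    qed
    have dz: "(I t has_field_derivative Iz t \<zeta>) (at \<zeta>)" if z: "\<zeta> \<in> S" for t \<zeta>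
    proof -
      have "((\<lambda>\<zeta>. integral (cbox (- k) k) (\<lambda>z. of_real (w t z * \<phi> z) * g \<zeta> z)) has_field_derivative
        integral (cbox (- k) k) (\<lambda>z. of_real (w t z * \<phi> z) * gz \<zeta> z)) (at \<zeta> within S)"
      proof (rule leibniz_rule_field_derivative[OF _ _ _ z])
        show "((\<lambda>\<zeta>. of_real (w t x * \<phi> x) * g \<zeta> x) has_field_derivative of_real (w t x * \<phi> x) * gz \<zeta> x) (at \<zeta> within S)"
          if "\<zeta> \<in> S" for \<zeta> x
          unfolding g_def gz_def
          by (intro DERIV_cmult DERIV_subset[OF mixed_gaussian_dz_deriv subset_UNIV]) (use that in \<open>simp add: S_def\<close>)
        show "(\<lambda>z. of_real (w t z * \<phi> z) * g \<zeta> z) integrable_on cbox (- k) k" if "\<zeta> \<in> S" for \<zeta>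
          by (intro integrable_continuous continuous_intros \<phi>c gc(1) continuous_on_slice[OF cw] that)
        show "continuous_on (S \<times> cbox (- k) k) (\<lambda>(\<zeta>, z). of_real (w t z * \<phi> z) * gz \<zeta> z)"
          unfolding split_beta B_def[symmetric]
          by (intro continuous_intros \<phi>s wc gcp(2))
        show "convex S" unfolding S_def by (rule convex_strip)
      qed
      then show ?thesis using at_within_open[OF z] open_strip by (simp add: I_def[abs_def] Iz_def B_def S_def)
    qed
    have Erc: "continuous_on S (Er t)" for t
      unfolding Er_def[abs_def] B_def
      by (rule integral_continuous_on_param, unfold split_beta kk_def B_def[symmetric])
        (intro continuous_intros \<phi>1s \<phi>2s wc gcp(3,4))
    define M where "M = C0 * \<Lambda> * exp (- \<Lambda> * q0)"
    have Erb: "cmod (Er t \<zeta>) \<le> M" if t: "0 \<le> t" "t \<le> T" and z: "\<zeta> \<in> disc \<delta> \<rho>" for t \<zeta>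
    proof -
      define E where "E = Cg * exp (- \<Lambda> * q0)"
      have E: "0 \<le> E" using Cg by (simp add: E_def)
      have zS: "\<zeta> \<in> S" using disc_strip[OF \<delta> par(2)] z S_def by blast
      define M' where "M' = Mw * (DIM('z) * ((M2 + 4 * M1 * Mz * \<kappa>m) * \<Lambda> * E))"
      have M': "0 \<le> M'" unfolding M'_def using Mw M1 M2 Mz \<kappa>m E L by (intro mult_nonneg_nonneg add_nonneg_nonneg) auto
      have "cmod (integral (cbox (- k) k) (\<lambda>x. of_real (w t x) * kk \<zeta> x)) \<le> M' * measure lborel (cbox (- k) k)"
      proof (rule integrable_bound[OF M'])
        show "(\<lambda>x. of_real (w t x) * kk \<zeta> x) integrable_on cbox (- k) k"
          unfolding kk_def
          by (intro integrable_continuous continuous_intros \<phi>c \<phi>1c \<phi>2c gc zS continuous_on_slice[OF cw])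
        fix x assume "x \<in> cbox (- k) k"
        then have x: "x \<in> B" by (simp add: B_def)
        have "cmod (kk \<zeta> x) \<le> DIM('z) * ((M2 + 4 * M1 * Mz * \<kappa>m) * \<Lambda> * E)"
          unfolding kk_def
        proof (rule sum_norm_bound)
          fix b :: 'z assume b: "b \<in> Basis"
          have "cmod (of_real (\<phi>2 b x) * g \<zeta> x + of_real (2 * \<phi>1 b x) * g1 \<zeta> b x) \<le> (M2 + 4 * M1 * Mz * \<kappa>m) * \<Lambda> * E"
          \<comment> \<open>Below level q0 both derivatives of the cut-off vanish; from q0 on the
            Gaussian is at most \<open>E\<close>.\<close>
          proof (cases "Q x < q0")
            case True
            then have "\<phi>2 b x = 0" "\<phi>1 b x = 0" using \<Psi>(5,6) by (auto simp: \<phi>1_def \<phi>2_def)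
            moreover have "0 \<le> (M2 + 4 * M1 * Mz * \<kappa>m) * \<Lambda> * E"
              using M1 M2 Mz \<kappa>m E L by (intro mult_nonneg_nonneg add_nonneg_nonneg) auto
            ultimately show ?thesis by simp
          next
            case False
            have "exp (- \<Lambda> * Q x) \<le> exp (- \<Lambda> * q0)" using False L by simp
            then have gE: "cmod (g \<zeta> x) \<le> E"
              unfolding E_def g_def using order_trans[OF Cg(2)[OF _ z] mult_left_mono] Cg(1) L by simp
            have "cmod (g1 \<zeta> b x) = (2 * \<Lambda> * \<bar>x \<bullet> b\<bar>) * cmod (heat_rate X \<delta> \<zeta> b) * cmod (g \<zeta> x)"
              unfolding g1_def mixed_gaussian_d1_def g_def norm_mult norm_of_real using L by (simp add: abs_mult)
            also have "\<dots> \<le> (2 * \<Lambda> * Mz) * \<kappa>m * E"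
              using norm_heat_rate_le[OF \<delta> par(2) z] Mz x b L gE \<kappa>m
              by (intro mult_mono mult_nonneg_nonneg) (auto simp: \<kappa>m_def)
            finally have g1E: "cmod (g1 \<zeta> b x) \<le> 2 * \<Lambda> * Mz * \<kappa>m * E" .
            have "cmod (of_real (\<phi>2 b x) * g \<zeta> x + of_real (2 * \<phi>1 b x) * g1 \<zeta> b x)
               \<le> \<bar>\<phi>2 b x\<bar> * cmod (g \<zeta> x) + (2 * \<bar>\<phi>1 b x\<bar>) * cmod (g1 \<zeta> b x)"
              using norm_triangle_ineq[of "of_real (\<phi>2 b x) * g \<zeta> x" "of_real (2 * \<phi>1 b x) * g1 \<zeta> b x"]
              by (simp add: norm_mult)
            also have "\<dots> \<le> M2 * E + (2 * M1) * (2 * \<Lambda> * Mz * \<kappa>m * E)"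
              using M1 M2 x b gE g1E by (intro add_mono mult_mono) auto
            also have "\<dots> \<le> M2 * E * \<Lambda> + (2 * M1) * (2 * \<Lambda> * Mz * \<kappa>m * E)"
              using mult_left_mono[OF L, of "M2 * E"] M2 E by simp
            also have "\<dots> = (M2 + 4 * M1 * Mz * \<kappa>m) * \<Lambda> * E" by (simp add: algebra_simps)
            finally show ?thesis .
          qed
          then show "cmod (of_real (dir_sign X b) * (of_real (\<phi>2 b x) * g \<zeta> x + of_real (2 * \<phi>1 b x) * g1 \<zeta> b x)) \<le> (M2 + 4 * M1 * Mz * \<kappa>m) * \<Lambda> * E"
            by (simp add: norm_mult dir_sign_def)
        qed
        then show "cmod (of_real (w t x) * kk \<zeta> x) \<le> M'"
          unfolding norm_mult norm_of_real M'_def using Mw(2)[OF t x] Mw(1) by (intro mult_mono) auto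
      qed
      also have "\<dots> = M" by (simp add: M'_def M_def C0_def E_def B_def mult_ac)
      finally show ?thesis by (simp add: Er_def B_def)
    qed
    \<comment> \<open>The data vanish below level q1 and the cut-off vanishes from q1 on.\<close>
    have z0: "w 0 x * \<phi> x = 0" "w1 0 x * \<phi> x = 0" for x
      using init_weight_form[OF \<delta>(1) q(3), of x] \<Psi>(7)[of "Q x"] by (cases "Q x < q1"; auto simp: Q_def \<phi>_def)+
    have "cmod (I T 0) \<le> T * \<rho> * (T / \<delta> * exp (\<Lambda> * T\<^sup>2 / \<rho>) * M)"
    proof (rule holomorphic_cauchy_bound[OF \<delta> _ par(3), of _ S I I1 I2 Iz Er])
      show "cball (complex_of_real ((\<rho> - \<delta>) / 2)) ((\<rho> + \<delta>) / 2) \<subseteq> S"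
        using disc_strip[OF \<delta> par(2)] by (simp add: disc_def S_def)
      show "((\<lambda>t. I t \<zeta>) has_vector_derivative I1 t \<zeta>) (at t)" if "\<zeta> \<in> S" for t \<zeta>
        unfolding I_def I1_def by (rule tder[OF d1 cw cw1 that])
      show "((\<lambda>t. I1 t \<zeta>) has_vector_derivative I2 t \<zeta>) (at t)" if "\<zeta> \<in> S" for t \<zeta>
        unfolding I1_def I2_def by (rule tder[OF d2 cw1 cw2 that])
      show "continuous_on (UNIV \<times> S) (\<lambda>(t, \<zeta>). I t \<zeta>)" "continuous_on (UNIV \<times> S) (\<lambda>(t, \<zeta>). I1 t \<zeta>)"
        "continuous_on (UNIV \<times> S) (\<lambda>(t, \<zeta>). I2 t \<zeta>)"
        unfolding split_beta I_def I1_def I2_def by (rule par1; rule cw cw1 cw2)+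
      show "I 0 \<zeta> = 0" "I1 0 \<zeta> = 0" for \<zeta> unfolding I_def I1_def z0 by simp_all
      show "cmod (Er t \<zeta>) \<le> M" if "0 \<le> t" "t \<le> T" "\<zeta> \<in> cball (complex_of_real ((\<rho> - \<delta>) / 2)) ((\<rho> + \<delta>) / 2)" for t \<zeta>
        using Erb that by (simp add: disc_def)
    qed (use L dz pde2 Erc in auto)
    also have "\<dots> = C * \<Lambda> * (exp (\<Lambda> * T\<^sup>2 / \<rho>) * exp (- \<Lambda> * q0))" by (simp add: M_def C_def mult_ac)
    also have "exp (\<Lambda> * T\<^sup>2 / \<rho>) * exp (- \<Lambda> * q0) = exp (- \<Lambda> * (q0 - T\<^sup>2 / \<rho>))"
      by (simp add: exp_add[symmetric] algebra_simps)
    finally show ?thesis by (simp add: I_def g_def)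
  qed
  show thesis
  proof (rule that[of \<phi> k C])
    show "continuous_on UNIV \<phi>" by (rule \<phi>c)
    show "\<phi> 0 = 1" using q \<Psi>(4) by (simp add: \<phi>_def Q_def weight_form_def)
    show "cball 0 1 \<subseteq> cbox (- k) k" using box K1 by (force intro: order_trans[rotated])
    show "0 \<le> C" unfolding C_def using par \<delta> C0 by simp
  qed (use goal in \<open>simp add: B_def\<close>)
qed

end

section \<open>Concentration of Gaussian integrals at the origin\<close>

lemma power_times_exp_tendsto_0:
  fixes c :: real
  assumes "0 < c"
  shows "((\<lambda>x. x ^ k * exp (- x * c)) \<longlongrightarrow> 0) at_top"
proof -
  have "filterlim (\<lambda>x. x * c) at_top at_top"
    using assms by (intro filterlim_at_top_mult_tendsto_pos[OF tendsto_const]) (auto simp: filterlim_ident)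
  from filterlim_compose[OF tendsto_power_div_exp_0 this, of k]
  have "((\<lambda>x. (x * c) ^ k / exp (x * c)) \<longlongrightarrow> 0) at_top" .
  from tendsto_divide[OF this tendsto_const, of "c ^ k"] assms
  have "((\<lambda>x. ((x * c) ^ k / exp (x * c)) / c ^ k) \<longlongrightarrow> 0) at_top" by simp
  moreover have "((x * c) ^ k / exp (x * c)) / c ^ k = x ^ k * exp (- x * c)" for x
    using assms by (simp add: power_mult_distrib exp_minus field_simps)
  ultimately show ?thesis by simp
qed

text \<open>If f(0) were nonzero, f would keep its sign and have size at least |f(0)| / 2 near 0. A
  small cube there contributes at least a constant times a negative power of \<Lambda>, whereas the
  part outside a fixed ball and, by \<open>bnd\<close>, the whole integral are exponentially
  small.\<close>

lemma gaussian_concentration: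
  fixes f \<beta> :: "'z::euclidean_space \<Rightarrow> real"
  assumes f: "continuous_on UNIV f" and \<beta>: "\<And>b. b \<in> Basis \<Longrightarrow> 0 < \<beta> b"
    and k: "cball 0 1 \<subseteq> cbox (- k) k" and "0 \<le> C" and \<gamma>: "0 < \<gamma>"
    and bnd: "\<And>\<Lambda>. 1 \<le> \<Lambda> \<Longrightarrow> \<bar>integral (cbox (- k) k) (\<lambda>z. f z * exp (- \<Lambda> * (\<Sum>b\<in>Basis. \<beta> b * (z \<bullet> b)\<^sup>2)))\<bar> \<le> C * \<Lambda> * exp (- \<Lambda> * \<gamma>)"
  shows "f 0 = 0"
proof (rule ccontr)
  assume nz: "f 0 \<noteq> 0"
  define s where "s = sgn (f 0)"
  define a where "a = \<bar>f 0\<bar> / 2"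
  have a: "0 < a" using nz by (simp add: a_def)
  define N where "N = DIM('z)"
  have "isCont f 0" using f by (simp add: continuous_on_eq_continuous_at)
  then have "((\<lambda>z. s * f z) \<longlongrightarrow> s * f 0) (at 0)" by (intro tendsto_intros) (simp add: isCont_def)
  moreover have s0: "s * f 0 = 2 * a" by (simp add: s_def a_def abs_sgn mult.commute)
  ultimately have "eventually (\<lambda>z. a < s * f z) (at 0)" using a by (intro order_tendstoD(1)) auto
  then obtain d' where d': "0 < d'" "\<And>z. z \<noteq> 0 \<Longrightarrow> dist z 0 < d' \<Longrightarrow> a < s * f z"
    unfolding eventually_at by blast
  define d where "d = min 1 (d' / 2)"
  have d: "0 < d" "d \<le> 1" using d' by (auto simp: d_def)
  have fa: "a \<le> s * f z" if "norm z \<le> d" for z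
    using d'(2)[of z] that d'(1) s0 a by (cases "z = 0") (auto simp: d_def)
  define \<beta>m where "\<beta>m = Min (\<beta> ` Basis)"
  have \<beta>m: "0 < \<beta>m" unfolding \<beta>m_def using \<beta> by (subst Min_gr_iff) auto
  define B where "B = cbox (- k) k"
  have "bounded (f ` B)" unfolding B_def
    by (intro compact_imp_bounded compact_continuous_image continuous_on_subset[OF f]) auto
  then obtain M where M: "0 < M" "\<And>z. z \<in> B \<Longrightarrow> \<bar>f z\<bar> \<le> M" by (auto simp: bounded_pos)
  define q where "q z = (\<Sum>b\<in>Basis. \<beta> b * (z \<bullet> b)\<^sup>2)" for z
  have qc: "continuous_on A q" for A unfolding q_def by (intro continuous_intros)
  have qm: "\<beta>m * (norm z)\<^sup>2 \<le> q z" for z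
  proof -
    have "(norm z)\<^sup>2 = (\<Sum>b\<in>Basis. (z \<bullet> b)\<^sup>2)"
      unfolding power2_norm_eq_inner by (subst euclidean_inner) (simp add: power2_eq_square)
    then have "\<beta>m * (norm z)\<^sup>2 = (\<Sum>b\<in>Basis. \<beta>m * (z \<bullet> b)\<^sup>2)" by (simp add: sum_distrib_left)
    also have "\<dots> \<le> q z" unfolding q_def \<beta>m_def by (intro sum_mono mult_right_mono) auto
    finally show ?thesis .
  qed
  define c where "c = a * exp (- (\<Sum>b\<in>Basis. \<beta> b))"
  have c: "0 < c" using a by (simp add: c_def)
  have ineq: "c * 2 ^ N \<le> C * (\<Lambda> ^ (N + 1) * exp (- \<Lambda> * \<gamma>)) + M * measure lborel B * (\<Lambda> ^ N * exp (- \<Lambda> * (\<beta>m * d\<^sup>2)))"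
    if L: "1 \<le> \<Lambda>" "N / d \<le> \<Lambda>" for \<Lambda>
  proof -
    \<comment> \<open>A cube of half-side 1 / \<Lambda> is smaller than the natural scale 1 / sqrt
      \<Lambda>. The exponent stays bounded on it, and its volume (2 / \<Lambda>)^N is an integer
      power, which is enough against exponential decay.\<close>
    define e :: 'z where "e = (1 / \<Lambda>) *\<^sub>R One"
    define S where "S = cbox (- e) e"
    have Sb: "\<bar>z \<bullet> b\<bar> \<le> 1 / \<Lambda>" if "z \<in> S" "b \<in> Basis" for z b
      using that by (force simp: S_def e_def mem_box abs_le_iff)
    have Sn: "norm z \<le> d" if "z \<in> S" for z
    proof -
      have "norm z \<le> (\<Sum>b\<in>Basis. \<bar>z \<bullet> b\<bar>)" by (rule norm_le_l1)
      also have "\<dots> \<le> (\<Sum>b\<in>(Basis::'z set). 1 / \<Lambda>)" by (intro sum_mono Sb that)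
      also have "\<dots> = N / \<Lambda>" by (simp add: N_def)
      also have "\<dots> \<le> d" using L d by (simp add: field_simps)
      finally show ?thesis .
    qed
    have SB: "S \<subseteq> B" using Sn d k unfolding B_def by (force intro: subsetD[OF k])
    define E where "E = M * exp (- \<Lambda> * (\<beta>m * d\<^sup>2))"
    \<comment> \<open>Three regions: on the cube a lower bound, elsewhere in the ball of radius d
      the sign, outside the ball a bound on the absolute value by the exponentially small
      \<open>E\<close>.\<close>
    have pw: "(if z \<in> S then c else 0) - E \<le> s * (f z * exp (- \<Lambda> * q z))" if "z \<in> B" for z
    proof -
      have E0: "0 \<le> E" using M by (simp add: E_def)
      consider "z \<in> S" | "z \<notin> S" "norm z \<le> d" | "z \<notin> S" "d < norm z" by linarith
      then show ?thesis
      proof cases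
        case 1
        have "\<Lambda> * q z \<le> \<Lambda> * (\<Sum>b\<in>Basis. \<beta> b * (1 / \<Lambda>))"
          unfolding q_def
        proof (intro mult_left_mono sum_mono)
          fix b :: 'z assume b: "b \<in> Basis"
          have "(z \<bullet> b)\<^sup>2 = \<bar>z \<bullet> b\<bar>\<^sup>2" by simp
          also have "\<dots> \<le> (1 / \<Lambda>)\<^sup>2" by (intro power_mono Sb 1 b) simp
          also have "\<dots> \<le> 1 / \<Lambda>" using L by (simp add: power2_eq_square field_simps)
          finally show "(z \<bullet> b)\<^sup>2 \<le> 1 / \<Lambda>" .
        qed (use \<beta> L in \<open>auto intro: less_imp_le\<close>)
        also have "\<dots> = (\<Sum>b\<in>Basis. \<beta> b)" using L by (simp add: sum_distrib_left)
        finally have "exp (- (\<Sum>b\<in>Basis. \<beta> b)) \<le> exp (- \<Lambda> * q z)" by simp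
        then have "c \<le> (s * f z) * exp (- \<Lambda> * q z)"
          unfolding c_def using fa[OF Sn[OF 1]] a by (intro mult_mono) auto
        then show ?thesis using 1 E0 by (simp add: mult.assoc)
      next
        case 2
        then have "0 \<le> s * f z" using fa[of z] a by linarith
        then have "0 \<le> (s * f z) * exp (- \<Lambda> * q z)" by simp
        then show ?thesis using 2 E0 by (simp add: mult.assoc)
      next
        case 3
        have "\<beta>m * d\<^sup>2 \<le> \<beta>m * (norm z)\<^sup>2" using 3 d \<beta>m by (intro mult_left_mono power_mono) auto
        then have "\<beta>m * d\<^sup>2 \<le> q z" using qm order_trans by blast
        then have "exp (- \<Lambda> * q z) \<le> exp (- \<Lambda> * (\<beta>m * d\<^sup>2))" using L by simp
        then have "\<bar>f z\<bar> * exp (- \<Lambda> * q z) \<le> E" unfolding E_def using M(1) M(2)[OF that] by (intro mult_mono) auto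
        moreover have "\<bar>s * (f z * exp (- \<Lambda> * q z))\<bar> = \<bar>f z\<bar> * exp (- \<Lambda> * q z)"
          using nz by (simp add: abs_mult s_def abs_sgn_eq)
        ultimately show ?thesis using 3 by (simp add: abs_le_iff)
      qed
    qed
    define J where "J = integral B (\<lambda>z. f z * exp (- \<Lambda> * q z))"
    have "((\<lambda>z. if z \<in> S then c else 0) has_integral (measure lborel S *\<^sub>R c)) B"
      unfolding has_integral_restrict[OF SB] unfolding S_def by (rule has_integral_const)
    then have 1: "((\<lambda>z. (if z \<in> S then c else 0) - E) has_integral (measure lborel S *\<^sub>R c - measure lborel B *\<^sub>R E)) B"
      unfolding B_def by (intro has_integral_diff has_integral_const)
    have 2: "((\<lambda>z. s * (f z * exp (- \<Lambda> * q z))) has_integral (s * J)) B"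
      unfolding J_def B_def
      by (intro has_integral_mult_right integrable_integral integrable_continuous continuous_intros qc continuous_on_subset[OF f]) auto
    have "measure lborel S *\<^sub>R c - measure lborel B *\<^sub>R E \<le> s * J"
      by (rule has_integral_le[OF 1 2]) (rule pw)
    also have "\<dots> \<le> \<bar>J\<bar>" using nz abs_ge_self[of J] abs_ge_minus_self[of J] by (simp add: s_def sgn_if)
    also have "\<dots> \<le> C * \<Lambda> * exp (- \<Lambda> * \<gamma>)" using bnd[OF L(1)] by (simp add: J_def B_def q_def)
    finally have 3: "measure lborel S * c \<le> C * \<Lambda> * exp (- \<Lambda> * \<gamma>) + measure lborel B * E" by simp
    have "measure lborel S = (\<Prod>b\<in>(Basis::'z set). 2 / \<Lambda>)"
      unfolding S_def using L by (subst content_cbox) (auto simp: e_def intro!: prod.cong)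
    then have "measure lborel S = (2 / \<Lambda>) ^ N" by (simp add: N_def)
    then have "\<Lambda> ^ N * (measure lborel S * c) = c * 2 ^ N" using L by (simp add: power_divide)
    moreover have "\<Lambda> ^ N * (measure lborel S * c) \<le> \<Lambda> ^ N * (C * \<Lambda> * exp (- \<Lambda> * \<gamma>) + measure lborel B * E)"
      using L by (intro mult_left_mono 3) auto
    moreover have "\<Lambda> ^ N * (C * \<Lambda> * exp (- \<Lambda> * \<gamma>) + measure lborel B * E) =
       C * (\<Lambda> ^ (N + 1) * exp (- \<Lambda> * \<gamma>)) + M * measure lborel B * (\<Lambda> ^ N * exp (- \<Lambda> * (\<beta>m * d\<^sup>2)))"
      by (simp add: E_def algebra_simps)
    ultimately show ?thesis by linarith
  qed
  have "((\<lambda>\<Lambda>. C * (\<Lambda> ^ (N + 1) * exp (- \<Lambda> * \<gamma>)) + M * measure lborel B * (\<Lambda> ^ N * exp (- \<Lambda> * (\<beta>m * d\<^sup>2))))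
      \<longlongrightarrow> C * 0 + M * measure lborel B * 0) at_top"
    by (intro tendsto_intros power_times_exp_tendsto_0 \<gamma> mult_pos_pos \<beta>m zero_less_power d)
  moreover have "c * 2 ^ N > C * 0 + M * measure lborel B * 0" using c by simp
  ultimately have "eventually (\<lambda>\<Lambda>. C * (\<Lambda> ^ (N + 1) * exp (- \<Lambda> * \<gamma>)) + M * measure lborel B * (\<Lambda> ^ N * exp (- \<Lambda> * (\<beta>m * d\<^sup>2))) < c * 2 ^ N) at_top"
    by (rule order_tendstoD(2))
  moreover have "eventually (\<lambda>\<Lambda>::real. 1 \<le> \<Lambda>) at_top" "eventually (\<lambda>\<Lambda>. N / d \<le> \<Lambda>) at_top" by (rule eventually_ge_at_top)+
  ultimately have "eventually (\<lambda>_. False) (at_top :: real filter)"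
    by eventually_elim (use ineq in \<open>auto simp: not_le[symmetric]\<close>)
  then show False by simp
qed

context cauchy_problem
begin

text \<open>As T < r, there is room for a level q0 above T^2 / \<rho> and below q1 = r^2 / (\<rho> +
  2 \<delta>), so that \<open>gaussian_pairing_bound\<close> decays exponentially. At \<zeta> = 0
  the kernel is a constant times a real Gaussian, and \<open>gaussian_concentration\<close>
  applies.\<close>

theorem vanishing: "w T 0 = 0"
proof -
  \<comment> \<open>The second entry makes 2 \<delta> T^2 at most half of \<rho> (r^2 - T^2),
    whereas T^2 / \<rho> < r^2 / (\<rho> + 2 \<delta>) only asks for less than the whole.\<close>
  define \<delta> where "\<delta> = min \<rho> (\<rho> * (r\<^sup>2 - T\<^sup>2) / (4 * T\<^sup>2))"
  have rT: "0 < r\<^sup>2 - T\<^sup>2" using par by (simp add: power_strict_mono)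
  have \<delta>: "0 < \<delta>" "\<delta> \<le> \<rho>" using par rT by (auto simp: \<delta>_def)
  have "\<delta> \<le> \<rho> * (r\<^sup>2 - T\<^sup>2) / (4 * T\<^sup>2)" by (simp add: \<delta>_def)
  then have "4 * T\<^sup>2 * \<delta> \<le> \<rho> * (r\<^sup>2 - T\<^sup>2)" using par by (simp add: field_simps)
  moreover have "0 < T\<^sup>2 * \<delta>" using \<delta> par by simp
  moreover have "0 < \<rho> * (r\<^sup>2 - T\<^sup>2)" using par rT by simp
  ultimately have "T\<^sup>2 * (\<rho> + 2 * \<delta>) < \<rho> * r\<^sup>2" by (simp add: algebra_simps)
  then have lt: "T\<^sup>2 / \<rho> < r\<^sup>2 / (\<rho> + 2 * \<delta>)" using par \<delta> by (simp add: field_simps)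
  define q1 where "q1 = r\<^sup>2 / (\<rho> + 2 * \<delta>)"
  have "T\<^sup>2 / \<rho> < q1" using lt by (simp add: q1_def)
  then obtain q0 where q: "T\<^sup>2 / \<rho> < q0" "q0 < q1" using dense by blast
  have q00: "0 < q0" using less_trans[OF _ q(1)] par by simp
  have q1: "(\<rho> + 2 * \<delta>) * q1 \<le> r\<^sup>2" using par \<delta> by (simp add: q1_def)
  obtain \<phi> :: "'z \<Rightarrow> real" and k C where G: "continuous_on UNIV \<phi>" "\<phi> 0 = 1" "cball 0 1 \<subseteq> cbox (- k) k" "0 \<le> C"
    "\<And>\<Lambda>. 1 \<le> \<Lambda> \<Longrightarrow> cmod (integral (cbox (- k) k) (\<lambda>z. of_real (w T z * \<phi> z) * mixed_gaussian X \<delta> \<Lambda> 0 z))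
        \<le> C * \<Lambda> * exp (- \<Lambda> * (q0 - T\<^sup>2 / \<rho>))"
    using gaussian_pairing_bound[OF \<delta> q00 q(2) q1] by blast
  define \<beta> where "\<beta> b = (if b \<in> X then 1 / (2 * \<delta>) else 1)" for b
  define P where "P = exp (- (\<Sum>b\<in>Basis. heat_log X \<delta> 0 (b::'z)) / 2)"
  have P: "0 < cmod P" by (simp add: P_def)
  have g: "mixed_gaussian X \<delta> \<Lambda> 0 z = P * of_real (exp (- \<Lambda> * (\<Sum>b\<in>Basis. \<beta> b * (z \<bullet> b)\<^sup>2)))" for \<Lambda> z
  proof -
    have "heat_rate X \<delta> 0 b = of_real (\<beta> b)" for b by (simp add: heat_rate_def \<beta>_def)
    then show ?thesis by (simp add: mixed_gaussian_def P_def exp_of_real[symmetric] exp_add[symmetric] of_real_sum)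
  qed
  have "w T 0 * \<phi> 0 = 0"
  proof (rule gaussian_concentration[where f = "\<lambda>z. w T z * \<phi> z" and \<beta> = \<beta> and k = k and C = "C / cmod P" and \<gamma> = "q0 - T\<^sup>2 / \<rho>"])
    show "continuous_on UNIV (\<lambda>z. w T z * \<phi> z)" by (intro continuous_intros continuous_on_slice[OF cw] G)
    fix \<Lambda> :: real assume L: "1 \<le> \<Lambda>"
    define f where "f z = w T z * \<phi> z * exp (- \<Lambda> * (\<Sum>b\<in>Basis. \<beta> b * (z \<bullet> b)\<^sup>2))" for z
    have "continuous_on (cbox (- k) k) f"
      unfolding f_def by (intro continuous_intros continuous_on_slice[OF cw] continuous_on_subset[OF G(1)]) auto
    then have i: "f integrable_on cbox (- k) k" by (rule integrable_continuous)
    have "(\<lambda>z. of_real (w T z * \<phi> z) * mixed_gaussian X \<delta> \<Lambda> 0 z) = (\<lambda>z. P * (complex_of_real \<circ> f) z)"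
      by (auto simp: g f_def fun_eq_iff)
    then have "integral (cbox (- k) k) (\<lambda>z. of_real (w T z * \<phi> z) * mixed_gaussian X \<delta> \<Lambda> 0 z) = P * integral (cbox (- k) k) (complex_of_real \<circ> f)"
      by (simp add: o_def)
    also have "\<dots> = P * of_real (integral (cbox (- k) k) f)"
      by (subst integral_linear[OF i bounded_linear_of_real]) simp
    finally have "cmod P * \<bar>integral (cbox (- k) k) f\<bar> \<le> C * \<Lambda> * exp (- \<Lambda> * (q0 - T\<^sup>2 / \<rho>))"
      using G(5)[OF L] by (simp add: norm_mult)
    then have "\<bar>integral (cbox (- k) k) f\<bar> \<le> C / cmod P * \<Lambda> * exp (- \<Lambda> * (q0 - T\<^sup>2 / \<rho>))"
      using P by (simp add: field_simps)
    then show "\<bar>integral (cbox (- k) k) (\<lambda>z. w T z * \<phi> z * exp (- \<Lambda> * (\<Sum>b\<in>Basis. \<beta> b * (z \<bullet> b)\<^sup>2)))\<bar>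
      \<le> C / cmod P * \<Lambda> * exp (- \<Lambda> * (q0 - T\<^sup>2 / \<rho>))"
      by (simp only: f_def[abs_def])
  qed (use G q P \<delta> in \<open>auto simp: \<beta>_def\<close>)
  then show ?thesis using G by simp
qed

end

section \<open>Second derivatives and reflections\<close>

lemma field_derivative_linear_bound:
  fixes \<phi> \<phi>' :: "real \<Rightarrow> real"
  assumes d: "\<And>s. (\<phi> has_real_derivative \<phi>' s) (at s)"
    and b: "\<And>s. \<bar>s\<bar> \<le> \<bar>h\<bar> \<Longrightarrow> \<bar>\<phi>' s - a\<bar> \<le> B"
  shows "\<bar>\<phi> h - \<phi> 0 - h * a\<bar> \<le> B * \<bar>h\<bar>"
proof -
  have "norm ((\<lambda>s. \<phi> s - s * a) h - (\<lambda>s. \<phi> s - s * a) 0) \<le> B * norm (h - 0)"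
  proof (rule field_differentiable_bound[where S = "{-\<bar>h\<bar>..\<bar>h\<bar>}" and f' = "\<lambda>s. \<phi>' s - a"])
    show "((\<lambda>s. \<phi> s - s * a) has_field_derivative \<phi>' s - a) (at s within {-\<bar>h\<bar>..\<bar>h\<bar>})" for s
      by (rule DERIV_subset[OF _ subset_UNIV]) (auto intro!: derivative_eq_intros d)
    show "norm (\<phi>' s - a) \<le> B" if "s \<in> {-\<bar>h\<bar>..\<bar>h\<bar>}" for s using b[of s] that by (auto simp: abs_le_iff)
  qed auto
  then show ?thesis by simp
qed

text \<open>Go from p to p + h one coordinate at a time and apply a mean value estimate on each
  segment. The induction over sets of coordinates adds one segment; \<open>N\<close> counts the
  steps of length at most |h| that can separate an intermediate point from p.\<close>

lemma has_derivative_continuous_partials: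
  fixes f :: "'p::euclidean_space \<Rightarrow> real"
  assumes d: "\<And>b p. b \<in> Basis \<Longrightarrow> ((\<lambda>t. f (p + t *\<^sub>R b)) has_real_derivative g b p) (at 0)"
    and c: "\<And>b. b \<in> Basis \<Longrightarrow> continuous_on UNIV (g b)"
  shows "(f has_derivative (\<lambda>h. \<Sum>b\<in>Basis. (h \<bullet> b) * g b p)) (at p)"
proof -
  have dt: "((\<lambda>t. f (q + t *\<^sub>R b)) has_real_derivative g b (q + s *\<^sub>R b)) (at s)" if "b \<in> Basis" for b q s
  proof -
    have "((\<lambda>t. f ((q + s *\<^sub>R b) + t *\<^sub>R b)) has_real_derivative g b (q + s *\<^sub>R b)) (at (s - s))"
      using d[OF that, of "q + s *\<^sub>R b"] by simp
    moreover have "((\<lambda>t. t - s) has_real_derivative 1) (at s)" by (auto intro!: derivative_eq_intros)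
    ultimately have "((\<lambda>t. f ((q + s *\<^sub>R b) + (t - s) *\<^sub>R b)) has_real_derivative g b (q + s *\<^sub>R b) * 1) (at s)"
      by (rule DERIV_chain2)
    moreover have "(q + s *\<^sub>R b) + (t - s) *\<^sub>R b = q + t *\<^sub>R b" for t by (simp add: scaleR_diff_left)
    ultimately show ?thesis by simp
  qed
  have main: "\<exists>d>0. \<forall>h::'p. norm h < d \<longrightarrow>
      \<bar>f (p + (\<Sum>b\<in>A. (h \<bullet> b) *\<^sub>R b)) - f p - (\<Sum>b\<in>A. (h \<bullet> b) * g b p)\<bar> \<le> e * norm h"
    if "finite A" "A \<subseteq> Basis" "0 < e" for A e
    using that
  proof (induction A arbitrary: e rule: finite_induct)
    case empty
    then show ?case by (auto intro!: exI[of _ 1])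
  next
    case (insert a A)
    then have a: "a \<in> Basis" and A: "A \<subseteq> Basis" by auto
    from insert.IH[OF A, of "e / 2"] insert.prems obtain d1 where d1: "0 < d1"
      "\<And>h::'p. norm h < d1 \<Longrightarrow> \<bar>f (p + (\<Sum>b\<in>A. (h \<bullet> b) *\<^sub>R b)) - f p - (\<Sum>b\<in>A. (h \<bullet> b) * g b p)\<bar> \<le> e / 2 * norm h"
      by auto
    have "isCont (g a) p" using c[OF a] by (simp add: continuous_on_eq_continuous_at)
    then obtain d2 where d2: "0 < d2" "\<And>z. dist z p < d2 \<Longrightarrow> dist (g a z) (g a p) < e / 2"
      using insert.prems unfolding continuous_at_eps_delta by (metis half_gt_zero)
    define N where "N = real (card A) + 1"
    have N: "0 < N" by (simp add: N_def)
    show ?case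
    proof (intro exI[of _ "min d1 (d2 / N)"] conjI allI impI)
      show "0 < min d1 (d2 / N)" using d1 d2 N by simp
      fix h :: 'p assume h: "norm h < min d1 (d2 / N)"
      define q where "q = p + (\<Sum>b\<in>A. (h \<bullet> b) *\<^sub>R b)"
      have ha: "\<bar>h \<bullet> b\<bar> \<le> norm h" if "b \<in> Basis" for b by (rule Basis_le_norm[OF that])
      have near: "dist (q + s *\<^sub>R a) p < d2" if s: "\<bar>s\<bar> \<le> \<bar>h \<bullet> a\<bar>" for s
      proof -
        have "norm (q + s *\<^sub>R a - p) \<le> norm (\<Sum>b\<in>A. (h \<bullet> b) *\<^sub>R b) + norm (s *\<^sub>R a)"
          unfolding q_def using norm_triangle_ineq[of "\<Sum>b\<in>A. (h \<bullet> b) *\<^sub>R b" "s *\<^sub>R a"] by (simp add: algebra_simps)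
        also have "norm (\<Sum>b\<in>A. (h \<bullet> b) *\<^sub>R b) \<le> (\<Sum>b\<in>A. norm h)"
          by (rule sum_norm_le) (use A ha in auto)
        also have "norm (s *\<^sub>R a) \<le> norm h" using s ha[OF a] a by simp
        finally have "norm (q + s *\<^sub>R a - p) \<le> N * norm h" by (simp add: N_def algebra_simps)
        also have "\<dots> < d2" using h N by (simp add: field_simps)
        finally show ?thesis by (simp add: dist_norm)
      qed
      have "\<bar>f (q + (h \<bullet> a) *\<^sub>R a) - f (q + 0 *\<^sub>R a) - (h \<bullet> a) * g a p\<bar> \<le> e / 2 * \<bar>h \<bullet> a\<bar>"
      proof (rule field_derivative_linear_bound)
        show "((\<lambda>s. f (q + s *\<^sub>R a)) has_real_derivative g a (q + s *\<^sub>R a)) (at s)" for s by (rule dt[OF a])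
        show "\<bar>g a (q + s *\<^sub>R a) - g a p\<bar> \<le> e / 2" if "\<bar>s\<bar> \<le> \<bar>h \<bullet> a\<bar>" for s
          using d2(2)[OF near[OF that]] by (simp add: dist_norm)
      qed
      also have "\<dots> \<le> e / 2 * norm h" using ha[OF a] insert.prems by (intro mult_left_mono) auto
      finally have 1: "\<bar>f (q + (h \<bullet> a) *\<^sub>R a) - f q - (h \<bullet> a) * g a p\<bar> \<le> e / 2 * norm h" by simp
      have 2: "\<bar>f q - f p - (\<Sum>b\<in>A. (h \<bullet> b) * g b p)\<bar> \<le> e / 2 * norm h" using d1(2)[of h] h by (simp add: q_def)
      have 3: "p + (\<Sum>b\<in>insert a A. (h \<bullet> b) *\<^sub>R b) = q + (h \<bullet> a) *\<^sub>R a"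
        using insert.hyps by (simp add: q_def algebra_simps)
      have 4: "(\<Sum>b\<in>insert a A. (h \<bullet> b) * g b p) = (h \<bullet> a) * g a p + (\<Sum>b\<in>A. (h \<bullet> b) * g b p)"
        using insert.hyps by simp
      show "\<bar>f (p + (\<Sum>b\<in>insert a A. (h \<bullet> b) *\<^sub>R b)) - f p - (\<Sum>b\<in>insert a A. (h \<bullet> b) * g b p)\<bar> \<le> e * norm h"
        unfolding 3 4
      proof -
        have "f (q + (h \<bullet> a) *\<^sub>R a) - f p - ((h \<bullet> a) * g a p + (\<Sum>b\<in>A. (h \<bullet> b) * g b p))
          = (f (q + (h \<bullet> a) *\<^sub>R a) - f q - (h \<bullet> a) * g a p) + (f q - f p - (\<Sum>b\<in>A. (h \<bullet> b) * g b p))" by simp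
        also have "\<bar>\<dots>\<bar> \<le> e / 2 * norm h + e / 2 * norm h"
          by (rule order_trans[OF abs_triangle_ineq add_mono[OF 1 2]])
        finally show "\<bar>f (q + (h \<bullet> a) *\<^sub>R a) - f p - ((h \<bullet> a) * g a p + (\<Sum>b\<in>A. (h \<bullet> b) * g b p))\<bar> \<le> e * norm h" by simp
      qed
    qed
  qed
  show ?thesis
    unfolding has_derivative_at_alt
  proof (intro conjI allI impI)
    show "bounded_linear (\<lambda>h. \<Sum>b\<in>Basis. (h \<bullet> b) * g b p)"
      by (intro bounded_linear_sum bounded_linear_mult_const bounded_linear_inner_left)
    fix e :: real assume "0 < e"
    from main[OF finite_Basis order_refl this] obtain d where d: "0 < d" "\<And>h::'p. norm h < d \<Longrightarrow>
      \<bar>f (p + h) - f p - (\<Sum>b\<in>Basis. (h \<bullet> b) * g b p)\<bar> \<le> e * norm h" by (auto simp: euclidean_representation)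
    show "\<exists>d>0. \<forall>y. norm (y - p) < d \<longrightarrow> norm (f y - f p - (\<Sum>b\<in>Basis. ((y - p) \<bullet> b) * g b p)) \<le> e * norm (y - p)"
      using d(1) d(2)[of "_ - p"] by (auto intro!: exI[of _ d])
  qed
qed

text \<open>\<open>C2\<close> speaks only of basis directions. The derivative along any v is
  therefore encoded as a linear combination of partial derivatives, and the second one below as the
  Hessian form at (v, v); \<open>C2_line_deriv\<close> identifies both with derivatives along
  lines.\<close>

definition dir_deriv :: "('p::euclidean_space \<Rightarrow> real) \<Rightarrow> 'p \<Rightarrow> 'p \<Rightarrow> real" where
  "dir_deriv f v p = (\<Sum>b\<in>Basis. (v \<bullet> b) * dirderiv f b p)"

definition dir_deriv2 :: "('p::euclidean_space \<Rightarrow> real) \<Rightarrow> 'p \<Rightarrow> 'p \<Rightarrow> real" where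
  "dir_deriv2 f v p = (\<Sum>b\<in>Basis. (v \<bullet> b) * (\<Sum>c\<in>Basis. (v \<bullet> c) * dirderiv (dirderiv f b) c p))"

lemma differentiable_imp_dirderiv:
  assumes "(\<lambda>t. f (p + t *\<^sub>R v)) differentiable (at 0)"
  shows "((\<lambda>t. f (p + t *\<^sub>R v)) has_real_derivative dirderiv f v p) (at 0)"
  using assms unfolding dirderiv_def by (simp add: DERIV_deriv_iff_real_differentiable)

lemma C2_has_derivative:
  assumes "C2 f"
  shows "(f has_derivative (\<lambda>h. dir_deriv f h p)) (at p)"
    and "b \<in> Basis \<Longrightarrow> (dirderiv f b has_derivative (\<lambda>h. \<Sum>c\<in>Basis. (h \<bullet> c) * dirderiv (dirderiv f b) c p)) (at p)"
  unfolding dir_deriv_def using assms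
  by (auto intro!: has_derivative_continuous_partials differentiable_imp_dirderiv simp: C2_def)

lemma C2_continuous:
  assumes "C2 f"
  shows "continuous_on A f" "continuous_on A (dir_deriv f v)" "continuous_on A (dir_deriv2 f v)"
  unfolding dir_deriv_def dir_deriv2_def using assms
  by (auto intro!: continuous_intros intro: continuous_on_subset simp: C2_def)

lemma C2_line_deriv:
  assumes "C2 f"
  shows "((\<lambda>s. f (p + s *\<^sub>R v)) has_real_derivative dir_deriv f v (p + s *\<^sub>R v)) (at s)"
    and "((\<lambda>s. dir_deriv f v (p + s *\<^sub>R v)) has_real_derivative dir_deriv2 f v (p + s *\<^sub>R v)) (at s)"
proof -
  have l: "((\<lambda>s. p + s *\<^sub>R v) has_derivative (\<lambda>h. h *\<^sub>R v)) (at s)" for s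
    by (auto intro!: derivative_eq_intros)
  have "((\<lambda>s. f (p + s *\<^sub>R v)) has_derivative (\<lambda>h. dir_deriv f (h *\<^sub>R v) (p + s *\<^sub>R v))) (at s)"
    by (rule has_derivative_compose[OF l C2_has_derivative(1)[OF assms]])
  moreover have "(\<lambda>h. dir_deriv f (h *\<^sub>R v) (p + s *\<^sub>R v)) = (*) (dir_deriv f v (p + s *\<^sub>R v))"
    by (auto simp: dir_deriv_def sum_distrib_left mult_ac)
  ultimately show "((\<lambda>s. f (p + s *\<^sub>R v)) has_real_derivative dir_deriv f v (p + s *\<^sub>R v)) (at s)"
    unfolding has_field_derivative_def by simp
  have "((\<lambda>s. dirderiv f b (p + s *\<^sub>R v)) has_real_derivative (\<Sum>c\<in>Basis. (v \<bullet> c) * dirderiv (dirderiv f b) c (p + s *\<^sub>R v))) (at s)"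
    if "b \<in> Basis" for b
  proof -
    have "((\<lambda>s. dirderiv f b (p + s *\<^sub>R v)) has_derivative (\<lambda>h. \<Sum>c\<in>Basis. ((h *\<^sub>R v) \<bullet> c) * dirderiv (dirderiv f b) c (p + s *\<^sub>R v))) (at s)"
      by (rule has_derivative_compose[OF l C2_has_derivative(2)[OF assms that]])
    moreover have "(\<lambda>h. \<Sum>c\<in>Basis. ((h *\<^sub>R v) \<bullet> c) * dirderiv (dirderiv f b) c (p + s *\<^sub>R v))
        = (*) (\<Sum>c\<in>Basis. (v \<bullet> c) * dirderiv (dirderiv f b) c (p + s *\<^sub>R v))"
      by (auto simp: sum_distrib_left mult_ac)
    ultimately show ?thesis
      unfolding has_field_derivative_def by simp
  qed
  then show "((\<lambda>s. dir_deriv f v (p + s *\<^sub>R v)) has_real_derivative dir_deriv2 f v (p + s *\<^sub>R v)) (at s)"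
    unfolding dir_deriv_def dir_deriv2_def by (intro DERIV_sum DERIV_cmult)
qed

section \<open>The ultrahyperbolic operator in reflected coordinates\<close>

lemma sum_Basis_vec: "(\<Sum>b\<in>(Basis :: (real^'n) set). f b) = (\<Sum>i\<in>UNIV. f (axis i 1))"
proof -
  have B: "(Basis :: (real^'n) set) = (\<lambda>i. axis i 1) ` UNIV" by (auto simp: Basis_vec_def)
  have "inj (\<lambda>i::'n. axis i (1::real))" by (auto simp: inj_on_def axis_eq_axis)
  then show ?thesis unfolding B by (rule sum.reindex_cong[OF _ refl]) simp
qed

lemma sum_Basis_prod:
  fixes f :: "'a::euclidean_space \<times> 'b::euclidean_space \<Rightarrow> real"
  shows "(\<Sum>i\<in>Basis. f i) = (\<Sum>i\<in>Basis. f (i, 0)) + (\<Sum>i\<in>Basis. f (0, i))"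
proof -
  have "inj_on (\<lambda>u. (u::'a, 0::'b)) Basis" "inj_on (\<lambda>u. (0::'a, u::'b)) Basis" by (auto simp: inj_on_def)
  moreover have "(\<lambda>u. (u::'a, 0::'b)) ` Basis \<inter> (\<lambda>u. (0::'a, u::'b)) ` Basis = {}" by (auto simp: nonzero_Basis)
  ultimately show ?thesis unfolding Basis_prod_def by (subst sum.union_disjoint) (auto simp: sum.reindex)
qed

lemma dir_deriv2_Basis: "b \<in> Basis \<Longrightarrow> dir_deriv2 f b p = dirderiv (dirderiv f b) b p"
proof -
  assume b: "b \<in> Basis"
  have *: "(\<Sum>c\<in>Basis. (b \<bullet> c) * F c) = F b" for F :: "'a \<Rightarrow> real"
  proof -
    have "(\<Sum>c\<in>Basis. (b \<bullet> c) * F c) = (\<Sum>c\<in>Basis. if c = b then F b else 0)"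
      using b by (intro sum.cong) (auto simp: inner_Basis)
    then show ?thesis using b by simp
  qed
  show ?thesis unfolding dir_deriv2_def * ..
qed

lemma dir_deriv_Basis: "b \<in> Basis \<Longrightarrow> dir_deriv f b p = dirderiv f b p"
proof -
  assume b: "b \<in> Basis"
  have "(\<Sum>c\<in>Basis. (b \<bullet> c) * dirderiv f c p) = (\<Sum>c\<in>Basis. if c = b then dirderiv f b p else 0)"
    using b by (intro sum.cong) (auto simp: inner_Basis)
  then show ?thesis using b by (simp add: dir_deriv_def)
qed

text \<open>In this form y1 and y' make up one Euclidean factor, so that an isometry of the whole
  y-space can be applied.\<close>

lemma ultrahyp_eq:
  fixes u :: "('n::finite, 'm::finite) pt \<Rightarrow> real"
  shows "ultrahyp u p = (\<Sum>b\<in>Basis. dir_deriv2 u (b, 0) p) - (\<Sum>b\<in>Basis. dir_deriv2 u (0, b) p)"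
proof -
  have "(\<Sum>b\<in>Basis. dir_deriv2 u (b, 0) p) = (\<Sum>i\<in>UNIV. dirderiv (dirderiv u (xdir i)) (xdir i) p)"
    unfolding sum_Basis_vec xdir_def
    by (intro sum.cong refl) (simp add: dir_deriv2_Basis Basis_prod_def axis_in_Basis_iff zero_prod_def[symmetric])
  moreover have "(\<Sum>b\<in>Basis. dir_deriv2 u (0, b) p) = dirderiv (dirderiv u y1dir) y1dir p
     + (\<Sum>j\<in>UNIV. dirderiv (dirderiv u (ypdir j)) (ypdir j) p)"
    unfolding sum_Basis_prod sum_Basis_vec xdir_def y1dir_def ypdir_def Basis_real_def
    by (simp add: dir_deriv2_Basis Basis_prod_def axis_in_Basis_iff)
  ultimately show ?thesis by (simp add: ultrahyp_def)
qed

text \<open>Both sides are the trace of the Hessian in y, taken in two orthonormal bases. A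
  reflection is symmetric, so \<open>adj\<close> can move L onto the coordinate vectors k and l,
  where Parseval's identity and \<open>iso\<close> finish.\<close>

lemma sum_dir_deriv2_isometry:
  fixes u :: "'a::euclidean_space \<times> 'y::euclidean_space \<Rightarrow> real"
  assumes iso: "\<And>v w. L v \<bullet> L w = v \<bullet> w" and adj: "\<And>v w. L v \<bullet> w = v \<bullet> L w"
  shows "(\<Sum>b\<in>Basis. dir_deriv2 u (0, L b) p) = (\<Sum>b\<in>Basis. dir_deriv2 u (0, b) p)"
proof -
  define H where "H k l = dirderiv (dirderiv u (0, k)) (0, l) p" for k l
  have e: "dir_deriv2 u (0, y) p = (\<Sum>k\<in>Basis. \<Sum>l\<in>Basis. (y \<bullet> k) * (y \<bullet> l) * H k l)" for y
    unfolding dir_deriv2_def H_def sum_Basis_prod by (simp add: sum_distrib_left mult.assoc)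
  have *: "(\<Sum>b\<in>Basis. dir_deriv2 u (0, M b) p) = (\<Sum>k\<in>Basis. \<Sum>l\<in>Basis. (\<Sum>b\<in>Basis. (M b \<bullet> k) * (M b \<bullet> l)) * H k l)" for M :: "'y \<Rightarrow> 'y"
  proof -
    have "(\<Sum>b\<in>Basis. dir_deriv2 u (0, M b) p) = (\<Sum>b\<in>Basis. \<Sum>k\<in>Basis. \<Sum>l\<in>Basis. (M b \<bullet> k) * (M b \<bullet> l) * H k l)"
      by (simp add: e)
    also have "\<dots> = (\<Sum>k\<in>Basis. \<Sum>b\<in>Basis. \<Sum>l\<in>Basis. (M b \<bullet> k) * (M b \<bullet> l) * H k l)" by (rule sum.swap)
    also have "\<dots> = (\<Sum>k\<in>Basis. \<Sum>l\<in>Basis. \<Sum>b\<in>Basis. (M b \<bullet> k) * (M b \<bullet> l) * H k l)"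
      by (intro sum.cong refl sum.swap)
    finally show ?thesis by (simp add: sum_distrib_right)
  qed
  have 1: "(\<Sum>b\<in>Basis. (L b \<bullet> k) * (L b \<bullet> l)) = k \<bullet> l" for k l
    unfolding adj using euclidean_inner[of "L k" "L l"] by (simp add: iso inner_commute)
  have 2: "(\<Sum>b\<in>Basis. (b \<bullet> k) * (b \<bullet> l)) = k \<bullet> l" for k l :: 'y
    using euclidean_inner[of k l] by (simp add: inner_commute)
  show ?thesis unfolding * *[of "\<lambda>b. b"] 1 2 ..
qed

text \<open>For \<open>e = a\<close> the junk value \<open>x / 0 = 0\<close> turns the Householder reflection into the identity.\<close>

lemma reflection_exists:
  fixes a e :: "'y::real_inner"
  assumes "norm a = 1" "norm e = 1"
  obtains L where "linear L" "L a = e" "\<And>v w. L v \<bullet> L w = v \<bullet> w" "\<And>v w. L v \<bullet> w = v \<bullet> L w"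
proof -
  define n where "n = a - e"
  define L where "L v = v - (2 * (v \<bullet> n) / (n \<bullet> n)) *\<^sub>R n" for v
  have aa: "a \<bullet> a = 1" "e \<bullet> e = 1" using assms by (simp_all add: dot_square_norm)
  have lin: "linear L" by (rule linearI) (auto simp: L_def inner_add_left algebra_simps add_divide_distrib)
  have La: "L a = e"
  proof (cases "a = e")
    case False
    have "n \<bullet> n = 2 * (a \<bullet> n)" using aa by (simp add: n_def inner_diff_left inner_diff_right inner_commute)
    moreover have "n \<bullet> n \<noteq> 0" using False by (simp add: n_def)
    ultimately show ?thesis by (simp add: L_def n_def)
  qed (simp add: L_def n_def)
  have adj: "L v \<bullet> w = v \<bullet> L w" for v w
    by (simp add: L_def inner_diff_left inner_diff_right inner_commute)
  have "L (L v) = v" for v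
  proof (cases "n = 0")
    case False
    then have nn: "n \<bullet> n \<noteq> 0" by simp
    have "(L v) \<bullet> n = - (v \<bullet> n)" using nn by (simp add: L_def inner_diff_left)
    then show ?thesis by (simp add: L_def[of "L v"]) (simp add: L_def)
  qed (simp add: L_def)
  then have "L v \<bullet> L w = v \<bullet> w" for v w by (simp add: adj)
  then show thesis using that lin La adj by blast
qed

text \<open>The reflection L takes (1, 0) to e, hence the vectors (0, y') to the complement of e,
  and preserves the operator. In these coordinates u solves a \<open>cauchy_problem\<close>, used
  with \<rho> = 1/2. The value of \<rho> shapes the initial ellipsoid in the y-directions, but the
  admissible heights are T < r for each value.\<close>

theorem ultrahyp_local_uniqueness:
  fixes u :: "('n::finite, 'm::finite) pt \<Rightarrow> real" and e :: "real \<times> (real^'m)"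
  assumes C: "C2 u" and u: "\<And>p. ultrahyp u p = 0" and e: "norm e = 1" and T: "0 < T" "T < r"
    and init: "\<And>x v. v \<bullet> e = 0 \<Longrightarrow> (norm x)\<^sup>2 + (norm v)\<^sup>2 / 2 < r\<^sup>2 \<Longrightarrow>
      u (x0 + x, y0 + v) = 0 \<and> dir_deriv u (0, e) (x0 + x, y0 + v) = 0"
  shows "u (x0, y0 + T *\<^sub>R e) = 0"
proof -
  have "norm (1::real, 0::real^'m) = 1" by (simp add: norm_Pair)
  then obtain L where L: "linear L" "L (1, 0) = e" "\<And>v w. L v \<bullet> L w = v \<bullet> w" "\<And>v w. L v \<bullet> w = v \<bullet> L w"
    using reflection_exists[OF _ e] by blast
  have Lc: "continuous_on A L" for A using L(1) by (rule linear_continuous_on[OF linear_conv_bounded_linear[THEN iffD1]])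
  define P where "P t z = (x0 + fst z, y0 + t *\<^sub>R e + L (0, snd z))" for t :: real and z :: "(real^'n) \<times> (real^'m)"
  define V where "V b = (fst b, L (0, snd b))" for b :: "(real^'n) \<times> (real^'m)"
  have Lz: "L (0, s *\<^sub>R v) = s *\<^sub>R L (0, v)" "L (0, v + w) = L (0, v) + L (0, w)" for s v w
    using linear_scale[OF L(1), of s "(0, v)"] linear_add[OF L(1), of "(0, v)" "(0, w)"] by simp_all
  have L0: "L (0, 0) = 0" using linear_0[OF L(1)] by (simp add: zero_prod_def)
  define P0 where "P0 z = (x0 + fst z, y0 + L (0, snd z))" for z :: "(real^'n) \<times> (real^'m)"
  have Pt: "P t z = P0 z + t *\<^sub>R (0, e)" for t z by (simp add: P_def P0_def)
  have Pz: "P t (z + s *\<^sub>R b) = P t z + s *\<^sub>R V b" for t z s b by (simp add: P_def V_def Lz)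
  have Pc: "continuous_on A (\<lambda>p. P (fst p) (snd p))" for A
    unfolding P_def by (intro continuous_intros continuous_on_compose2[OF Lc[of UNIV]]) auto
  have Pc2: "continuous_on A (P t)" for A t
    unfolding P_def[abs_def] by (intro continuous_intros continuous_on_compose2[OF Lc[of UNIV]]) auto
  define X :: "((real^'n) \<times> (real^'m)) set" where "X = (\<lambda>b. (b, 0)) ` Basis"
  have X: "(b, 0) \<in> X" if "b \<in> Basis" for b using that by (auto simp: X_def)
  have X': "(0, b) \<notin> X" for b by (auto simp: X_def nonzero_Basis)
  interpret cauchy_problem X "\<lambda>t z. u (P t z)" "\<lambda>t z. dir_deriv u (0, e) (P t z)" "\<lambda>t z. dir_deriv2 u (0, e) (P t z)"
    "\<lambda>b t z. dir_deriv u (V b) (P t z)" "\<lambda>b t z. dir_deriv2 u (V b) (P t z)" "1 / 2" r T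
  proof
    show "((\<lambda>t. u (P t z)) has_real_derivative dir_deriv u (0, e) (P t z)) (at t)"
      "((\<lambda>t. dir_deriv u (0, e) (P t z)) has_real_derivative dir_deriv2 u (0, e) (P t z)) (at t)" for t z
      unfolding Pt by (rule C2_line_deriv[OF C])+
    show "((\<lambda>s. u (P t (z + s *\<^sub>R b))) has_real_derivative dir_deriv u (V b) (P t z)) (at 0)"
      "((\<lambda>s. dir_deriv u (V b) (P t (z + s *\<^sub>R b))) has_real_derivative dir_deriv2 u (V b) (P t z)) (at 0)" for t z b
      unfolding Pz using C2_line_deriv[OF C, where p = "P t z" and v = "V b" and s = 0] by simp_all
    show "continuous_on UNIV (\<lambda>(t, z). u (P t z))" "continuous_on UNIV (\<lambda>(t, z). dir_deriv u (0, e) (P t z))"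
      "continuous_on UNIV (\<lambda>(t, z). dir_deriv2 u (0, e) (P t z))"
      unfolding split_beta
      by (rule continuous_on_compose2[OF C2_continuous(1)[OF C, of UNIV] Pc] continuous_on_compose2[OF C2_continuous(2)[OF C, of UNIV] Pc]
          continuous_on_compose2[OF C2_continuous(3)[OF C, of UNIV] Pc]; simp)+
    show "continuous_on UNIV (\<lambda>z. dir_deriv u (V b) (P t z))" "continuous_on UNIV (\<lambda>z. dir_deriv2 u (V b) (P t z))" for b t
      by (rule continuous_on_compose2[OF C2_continuous(2)[OF C, of UNIV] Pc2] continuous_on_compose2[OF C2_continuous(3)[OF C, of UNIV] Pc2]; simp)+
    show "dir_deriv2 u (0, e) (P t z) = (\<Sum>b\<in>Basis. dir_sign X b * dir_deriv2 u (V b) (P t z))" for t z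
    proof -
      have "(\<Sum>b\<in>Basis. dir_deriv2 u (b, 0) (P t z)) = (\<Sum>b\<in>Basis. dir_deriv2 u (0, b) (P t z))"
        using u[of "P t z"] by (simp add: ultrahyp_eq)
      also have "\<dots> = (\<Sum>b\<in>Basis. dir_deriv2 u (0, L b) (P t z))" by (rule sum_dir_deriv2_isometry[OF L(3,4), symmetric])
      also have "\<dots> = dir_deriv2 u (0, e) (P t z) + (\<Sum>b\<in>Basis. dir_deriv2 u (0, L (0, b)) (P t z))"
        unfolding sum_Basis_prod Basis_real_def by (simp add: L(2))
      finally have "dir_deriv2 u (0, e) (P t z) = (\<Sum>b\<in>Basis. dir_deriv2 u (b, 0) (P t z)) - (\<Sum>b\<in>Basis. dir_deriv2 u (0, L (0, b)) (P t z))"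
        by simp
      also have "\<dots> = (\<Sum>b\<in>Basis. dir_sign X b * dir_deriv2 u (V b) (P t z))"
        unfolding sum_Basis_prod by (simp add: dir_sign_def X X' V_def L0 sum_negf)
      finally show ?thesis .
    qed
    have I: "u (P 0 z) = 0 \<and> dir_deriv u (0, e) (P 0 z) = 0"
      if "(\<Sum>b\<in>Basis. (if b \<in> X then 1 else 1 / 2) * (z \<bullet> b)\<^sup>2) < r\<^sup>2" for z
    proof -
      have n: "(norm v)\<^sup>2 = (\<Sum>b\<in>Basis. (v \<bullet> b)\<^sup>2)" for v :: "'q::euclidean_space"
        unfolding power2_norm_eq_inner by (subst euclidean_inner) (simp add: power2_eq_square)
      have "(norm (fst z))\<^sup>2 + (norm (snd z))\<^sup>2 / 2 < r\<^sup>2"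
        using that unfolding sum_Basis_prod by (simp add: X X' n inner_prod_def sum_divide_distrib)
      moreover have "norm (L (0, snd z)) = norm (snd z)"
        by (simp add: norm_eq_sqrt_inner L(3))
      moreover have "L (0, snd z) \<bullet> e = 0" using L(3)[of "(0, snd z)" "(1, 0)"] L(2) by (simp add: inner_prod_def)
      ultimately show ?thesis using init[of "L (0, snd z)" "fst z"] by (simp add: P_def)
    qed
    show "(\<Sum>b\<in>Basis. (if b \<in> X then 1 else 1 / 2) * (z \<bullet> b)\<^sup>2) < r\<^sup>2 \<Longrightarrow> u (P 0 z) = 0" for z using I by blast
    show "(\<Sum>b\<in>Basis. (if b \<in> X then 1 else 1 / 2) * (z \<bullet> b)\<^sup>2) < r\<^sup>2 \<Longrightarrow> dir_deriv u (0, e) (P 0 z) = 0" for z using I by blast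
  qed (use T in auto)
  show ?thesis using vanishing by (simp add: P_def L0)
qed

section \<open>Sweeping by cones\<close>

text \<open>Where u vanishes on an open set, its first derivatives vanish too, so the Cauchy data
  are zero on every piece of hyperplane inside that set.\<close>

lemma ultrahyp_local_uniqueness_open:
  fixes u :: "('n::finite, 'm::finite) pt \<Rightarrow> real" and e :: "real \<times> (real^'m)"
  assumes C: "C2 u" and u: "\<And>p. ultrahyp u p = 0" and e: "norm e = 1" and T: "0 < T" "T < r"
    and W: "open W" "\<And>p. p \<in> W \<Longrightarrow> u p = 0"
    and sub: "\<And>x v. v \<bullet> e = 0 \<Longrightarrow> (norm x)\<^sup>2 + (norm v)\<^sup>2 / 2 < r\<^sup>2 \<Longrightarrow> (x0 + x, y0 + v) \<in> W"
  shows "u (x0, y0 + T *\<^sub>R e) = 0"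
proof (rule ultrahyp_local_uniqueness[OF C u e T])
  have dd: "dir_deriv u v p = 0" if "p \<in> W" for v p
  proof -
    have "((\<lambda>s. u (p + s *\<^sub>R v)) has_real_derivative dir_deriv u v p) (at 0)"
      using C2_line_deriv(1)[OF C, where p = p and v = v and s = 0] by simp
    moreover have "((\<lambda>s. u (p + s *\<^sub>R v)) has_real_derivative 0) (at 0)"
    proof (rule has_field_derivative_transform_within_open[where f = "\<lambda>_. 0" and S = "(\<lambda>s. p + s *\<^sub>R v) -` W"])
      show "open ((\<lambda>s. p + s *\<^sub>R v) -` W)" using W(1) by (intro open_vimage continuous_intros)
    qed (use that W(2) in auto)
    ultimately show ?thesis by (rule DERIV_unique)
  qed
  show "u (x0 + x, y0 + v) = 0 \<and> dir_deriv u (0, e) (x0 + x, y0 + v) = 0"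
    if "v \<bullet> e = 0" "(norm x)\<^sup>2 + (norm v)\<^sup>2 / 2 < r\<^sup>2" for x v
    using W(2) dd sub[OF that] by simp
qed

lemma dir_deriv_scale: "dir_deriv f (s *\<^sub>R v) p = s * dir_deriv f v p"
  by (simp add: dir_deriv_def sum_distrib_left mult_ac)

text \<open>For \<kappa> = 1 the cone is the set D. For \<kappa> > 0 the inequality excludes |x|
  \<ge> 1 by itself, as its right side is then not positive.\<close>

definition vanishes_on_cone :: "('a::real_normed_vector \<times> 'b::real_normed_vector \<Rightarrow> real) \<Rightarrow> real \<Rightarrow> bool" where
  "vanishes_on_cone u \<kappa> \<longleftrightarrow> (\<forall>x y. norm y < \<kappa> * (1 - norm x) \<longrightarrow> u (x, y) = 0)"

lemma vanishes_on_coneD: "vanishes_on_cone u \<kappa> \<Longrightarrow> norm y < \<kappa> * (1 - norm x) \<Longrightarrow> u (x, y) = 0"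
  unfolding vanishes_on_cone_def by blast

lemma vanishes_on_cone_mono:
  fixes u :: "'a::real_normed_vector \<times> 'b::real_normed_vector \<Rightarrow> real"
  assumes "vanishes_on_cone u \<kappa>'" "\<kappa> \<le> \<kappa>'" "0 < \<kappa>"
  shows "vanishes_on_cone u \<kappa>"
  unfolding vanishes_on_cone_def
proof (intro allI impI)
  fix x :: 'a and y :: 'b assume y: "norm y < \<kappa> * (1 - norm x)"
  then have "0 < \<kappa> * (1 - norm x)" using norm_ge_zero[of y] by linarith
  then have "0 < 1 - norm x" using assms(3) by (simp add: zero_less_mult_iff)
  then have "\<kappa> * (1 - norm x) \<le> \<kappa>' * (1 - norm x)" using assms(2) by (intro mult_right_mono) auto
  then show "u (x, y) = 0" using vanishes_on_coneD[OF assms(1)] y by simp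
qed

text \<open>Start at (x0, 0, y') and move along the y1-axis by |y1|. The constant 6 leaves room:
  with r = \<epsilon> (1 - |x0|) / 6, the ellipsoid of the local uniqueness theorem displaces x by
  at most r and y' by at most 2 r, and the displaced points stay in the ellipsoid of the given
  data.\<close>

lemma vanishes_on_initial_cone:
  fixes u :: "('n::finite, 'm::finite) pt \<Rightarrow> real"
  assumes \<epsilon>: "0 < \<epsilon>" "\<epsilon> \<le> 1" and C: "C2 u" and u: "\<And>p. ultrahyp u p = 0"
    and u0: "\<And>x y'. norm x ^ 2 + norm y' ^ 2 / \<epsilon> ^ 2 < 1 \<Longrightarrow> u (x, (0, y')) = 0"
    and u1: "\<And>x y'. norm x ^ 2 + norm y' ^ 2 / \<epsilon> ^ 2 < 1 \<Longrightarrow> dirderiv u y1dir (x, (0, y')) = 0"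
  shows "vanishes_on_cone u (\<epsilon> / 6)"
  unfolding vanishes_on_cone_def
proof (intro allI impI)
  fix x0 :: "real^'n" and y :: "real \<times> (real^'m)"
  assume y: "norm y < \<epsilon> / 6 * (1 - norm x0)"
  define m where "m = 1 - norm x0"
  define r where "r = \<epsilon> / 6 * m"
  obtain y1 y' where yy: "y = (y1, y')" by (cases y)
  have yr: "norm y < r" using y by (simp add: r_def m_def)
  have "\<bar>y1\<bar> < r" "norm y' < r"
    using yr norm_fst_le[of y1 y'] norm_snd_le[of y' y1] by (simp_all add: yy)
  have r0: "0 < r" using yr norm_ge_zero[of y] by linarith
  then have m: "0 < m" "m \<le> 1" using \<epsilon> by (auto simp: r_def m_def zero_less_mult_iff)
  have Z: "norm (x0 + x) ^ 2 + norm (y' + v) ^ 2 / \<epsilon> ^ 2 < 1" if "norm x \<le> r" "norm v \<le> 2 * r" for x v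
  proof -
    \<comment> \<open>With m = 1 - |x0| one has |x0| + r = 1 - q m and 3 r / \<epsilon> = m / 2, so
      it suffices that (1 - q m)^2 + m^2 / 4 < 1, that is, m (q^2 + 1/4) < 2 q.\<close>
    define q where "q = 1 - \<epsilon> / 6"
    have q: "1 / 4 < q" "q < 1" using \<epsilon> by (auto simp: q_def)
    have "norm (x0 + x) \<le> norm x0 + r" using norm_triangle_ineq[of x0 x] that by linarith
    also have "\<dots> = 1 - q * m" by (simp add: q_def r_def m_def algebra_simps)
    finally have 1: "norm (x0 + x) ^ 2 \<le> (1 - q * m) ^ 2" by (intro power_mono) auto
    have "norm (y' + v) \<le> 3 * r" using norm_triangle_ineq[of y' v] that \<open>norm y' < r\<close> by linarith
    then have "norm (y' + v) / \<epsilon> \<le> m / 2" using \<epsilon> by (simp add: r_def field_simps)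
    then have "(norm (y' + v) / \<epsilon>) ^ 2 \<le> (m / 2) ^ 2" using \<epsilon> by (intro power_mono) auto
    then have 2: "norm (y' + v) ^ 2 / \<epsilon> ^ 2 \<le> m\<^sup>2 / 4" by (simp add: power_divide)
    have "q\<^sup>2 + 1 / 4 < 2 * q"
    proof -
      have "q\<^sup>2 \<le> q" using q by (simp add: power2_eq_square)
      then show ?thesis using q by linarith
    qed
    then have "m * (q\<^sup>2 + 1 / 4) < 2 * q"
      using mult_right_mono[of m 1 "q\<^sup>2 + 1 / 4"] m q by simp
    then have "m * (m * (q\<^sup>2 + 1 / 4)) < m * (2 * q)" using m by (intro mult_strict_left_mono)
    then have "(1 - q * m) ^ 2 + m\<^sup>2 / 4 < 1" by (simp add: power2_eq_square algebra_simps)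
    then show ?thesis using 1 2 by linarith
  qed
  show "u (x0, y) = 0"
  \<comment> \<open>On the initial hyperplane the hypothesis on u applies directly; there
    \<open>sgn y1\<close> is 0 and would give no unit conormal.\<close>
  proof (cases "y1 = 0")
    case True
    have "norm x0 ^ 2 + norm y' ^ 2 / \<epsilon> ^ 2 < 1" using Z[of 0 0] r0 by simp
    then show ?thesis using u0 True yy by simp
  next
    case False
    define e :: "real \<times> (real^'m)" where "e = (sgn y1, 0)"
    have e: "norm e = 1" using False by (simp add: e_def norm_Pair)
    have e': "(0, e) = sgn y1 *\<^sub>R (y1dir :: ('n, 'm) pt)" by (simp add: e_def y1dir_def)
    have y1B: "(y1dir :: ('n, 'm) pt) \<in> Basis" by (simp add: y1dir_def Basis_prod_def)
    have "u (x0, (0, y') + \<bar>y1\<bar> *\<^sub>R e) = 0"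
    proof (rule ultrahyp_local_uniqueness[OF C u e])
      show "0 < \<bar>y1\<bar>" "\<bar>y1\<bar> < r" using False \<open>\<bar>y1\<bar> < r\<close> by auto
      fix x :: "real^'n" and v :: "real \<times> (real^'m)"
      assume ve: "v \<bullet> e = 0" and xv: "(norm x)\<^sup>2 + (norm v)\<^sup>2 / 2 < r\<^sup>2"
      obtain v' where v: "v = (0, v')"
        using ve False by (cases v) (auto simp: e_def sgn_if split: if_splits)
      have "(norm x)\<^sup>2 \<le> r\<^sup>2 \<and> (norm v)\<^sup>2 \<le> 4 * r\<^sup>2"
        using xv zero_le_power2[of "norm x"] zero_le_power2[of "norm v"] by linarith
      then have "(norm x)\<^sup>2 \<le> r\<^sup>2" "(norm v)\<^sup>2 \<le> (2 * r)\<^sup>2" by (simp_all add: power_mult_distrib)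
      then have "norm x \<le> r" "norm v \<le> 2 * r"
        using power2_le_imp_le[of "norm x" r] power2_le_imp_le[of "norm v" "2 * r"] r0 by simp_all
      then have z: "norm (x0 + x) ^ 2 + norm (y' + v') ^ 2 / \<epsilon> ^ 2 < 1" using Z by (simp add: v norm_Pair)
      show "u (x0 + x, (0, y') + v) = 0 \<and> dir_deriv u (0, e) (x0 + x, (0, y') + v) = 0"
        using u0[OF z] u1[OF z] unfolding e' dir_deriv_scale dir_deriv_Basis[OF y1B] by (simp add: v)
    qed
    moreover have "(0, y') + \<bar>y1\<bar> *\<^sub>R e = y" by (simp add: e_def yy abs_mult_sgn)
    ultimately show ?thesis by simp
  qed
qed

text \<open>Let m = 1 - |x0|. A chord orthogonal to y at height \<beta> m, with radius \<theta> m,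
  lies in the old cone, and local uniqueness then reaches every height below (\<beta> + \<theta>) m.
  To first order in \<theta>, \<beta> is \<kappa> - \<kappa> \<theta>, so the gain is (1 - \<kappa>)
  \<theta>, which is positive for \<kappa> < 1.\<close>

lemma vanishes_on_larger_cone:
  fixes u :: "('n::finite, 'm::finite) pt \<Rightarrow> real"
  assumes C: "C2 u" and u: "\<And>p. ultrahyp u p = 0" and \<kappa>: "0 < \<kappa>" "\<kappa> < 1" and V: "vanishes_on_cone u \<kappa>"
  obtains \<kappa>' where "\<kappa> < \<kappa>'" "vanishes_on_cone u \<kappa>'"
proof -
  \<comment> \<open>Small enough for the quadratic terms not to consume the first-order gain: 2
    \<kappa> (1 - \<kappa>) \<theta> equals 4 \<theta>^2, which exceeds the loss 3
    \<theta>^2.\<close>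
  define \<theta> where "\<theta> = \<kappa> * (1 - \<kappa>) / 2"
  have "\<kappa> * (1 - \<kappa>) \<le> \<kappa> * 1" using \<kappa> by (intro mult_left_mono) auto
  then have \<theta>: "0 < \<theta>" "\<theta> < \<kappa>" using \<kappa> by (simp_all add: \<theta>_def)
  \<comment> \<open>Chosen so that \<beta>^2 + 2 \<theta>^2 = (\<kappa> (1 - \<theta>))^2: the ends
    of the chord, where |v|^2 tends to 2 (\<theta> m)^2, just fit into the cone at norm 1 - (1 -
    \<theta>) m, the largest norm of a displaced x.\<close>
  define \<beta> where "\<beta> = sqrt (\<kappa>\<^sup>2 * (1 - \<theta>)\<^sup>2 - 2 * \<theta>\<^sup>2)"
  have "\<kappa>\<^sup>2 * (1 - \<theta>)\<^sup>2 - 2 * \<theta>\<^sup>2 - (\<kappa> - \<theta>)\<^sup>2 = (2 * \<kappa> * (1 - \<kappa>)) * \<theta> + \<kappa>\<^sup>2 * \<theta>\<^sup>2 - 3 * \<theta>\<^sup>2"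
    by (simp add: power2_eq_square algebra_simps)
  also have "2 * \<kappa> * (1 - \<kappa>) = 4 * \<theta>" by (simp add: \<theta>_def)
  also have "4 * \<theta> * \<theta> + \<kappa>\<^sup>2 * \<theta>\<^sup>2 - 3 * \<theta>\<^sup>2 = \<theta>\<^sup>2 + \<kappa>\<^sup>2 * \<theta>\<^sup>2" by (simp add: power2_eq_square)
  also have "0 < \<theta>\<^sup>2 + \<kappa>\<^sup>2 * \<theta>\<^sup>2" using \<theta> by (simp add: add_pos_nonneg)
  finally have gt: "(\<kappa> - \<theta>)\<^sup>2 < \<kappa>\<^sup>2 * (1 - \<theta>)\<^sup>2 - 2 * \<theta>\<^sup>2" by simp
  then have "\<kappa> - \<theta> < \<beta>" unfolding \<beta>_def by (rule real_less_rsqrt)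
  have \<beta>2: "\<beta>\<^sup>2 = \<kappa>\<^sup>2 * (1 - \<theta>)\<^sup>2 - 2 * \<theta>\<^sup>2"
    unfolding \<beta>_def using gt zero_le_power2[of "\<kappa> - \<theta>"] by (intro real_sqrt_pow2) linarith
  have \<beta>0: "0 \<le> \<beta>" using \<open>\<kappa> - \<theta> < \<beta>\<close> \<theta> by linarith
  \<comment> \<open>Points with |y| < \<kappa> m are in the old cone. For the others \<beta> <
    \<kappa> makes the remaining distance |y| - \<beta> m positive.\<close>
  have "\<beta> < \<kappa>"
  proof (rule power2_less_imp_less)
    have "(1 - \<theta>)\<^sup>2 \<le> 1" using \<theta> \<kappa> by (intro power_le_one) auto
    then have "\<kappa>\<^sup>2 * (1 - \<theta>)\<^sup>2 \<le> \<kappa>\<^sup>2" by (simp add: mult_left_le)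
    moreover have "0 < \<theta>\<^sup>2" using \<theta> by simp
    ultimately show "\<beta>\<^sup>2 < \<kappa>\<^sup>2" unfolding \<beta>2 by linarith
  qed (use \<kappa> in simp)
  have "vanishes_on_cone u (\<beta> + \<theta>)"
    unfolding vanishes_on_cone_def
  proof (intro allI impI)
    fix x0 :: "real^'n" and y :: "real \<times> (real^'m)"
    assume y: "norm y < (\<beta> + \<theta>) * (1 - norm x0)"
    define m where "m = 1 - norm x0"
    have y': "norm y < (\<beta> + \<theta>) * m" using y by (simp add: m_def)
    then have "0 < (\<beta> + \<theta>) * m" using norm_ge_zero[of y] by linarith
    then have m: "0 < m" using \<theta> \<beta>0 by (simp add: zero_less_mult_iff)
    show "u (x0, y) = 0"
    proof (cases "norm y < \<kappa> * m")
      case True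
      then show ?thesis using vanishes_on_coneD[OF V] by (simp add: m_def)
    next
      case False
      have bk: "\<beta> * m < \<kappa> * m" using \<open>\<beta> < \<kappa>\<close> m by simp
      have "0 < \<kappa> * m" using \<kappa> m by simp
      then have y0: "0 < norm y" using False by linarith
      define e where "e = (1 / norm y) *\<^sub>R y"
      have e: "norm e = 1" using y0 by (simp add: e_def)
      define W where "W = {p :: ('n, 'm) pt. norm (snd p) < \<kappa> * (1 - norm (fst p))}"
      have "u (x0, (\<beta> * m) *\<^sub>R e + (norm y - \<beta> * m) *\<^sub>R e) = 0"
      proof (rule ultrahyp_local_uniqueness_open[OF C u e, where r = "\<theta> * m" and W = W])
        show "0 < norm y - \<beta> * m" using False bk by linarith
        show "norm y - \<beta> * m < \<theta> * m" using y' by (simp add: algebra_simps)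
        show "open W" unfolding W_def by (intro open_Collect_less continuous_intros)
        show "u p = 0" if "p \<in> W" for p using that vanishes_on_coneD[OF V, of "snd p" "fst p"] by (simp add: W_def)
        fix x :: "real^'n" and v :: "real \<times> (real^'m)"
        assume ve: "v \<bullet> e = 0" and xv: "(norm x)\<^sup>2 + (norm v)\<^sup>2 / 2 < (\<theta> * m)\<^sup>2"
        have "(norm x)\<^sup>2 \<le> (\<theta> * m)\<^sup>2" using xv zero_le_power2[of "norm v"] by linarith
        then have "norm x \<le> \<theta> * m" by (rule power2_le_imp_le) (use \<theta> m in simp)
        then have "norm (x0 + x) \<le> 1 - (1 - \<theta>) * m"
          using norm_triangle_ineq[of x0 x] by (simp add: m_def algebra_simps)
        then have 1: "\<kappa> * ((1 - \<theta>) * m) \<le> \<kappa> * (1 - norm (x0 + x))" using \<kappa> by (intro mult_left_mono) auto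
        have ev: "orthogonal ((\<beta> * m) *\<^sub>R e) v" using ve by (simp add: orthogonal_def inner_commute)
        have "(norm ((\<beta> * m) *\<^sub>R e + v))\<^sup>2 = (\<beta> * m)\<^sup>2 + (norm v)\<^sup>2"
          unfolding norm_add_Pythagorean[OF ev] norm_scaleR e by simp
        also have "\<dots> < (\<beta> * m)\<^sup>2 + 2 * (\<theta> * m)\<^sup>2" using xv zero_le_power2[of "norm x"] by linarith
        also have "\<dots> = (\<kappa> * ((1 - \<theta>) * m))\<^sup>2" unfolding power_mult_distrib \<beta>2 by (simp add: algebra_simps)
        finally have "norm ((\<beta> * m) *\<^sub>R e + v) < \<kappa> * ((1 - \<theta>) * m)"
          by (rule power2_less_imp_less) (use \<kappa> \<theta> m in simp)
        then show "(x0 + x, (\<beta> * m) *\<^sub>R e + v) \<in> W" using 1 by (simp add: W_def)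
      qed
      moreover have "(\<beta> * m) *\<^sub>R e + (norm y - \<beta> * m) *\<^sub>R e = y"
        using y0 by (simp add: e_def scaleR_add_left[symmetric] add_divide_distrib[symmetric])
      ultimately show ?thesis by simp
    qed
  qed
  moreover have "\<kappa> < \<beta> + \<theta>" using \<open>\<kappa> - \<theta> < \<beta>\<close> by linarith
  ultimately show thesis using that by blast
qed

theorem theorem11:
  fixes u :: "('n::finite, 'm::finite) pt \<Rightarrow> real" and \<epsilon> :: real
  assumes "0 < \<epsilon>" and "\<epsilon> \<le> 1"
    and "C2 u"
    and "\<And>p. ultrahyp u p = 0"
    and "\<And>x y'. norm x ^ 2 + norm y' ^ 2 / \<epsilon> ^ 2 < 1 \<Longrightarrow> u (x, (0, y')) = 0"
    and "\<And>x y'. norm x ^ 2 + norm y' ^ 2 / \<epsilon> ^ 2 < 1 \<Longrightarrow> dirderiv u y1dir (x, (0, y')) = 0"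
  shows "\<forall>x y. norm x + norm y < 1 \<longrightarrow> u (x, y) = 0"
proof -
  define S where "S = {\<kappa>. 0 < \<kappa> \<and> \<kappa> \<le> 1 \<and> vanishes_on_cone u \<kappa>}"
  have "\<epsilon> / 6 \<in> S" using vanishes_on_initial_cone[OF assms] assms(1,2) by (simp add: S_def)
  then have ne: "S \<noteq> {}" by blast
  have bdd: "bdd_above S" by (rule bdd_aboveI[of _ 1]) (simp add: S_def)
  define \<sigma> where "\<sigma> = Sup S"
  have up: "\<kappa> \<le> \<sigma>" if "\<kappa> \<in> S" for \<kappa> unfolding \<sigma>_def by (rule cSup_upper[OF that bdd])
  have \<sigma>0: "0 < \<sigma>" using up[OF \<open>\<epsilon> / 6 \<in> S\<close>] assms(1) by simp
  have \<sigma>1: "\<sigma> \<le> 1" unfolding \<sigma>_def by (rule cSup_least[OF ne]) (simp add: S_def)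
  \<comment> \<open>The supremum is attained: the inequality defining the cone is strict, so each
    point of the cone of slope \<sigma> already lies in a cone whose slope belongs to
    \<open>S\<close>.\<close>
  have V: "vanishes_on_cone u \<sigma>"
    unfolding vanishes_on_cone_def
  proof (intro allI impI)
    fix x :: "real^'n" and y :: "real \<times> (real^'m)" assume y: "norm y < \<sigma> * (1 - norm x)"
    then have "0 < \<sigma> * (1 - norm x)" using norm_ge_zero[of y] by linarith
    then have m: "0 < 1 - norm x" using \<sigma>0 by (simp add: zero_less_mult_iff)
    then have "norm y / (1 - norm x) < Sup S" using y by (simp add: \<sigma>_def field_simps)
    then obtain \<kappa> where "\<kappa> \<in> S" "norm y / (1 - norm x) < \<kappa>" using less_cSup_iff[OF ne bdd] by blast
    then show "u (x, y) = 0" using m vanishes_on_coneD[of u \<kappa> y x] by (simp add: S_def pos_divide_less_eq)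
  qed
  have "\<sigma> = 1"
  proof (rule ccontr)
    assume "\<sigma> \<noteq> 1"
    then have "\<sigma> < 1" using \<sigma>1 by simp
    then obtain \<kappa>' where k: "\<sigma> < \<kappa>'" "vanishes_on_cone u \<kappa>'"
      using vanishes_on_larger_cone[OF assms(3,4) \<sigma>0 _ V] by blast
    have "min \<kappa>' 1 \<in> S" using k \<sigma>0 vanishes_on_cone_mono[OF k(2), of "min \<kappa>' 1"] by (simp add: S_def)
    then have "min \<kappa>' 1 \<le> \<sigma>" by (rule up)
    then show False using k \<open>\<sigma> < 1\<close> by simp
  qed
  then show ?thesis using vanishes_on_coneD[OF V] by simp
qed

end
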